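(* Assume that $Q\in H^{1/2}(\mathbb{R})$ is non-negative, not identically zero, and satisfies $$TQ-Q^2=-\tfrac{2}{\pi}Q\qquad\text{in }\mathbb{R}.$$ Then there is an $\alpha\in\mathbb{R}$ such that $Q(t)=h(t-\alpha)$, where $h(t)=\dfrac{1}{\cosh t}$. Moreover, $$\ker\left(T-2Q+\tfrac{2}{\pi}\right)=\operatorname{span}\{Q'\}.$$
   Context: The Fourier transform on $\mathbb{R}$ is $\widehat\phi(\tau)=(2\pi)^{-1/2}\int_{\mathbb{R}} e^{-i\tau t}\phi(t)\,dt$. $T$ is the non-local pseudo-differential operator given by $$\widehat{T\phi}(\tau)=\left(\tau\coth(\pi\tau/2)-2/\pi\right)\widehat\phi(\tau)$$ (the function $\tau\coth(\pi\tau/2)$ is extended by its limit $2/\pi$ at $\tau=0$). The equation for $Q$ is understood in $H^{-1/2}(\mathbb{R})$, that is, for every $\phi\in H^{1/2}(\mathbb{R})$ $$\int_{\mathbb{R}}\tau\coth(\pi\tau/2)\,\overline{\widehat\phi(\tau)}\,\widehat Q(\tau)\,d\tau=\int_{\mathbb{R}}\overline{\phi(t)}\,Q(t)^2\,dt.$$ In $T-2Q+\tfrac{2}{\pi}$, the symbol $Q$ denotes multiplication by the function $Q$; the operator acts in $L^2(\mathbb{R})$ (complex-valued functions), and the span is over $\mathbb{C}$. *)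

theory Defs
  imports "HOL-Analysis.Analysis"
begin

text \<open>Elements of \<open>L\<^sup>2(\<real>)\<close> are represented by Borel functions; equality in
  \<open>L\<^sup>2(\<real>)\<close> is equality almost everywhere with respect to \<^const>\<open>lborel\<close>.\<close>

definition L2 :: "(real \<Rightarrow> complex) set" where
  "L2 = {f \<in> borel_measurable lborel. integrable lborel (\<lambda>t. (norm (f t))\<^sup>2)}"

definition fourier_integral :: "(real \<Rightarrow> complex) \<Rightarrow> real \<Rightarrow> complex" where
  "fourier_integral \<phi> \<tau> =
     complex_of_real (1 / sqrt (2 * pi)) *
       (LINT t|lborel. exp (- (\<i> * complex_of_real (\<tau> * t))) * \<phi> t)"

text \<open>The integral above need not exist for \<open>\<phi>\<close> in \<^const>\<open>L2\<close>. As usual, the Fourier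
  transform on \<open>L\<^sup>2(\<real>)\<close> is the limit in \<open>L\<^sup>2\<close>-norm of the transforms of the truncations of
  \<open>\<phi>\<close> to \<open>[-n, n]\<close>. It is determined only up to null sets, so the choice below merely
  picks a representative. The norm is a nonnegative integral because the Bochner integral
  of a non-integrable function would be \<open>0\<close>.\<close>

definition is_fourier_L2 :: "(real \<Rightarrow> complex) \<Rightarrow> (real \<Rightarrow> complex) \<Rightarrow> bool" where
  "is_fourier_L2 \<phi> g \<longleftrightarrow> g \<in> L2 \<and>
     (\<lambda>n::nat. \<integral>\<^sup>+\<tau>. ennreal ((norm (g \<tau> -
         fourier_integral (\<lambda>t. indicator {- real n..real n} t * \<phi> t) \<tau>))\<^sup>2) \<partial>lborel)
       \<longlonglongrightarrow> 0"

definition fourier_L2 :: "(real \<Rightarrow> complex) \<Rightarrow> real \<Rightarrow> complex" where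
  "fourier_L2 \<phi> = (SOME g. is_fourier_L2 \<phi> g)"

definition H_half :: "(real \<Rightarrow> complex) set" where
  "H_half = {\<phi> \<in> L2. integrable lborel (\<lambda>\<tau>. sqrt (1 + \<tau>\<^sup>2) * (norm (fourier_L2 \<phi> \<tau>))\<^sup>2)}"

text \<open>The function \<open>\<tau> coth (\<pi>\<tau>/2)\<close>, extended continuously to \<open>\<tau> = 0\<close>.\<close>

definition tau_coth :: "real \<Rightarrow> real" where
  "tau_coth \<tau> = (if \<tau> = 0 then 2 / pi else \<tau> * (cosh (pi * \<tau> / 2) / sinh (pi * \<tau> / 2)))"

text \<open>The equation \<open>T Q - Q\<^sup>2 = - (2/\<pi>) Q\<close> in \<open>H\<^sup>-\<^sup>1\<^sup>/\<^sup>2(\<real>)\<close>; the term \<open>- (2/\<pi>) Q\<close> cancels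
  against the constant in the symbol of \<open>T\<close>. For \<open>Q\<close> in \<^const>\<open>H_half\<close> both integrands are
  integrable: the left one by Cauchy--Schwarz, the right one by the Sobolev embedding of
  \<open>H\<^sup>1\<^sup>/\<^sup>2(\<real>)\<close> into \<open>L\<^sup>4(\<real>)\<close>.\<close>

definition solves_Q_equation :: "(real \<Rightarrow> real) \<Rightarrow> bool" where
  "solves_Q_equation Q \<longleftrightarrow>
     (\<forall>\<phi>\<in>H_half.
        (LINT \<tau>|lborel. complex_of_real (tau_coth \<tau>) * cnj (fourier_L2 \<phi> \<tau>) *
            fourier_L2 (\<lambda>t. complex_of_real (Q t)) \<tau>) =
        (LINT t|lborel. cnj (\<phi> t) * complex_of_real ((Q t)\<^sup>2)))"

text \<open>\<open>T\<close> as an unbounded operator in \<open>L\<^sup>2(\<real>)\<close> with its maximal domain: the graph consists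
  of the pairs \<open>(\<psi>, u)\<close> with \<open>u = T \<psi>\<close>.\<close>

definition T_graph :: "((real \<Rightarrow> complex) \<times> (real \<Rightarrow> complex)) set" where
  "T_graph = {(\<psi>, u). \<psi> \<in> L2 \<and> u \<in> L2 \<and>
     (AE \<tau> in lborel. fourier_L2 u \<tau> = complex_of_real (tau_coth \<tau> - 2 / pi) * fourier_L2 \<psi> \<tau>)}"

text \<open>The kernel of \<open>T - 2 Q + 2/\<pi>\<close>. Since \<open>\<psi>\<close> and \<open>T \<psi>\<close> lie in \<open>L\<^sup>2(\<real>)\<close>, the equation itself
  forces \<open>Q \<psi>\<close> to be in \<open>L\<^sup>2(\<real>)\<close>, so the domain of multiplication by \<open>Q\<close> needs no mention.\<close>

definition kernel_linearized :: "(real \<Rightarrow> real) \<Rightarrow> (real \<Rightarrow> complex) set" where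
  "kernel_linearized Q = {\<psi>. \<exists>u. (\<psi>, u) \<in> T_graph \<and>
     (AE t in lborel. u t - 2 * complex_of_real (Q t) * \<psi> t + complex_of_real (2 / pi) * \<psi> t = 0)}"

text \<open>\<open>Q\<close> is only given up to null sets, so \<open>Q'\<close> is the weak derivative.\<close>

definition test_function :: "(real \<Rightarrow> real) \<Rightarrow> bool" where
  "test_function \<phi> \<longleftrightarrow> (\<forall>k t. (deriv ^^ k) \<phi> differentiable (at t)) \<and>
     (\<exists>R. \<forall>t. \<bar>t\<bar> > R \<longrightarrow> \<phi> t = 0)"

definition has_weak_derivative :: "(real \<Rightarrow> real) \<Rightarrow> (real \<Rightarrow> real) \<Rightarrow> bool" where
  "has_weak_derivative f g \<longleftrightarrow>
     (\<forall>a b. set_integrable lborel {a..b} f \<and> set_integrable lborel {a..b} g) \<and>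
     (\<forall>\<phi>. test_function \<phi> \<longrightarrow>
        (LINT t|lborel. f t * deriv \<phi> t) = - (LINT t|lborel. g t * \<phi> t))"

text \<open>The complex span of a single element, as a subspace of \<open>L\<^sup>2(\<real>)\<close>.\<close>

definition span_L2 :: "(real \<Rightarrow> complex) \<Rightarrow> (real \<Rightarrow> complex) set" where
  "span_L2 f = {\<psi> \<in> L2. \<exists>c::complex. AE t in lborel. \<psi> t = c * f t}"

end

theory Submission
  imports Defs "HOL-Probability.Probability" "HOL-Real_Asymp.Real_Asymp"
begin

text \<open>Write \<open>D\<close> for the Fourier multiplier with symbol \<open>\<tau> coth (\<pi> \<tau> / 2)\<close>, so that the equation is
  \<open>D Q = Q\<^sup>2\<close>. Its inverse is convolution with a positive function; in the form \<open>Q = green * Q\<^sup>2\<close>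
  the equation shows that \<open>Q\<close> is bounded, smooth and positive. Let \<open>V\<close> be a primitive of \<open>Q\<^sup>2\<close>.
  The addition formula of \<open>coth\<close> gives \<open>D (Q V) = V V' - Q Q'\<close>, whence \<open>p = Q' + Q V\<close> satisfies
  \<open>D p = Q p\<close>. This is the linear equation solved by the positive function \<open>Q\<close>, so, as in the
  Perron--Frobenius theorem, \<open>p\<close> is a multiple of \<open>Q\<close>. Changing the constant in \<open>V\<close> we get
  \<open>Q' = - Q V\<close> and \<open>V' = Q\<^sup>2\<close>, whose solutions are \<open>A / cosh (A (t - \<alpha>))\<close>; comparing integrals
  gives \<open>A = 1\<close>. Polarizing the bilinear identity treats \<open>D \<psi> = 2 Q \<psi>\<close> in the same way: with
  \<open>z' = 2 Q \<psi>\<close>, the function \<open>\<psi>' + V \<psi> + Q z\<close> is again a multiple of \<open>Q\<close>, which leaves a linear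
  system with the two solutions \<open>Q'\<close> and \<open>Q + (t - \<alpha>) Q'\<close>; integration excludes the second.\<close>

section \<open>The Fourier integral on \<open>L\<^sup>1\<close>\<close>

text \<open>D is the Dirichlet-to-Neumann map of the strip 0 < y < \<pi>/2 for harmonic functions
  vanishing on the far side: exp (i \<tau> x) extends with the factor sinh (\<tau> (\<pi>/2 - y)) /
  sinh (\<pi> \<tau>/2), whose normal derivative at y = 0 is \<tau> coth (\<pi> \<tau>/2). If V' = D
  u, then u + i V is the boundary value of a holomorphic function that is purely imaginary on the
  far side. The imaginary part 2 u V of its square vanishes there too, and the Cauchy-Riemann
  equations of the square are the formula for D (Q V). The addition formula is the same fact in
  Fourier variables and avoids analysis in the strip. The combination p arises since D Q' = 2 Q Q'
  carries one Q Q' too many for D p = Q p, and the term - Q Q' in D (Q V) removes it. The scale is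
  fixed at frequency 0, where the symbol is 2/\<pi>: the integral of Q^2 must be 2/\<pi> times that
  of Q, while A / cosh (A t) has integral \<pi> for every A and its square has integral 2 A. The
  second solution Q + (t - \<alpha>) Q' is the derivative of this family in A at A = 1, so it
  violates the linearized relation.\<close>

definition wave :: "real \<Rightarrow> real \<Rightarrow> complex" where
  "wave \<tau> t = exp (- (\<i> * complex_of_real (\<tau> * t)))"

definition cF :: complex where
  "cF = complex_of_real (1 / sqrt (2 * pi))"

lemma fourier_integral_wave: "fourier_integral \<phi> \<tau> = cF * (LINT t|lborel. wave \<tau> t * \<phi> t)"
  by (simp add: fourier_integral_def wave_def cF_def)

lemma cF_nonzero [simp]: "cF \<noteq> 0"
  by (simp add: cF_def)

lemma cnj_cF [simp]: "cnj cF = cF"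
  by (simp add: cF_def)

lemma norm_cF_le_1: "norm cF \<le> 1"
proof -
  have "1 \<le> sqrt (2 * pi)"
    using pi_gt3 by (intro real_le_rsqrt) auto
  then show ?thesis
    by (simp add: cF_def norm_divide)
qed

lemma norm_wave [simp]: "norm (wave \<tau> t) = 1"
  by (simp add: wave_def norm_exp_eq_Re)

lemma wave_commute: "wave \<tau> t = wave t \<tau>"
  by (simp add: wave_def mult.commute)

lemma wave_0 [simp]: "wave 0 t = 1" "wave t 0 = 1"
  by (simp_all add: wave_def)

lemma wave_add_left: "wave (\<sigma> + s) t = wave \<sigma> t * wave s t"
  by (simp add: wave_def algebra_simps flip: exp_add)

lemma wave_add_right: "wave t (\<sigma> + s) = wave t \<sigma> * wave t s"
  by (simp add: wave_def algebra_simps flip: exp_add)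

lemma wave_uminus: "wave (- \<tau>) t = cnj (wave \<tau> t)" "wave \<tau> (- t) = cnj (wave \<tau> t)"
  by (simp_all add: wave_def exp_cnj)

lemma isCont_wave: "isCont (\<lambda>\<tau>. wave \<tau> t) x" "isCont (\<lambda>t. wave \<tau> t) x"
  unfolding wave_def by (intro continuous_intros)+

lemma measurable_wave [measurable (raw)]:
  assumes "f \<in> borel_measurable M" "g \<in> borel_measurable M"
  shows "(\<lambda>x. wave (f x) (g x)) \<in> borel_measurable M"
  using assms unfolding wave_def by measurable

lemma integrable_wave_mult [simp]:
  fixes f :: "real \<Rightarrow> complex"
  assumes "integrable lborel f"
  shows "integrable lborel (\<lambda>t. wave \<tau> t * f t)"
proof (rule Bochner_Integration.integrable_bound[OF assms])
  have [measurable]: "f \<in> borel_measurable lborel" using assms by auto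
  show "(\<lambda>t. wave \<tau> t * f t) \<in> borel_measurable lborel" by measurable
qed (simp add: norm_mult)

lemma norm_fourier_integral_le:
  "norm (fourier_integral f \<tau>) \<le> (LINT t|lborel. norm (f t))"
proof -
  have "norm (fourier_integral f \<tau>) \<le> norm (LINT t|lborel. wave \<tau> t * f t)"
    using norm_cF_le_1 by (simp add: fourier_integral_wave norm_mult mult_left_le_one_le)
  also have "\<dots> \<le> (LINT t|lborel. norm (wave \<tau> t * f t))"
    by (rule integral_norm_bound)
  finally show ?thesis by (simp add: norm_mult)
qed

lemma isCont_fourier_integral:
  assumes "integrable lborel f"
  shows "isCont (fourier_integral f) \<tau>"
proof (rule continuous_at_sequentiallyI)
  fix u :: "nat \<Rightarrow> real" assume u: "u \<longlonglongrightarrow> \<tau>"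
  have [measurable]: "f \<in> borel_measurable lborel" using assms by auto
  have "(\<lambda>n. LINT t|lborel. wave (u n) t * f t) \<longlonglongrightarrow> (LINT t|lborel. wave \<tau> t * f t)"
  proof (rule integral_dominated_convergence[where w="\<lambda>t. norm (f t)"])
    show "AE t in lborel. (\<lambda>n. wave (u n) t * f t) \<longlonglongrightarrow> wave \<tau> t * f t"
      using isCont_tendsto_compose[OF isCont_wave(1) u] by (intro AE_I2 tendsto_mult_right)
  qed (use assms in \<open>auto simp: norm_mult\<close>)
  then show "(\<lambda>n. fourier_integral f (u n)) \<longlonglongrightarrow> fourier_integral f \<tau>"
    unfolding fourier_integral_wave by (intro tendsto_mult_left)
qed

lemma continuous_on_fourier_integral:
  "integrable lborel f \<Longrightarrow> continuous_on A (fourier_integral f)"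
  by (meson continuous_at_imp_continuous_on isCont_fourier_integral)

lemma measurable_fourier_integral:
  "integrable lborel f \<Longrightarrow> fourier_integral f \<in> borel_measurable borel"
  by (rule borel_measurable_continuous_onI) (rule continuous_on_fourier_integral)

lemma integrable_bounded_mult:
  fixes f g :: "real \<Rightarrow> 'a::{banach,second_countable_topology,real_normed_algebra}"
  assumes "integrable lborel f" "g \<in> borel_measurable lborel" "\<And>x. norm (g x) \<le> B"
  shows "integrable lborel (\<lambda>x. g x * f x)"
proof (rule Bochner_Integration.integrable_bound)
  have [measurable]: "f \<in> borel_measurable lborel" using assms by auto
  show "integrable lborel (\<lambda>x. B * norm (f x))" using assms by auto
  show "(\<lambda>t. g t * f t) \<in> borel_measurable lborel" using assms by measurable
  show "AE x in lborel. norm (g x * f x) \<le> norm (B * norm (f x))"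
    using assms(3) by (intro AE_I2) (metis abs_ge_self mult_right_mono norm_ge_zero norm_mult_ineq order_trans real_norm_def)
qed

lemma integrable_fourier_integral_mult:
  assumes "integrable lborel f" "integrable lborel h"
  shows "integrable lborel (\<lambda>x. fourier_integral f x * h x)"
  using integrable_bounded_mult[OF assms(2), of "fourier_integral f"] measurable_fourier_integral[OF assms(1)]
    norm_fourier_integral_le by auto

lemma integrable_pair_product:
  fixes f h :: "real \<Rightarrow> complex"
  assumes "integrable lborel f" "integrable lborel h"
    and [measurable]: "k \<in> borel_measurable (lborel \<Otimes>\<^sub>M lborel)" and k: "\<And>z. norm (k z) \<le> 1"
  shows "integrable (lborel \<Otimes>\<^sub>M lborel) (\<lambda>(x, y). k (x, y) * (f x * h y) :: complex)"
proof -
  have [measurable]: "f \<in> borel_measurable lborel" "h \<in> borel_measurable lborel" using assms by auto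
  have "integrable (lborel \<Otimes>\<^sub>M lborel) (\<lambda>(x, y). f x * h y)"
  proof (rule lborel_pair.Fubini_integrable)
    show "AE x in lborel. integrable lborel (\<lambda>y. case (x, y) of (x, y) \<Rightarrow> f x * h y)"
      using assms by auto
    show "integrable lborel (\<lambda>x. LINT y|lborel. norm (case (x, y) of (x, y) \<Rightarrow> f x * h y))"
      using assms by (auto simp: norm_mult)
  qed measurable
  then show ?thesis
  proof (rule Bochner_Integration.integrable_bound)
    show "AE x in lborel \<Otimes>\<^sub>M lborel. norm (case x of (x, y) \<Rightarrow> k (x, y) * (f x * h y)) \<le> norm (case x of (x, y) \<Rightarrow> f x * h y)"
      using k by (auto simp: norm_mult mult_left_le_one_le split: prod.splits)
  qed measurable
qed

text \<open>The multiplication formula, by Fubini with a kernel of modulus one. Tested against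
  Gaussians, whose transforms are explicit, it yields inversion, Bessel's inequality and the link
  with \<open>fourier_L2\<close>.\<close>

lemma fourier_integral_swap:
  assumes f: "integrable lborel f" and h: "integrable lborel h"
  shows "(LINT \<tau>|lborel. fourier_integral f \<tau> * h \<tau>) = (LINT t|lborel. f t * fourier_integral h t)"
proof -
  have "integrable (lborel \<Otimes>\<^sub>M lborel) (\<lambda>(x, y). (\<lambda>(x,y). wave x y) (x, y) * (f x * h y))"
    by (rule integrable_pair_product[OF f h]) auto
  then have "(LINT y|lborel. LINT x|lborel. wave x y * (f x * h y)) = (LINT x|lborel. LINT y|lborel. wave x y * (f x * h y))"
    by (intro lborel_pair.Fubini_integral) simp
  moreover have "(LINT x|lborel. wave x y * (f x * h y)) = (LINT x|lborel. wave y x * f x) * h y" for y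
    by (simp add: wave_commute[of _ y] flip: mult.assoc)
  moreover have "(LINT y|lborel. wave x y * (f x * h y)) = f x * (LINT y|lborel. wave x y * h y)" for x
    by (simp add: mult.left_commute[of _ "f x"])
  ultimately show ?thesis
    unfolding fourier_integral_wave by (simp add: mult.assoc mult.left_commute[of _ cF])
qed

lemma fourier_integral_cong_AE:
  assumes "AE x in lborel. f x = g x" "f \<in> borel_measurable lborel" "g \<in> borel_measurable lborel"
  shows "fourier_integral f \<tau> = fourier_integral g \<tau>"
proof -
  have "(LINT t|lborel. wave \<tau> t * f t) = (LINT t|lborel. wave \<tau> t * g t)"
    using assms by (intro integral_cong_AE) auto
  then show ?thesis by (simp add: fourier_integral_wave)
qed

lemma fourier_integral_add:
  assumes "integrable lborel f" "integrable lborel h"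
  shows "fourier_integral (\<lambda>t. f t + h t) \<tau> = fourier_integral f \<tau> + fourier_integral h \<tau>"
  using assms by (simp add: fourier_integral_wave ring_distribs)

lemma fourier_integral_diff:
  assumes "integrable lborel f" "integrable lborel h"
  shows "fourier_integral (\<lambda>t. f t - h t) \<tau> = fourier_integral f \<tau> - fourier_integral h \<tau>"
  using assms by (simp add: fourier_integral_wave ring_distribs)

lemma fourier_integral_cmult:
  shows "fourier_integral (\<lambda>t. c * f t) \<tau> = c * fourier_integral f \<tau>"
  by (simp add: fourier_integral_wave mult.left_commute[of _ c])

lemma fourier_integral_wave_mult:
  "fourier_integral (\<lambda>t. wave s t * f t) \<tau> = fourier_integral f (\<tau> + s)"
  by (simp add: fourier_integral_wave wave_add_left mult.assoc)

text \<open>Reduces to the uniqueness theorem for characteristic functions. The positive and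
  negative parts of f have the same mass m, by the hypothesis at frequency 0; divided by m they are
  probability densities with equal characteristic functions, hence equal a.e., although at each
  point one of them is 0.\<close>

lemma AE_eq_0_of_fourier_real:
  fixes f :: "real \<Rightarrow> real"
  assumes f: "integrable lborel f"
    and 0: "\<And>\<tau>. (LINT t|lborel. iexp (\<tau> * t) * complex_of_real (f t)) = 0"
  shows "AE t in lborel. f t = 0"
proof -
  have [measurable]: "f \<in> borel_measurable lborel" using f by auto
  define p where "p t = max (f t) 0" for t
  define n where "n t = max (- f t) 0" for t
  have [measurable]: "p \<in> borel_measurable lborel" "n \<in> borel_measurable lborel"
    unfolding p_def n_def by measurable
  have pn: "f t = p t - n t" "p t \<ge> 0" "n t \<ge> 0" "p t = 0 \<or> n t = 0" for t
    by (auto simp: p_def n_def)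
  have ip: "integrable lborel p" and iin: "integrable lborel n"
    unfolding p_def n_def using f by auto
  define m where "m = integral\<^sup>L lborel p"
  have "complex_of_real (integral\<^sup>L lborel f) = 0"
    using 0[of 0] by simp
  then have mn: "integral\<^sup>L lborel n = m"
    using ip iin by (simp add: pn(1)[abs_def] m_def)
  have m0: "m \<ge> 0" unfolding m_def by (intro integral_nonneg_AE) (auto simp: pn)
  show ?thesis
  proof (cases "m = 0")
    case True
    then have "AE t in lborel. p t = 0" "AE t in lborel. n t = 0"
      using integral_nonneg_eq_0_iff_AE[OF ip] integral_nonneg_eq_0_iff_AE[OF iin] mn pn
      by (auto simp: m_def)
    then show ?thesis by eventually_elim (simp add: pn)
  next
    case False
    with m0 have m: "m > 0" by simp
    have rd: "real_distribution (density lborel (\<lambda>t. ennreal (q t / m)))"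
      if [measurable]: "q \<in> borel_measurable lborel" and "integrable lborel q" "\<And>t. q t \<ge> 0" "integral\<^sup>L lborel q = m" for q
    proof -
      have "(\<integral>\<^sup>+t. ennreal (q t / m) \<partial>lborel) = ennreal (LINT t|lborel. q t / m)"
        using that m by (intro nn_integral_eq_integral) auto
      also have "\<dots> = 1" using that m by simp
      finally have "prob_space (density lborel (\<lambda>t. ennreal (q t / m)))"
        by (intro prob_spaceI) (simp add: emeasure_density)
      then show ?thesis
        by (simp add: real_distribution_def real_distribution_axioms_def)
    qed
    have ch: "char (density lborel (\<lambda>t. ennreal (q t / m))) \<tau> = (LINT t|lborel. iexp (\<tau> * t) * complex_of_real (q t)) / m"
      if [measurable]: "q \<in> borel_measurable lborel" and "\<And>t. q t \<ge> 0" for q \<tau>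
    proof -
      have "char (density lborel (\<lambda>t. ennreal (q t / m))) \<tau> = (LINT t|lborel. (q t / m) *\<^sub>R iexp (\<tau> * t))"
        unfolding char_def using that m by (intro integral_density) auto
      also have "\<dots> = (LINT t|lborel. iexp (\<tau> * t) * complex_of_real (q t) / m)"
        by (simp add: scaleR_conv_of_real field_simps)
      finally show ?thesis by simp
    qed
    have intg: "integrable lborel (\<lambda>t. iexp (\<tau> * t) * complex_of_real (q t))" if "integrable lborel q" for q \<tau>
    proof -
      have [measurable]: "q \<in> borel_measurable lborel" using that by auto
      show ?thesis
        by (rule Bochner_Integration.integrable_bound[OF that]) (auto simp: norm_mult)
    qed
    have "char (density lborel (\<lambda>t. ennreal (p t / m))) = char (density lborel (\<lambda>t. ennreal (n t / m)))"
    proof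
      fix \<tau>
      have "(LINT t|lborel. iexp (\<tau> * t) * complex_of_real (p t)) - (LINT t|lborel. iexp (\<tau> * t) * complex_of_real (n t)) = 0"
        using 0[of \<tau>] intg[OF ip] intg[OF iin] by (simp add: pn(1) ring_distribs flip: Bochner_Integration.integral_diff)
      then show "char (density lborel (\<lambda>t. ennreal (p t / m))) \<tau> = char (density lborel (\<lambda>t. ennreal (n t / m))) \<tau>"
        by (simp add: ch pn)
    qed
    then have "density lborel (\<lambda>t. ennreal (p t / m)) = density lborel (\<lambda>t. ennreal (n t / m))"
      using mn by (intro Levy_uniqueness rd) (auto simp: ip iin pn m_def)
    then have "AE t in lborel. ennreal (p t / m) = ennreal (n t / m)"
      by (intro sigma_finite_measure.density_unique[OF sigma_finite_lborel]) auto
    then show ?thesis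
    proof eventually_elim
      case (elim t)
      then show ?case using m pn[of t] by (simp add: ennreal_inj divide_eq_eq)
    qed
  qed
qed

text \<open>Conjugating f conjugates the transform and reflects the frequency. So the transform of
  \<open>cnj f\<close> vanishes as well, and with it those of the real and imaginary parts, to which
  the real case applies.\<close>

lemma fourier_integral_inject:
  assumes f: "integrable lborel f" and 0: "\<And>\<tau>. fourier_integral f \<tau> = 0"
  shows "AE t in lborel. f t = 0"
proof -
  have w: "(LINT t|lborel. iexp (\<tau> * t) * f t) = 0" for \<tau>
    using 0[of "- \<tau>"] by (simp add: fourier_integral_wave wave_def)
  have w': "(LINT t|lborel. iexp (\<tau> * t) * cnj (f t)) = 0" for \<tau>
  proof -
    have "(LINT t|lborel. iexp (\<tau> * t) * cnj (f t)) = (LINT t|lborel. cnj (iexp ((- \<tau>) * t) * f t))"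
      by (simp add: exp_cnj)
    also have "\<dots> = cnj (LINT t|lborel. iexp ((- \<tau>) * t) * f t)"
      by (rule Bochner_Integration.integral_cnj)
    finally show ?thesis using w[of "- \<tau>"] by simp
  qed
  have i: "integrable lborel (\<lambda>t. iexp (\<tau> * t) * f t)" for \<tau>
    using integrable_wave_mult[OF f, of "- \<tau>"] by (simp add: wave_def)
  have i': "integrable lborel (\<lambda>t. iexp (\<tau> * t) * cnj (f t))" for \<tau>
    using integrable_wave_mult[of "\<lambda>t. cnj (f t)" "- \<tau>"] f by (simp add: wave_def)
  have "AE t in lborel. Re (f t) = 0"
  proof (rule AE_eq_0_of_fourier_real)
    fix \<tau>
    have "iexp (\<tau> * t) * complex_of_real (Re (f t)) = (iexp (\<tau> * t) * f t + iexp (\<tau> * t) * cnj (f t)) / 2" for t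
      unfolding distrib_left[symmetric] complex_add_cnj by simp
    then have "(LINT t|lborel. iexp (\<tau> * t) * complex_of_real (Re (f t))) = (LINT t|lborel. (iexp (\<tau> * t) * f t + iexp (\<tau> * t) * cnj (f t)) / 2)"
      by presburger
    then show "(LINT t|lborel. iexp (\<tau> * t) * complex_of_real (Re (f t))) = 0"
      using w[of \<tau>] w'[of \<tau>] i[of \<tau>] i'[of \<tau>] by simp
  qed (use f in auto)
  moreover have "AE t in lborel. Im (f t) = 0"
  proof (rule AE_eq_0_of_fourier_real)
    fix \<tau>
    have "iexp (\<tau> * t) * complex_of_real (Im (f t)) = (iexp (\<tau> * t) * f t - iexp (\<tau> * t) * cnj (f t)) / (2 * \<i>)" for t
      unfolding right_diff_distrib[symmetric] complex_diff_cnj by (simp add: field_simps)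
    then have "(LINT t|lborel. iexp (\<tau> * t) * complex_of_real (Im (f t))) = (LINT t|lborel. (iexp (\<tau> * t) * f t - iexp (\<tau> * t) * cnj (f t)) / (2 * \<i>))"
      by presburger
    then show "(LINT t|lborel. iexp (\<tau> * t) * complex_of_real (Im (f t))) = 0"
      using w[of \<tau>] w'[of \<tau>] i[of \<tau>] i'[of \<tau>] by simp
  qed (use f in auto)
  ultimately show ?thesis
    by eventually_elim (simp add: complex_eq_iff)
qed

section \<open>Gaussians, inversion and the Bessel inequality\<close>

text \<open>This scaling is the one fixed by the unitary Fourier transform, which then exchanges
  translated and modulated Gaussians.\<close>

definition gauss :: "real \<Rightarrow> complex" where
  "gauss t = complex_of_real (exp (- t\<^sup>2 / 2))"

lemma gauss_nonzero [simp]: "gauss t \<noteq> 0"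
  by (simp add: gauss_def)

lemma norm_gauss_le_1: "norm (gauss t) \<le> 1"
  by (simp add: gauss_def)

lemma measurable_cnj [measurable (raw)]:
  "f \<in> borel_measurable M \<Longrightarrow> (\<lambda>x. cnj (f x)) \<in> borel_measurable M"
  by (rule borel_measurable_continuous_on) (intro continuous_intros)

lemma gauss_uminus [simp]: "gauss (- t) = gauss t"
  by (simp add: gauss_def)

lemma cnj_gauss [simp]: "cnj (gauss t) = gauss t"
  by (simp add: gauss_def)

lemma measurable_gauss [measurable]: "gauss \<in> borel_measurable borel"
  unfolding gauss_def by measurable

lemma gauss_conv_normal_density:
  assumes "\<sigma> > 0"
  shows "cF * gauss (t / \<sigma>) / of_real \<sigma> = of_real (normal_density 0 \<sigma> t)"
  using assms by (simp add: gauss_def cF_def normal_density_def power_divide real_sqrt_mult)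

lemma integrable_gauss_scale:
  assumes "c \<noteq> 0"
  shows "integrable lborel (\<lambda>t. gauss (c * t))"
proof -
  have *: "gauss = (\<lambda>t. complex_of_real (normal_density 0 1 t) / cF)"
    using gauss_conv_normal_density[of 1] by (simp add: field_simps fun_eq_iff)
  have "integrable lborel gauss"
    unfolding * by simp
  from lborel_integrable_real_affine[OF this assms, of 0] show ?thesis by simp
qed

lemma integrable_gauss: "integrable lborel gauss"
  using integrable_gauss_scale[of 1] by simp

lemma integrable_gauss_shift: "integrable lborel (\<lambda>t. gauss (t - s))"
  using lborel_integrable_real_affine[OF integrable_gauss, of 1 "-s"] by (simp add: algebra_simps)

lemma fourier_integral_gauss: "fourier_integral gauss \<tau> = gauss \<tau>"
proof -
  have "char std_normal_distribution (- \<tau>) = (LINT t|lborel. std_normal_density t *\<^sub>R iexp (- \<tau> * t))"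
    unfolding char_def by (intro integral_density) auto
  also have "\<dots> = (LINT t|lborel. cF * (wave \<tau> t * gauss t))"
    using gauss_conv_normal_density[of 1, symmetric]
    by (simp add: scaleR_conv_of_real wave_def mult_ac)
  finally show ?thesis
    by (simp add: fourier_integral_wave char_std_normal_distribution gauss_def)
qed

lemma fourier_integral_scale:
  assumes "c > 0"
  shows "fourier_integral (\<lambda>t. f (c * t)) \<tau> = fourier_integral f (\<tau> / c) / of_real c"
proof -
  have "(LINT t|lborel. wave (\<tau> / c) t * f t) = c *\<^sub>R (LINT t|lborel. wave (\<tau> / c) (0 + c * t) * f (0 + c * t))"
    using assms by (subst lborel_integral_real_affine[of c _ 0]) auto
  also have "\<dots> = c *\<^sub>R (LINT t|lborel. wave \<tau> t * f (c * t))"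
    using assms by (simp add: wave_def)
  finally show ?thesis
    using assms by (simp add: fourier_integral_wave scaleR_conv_of_real)
qed

lemma fourier_integral_shift:
  "fourier_integral (\<lambda>t. f (t - s)) \<tau> = wave \<tau> s * fourier_integral f \<tau>"
proof -
  have "(LINT t|lborel. wave \<tau> t * f (t - s)) = (LINT t|lborel. wave \<tau> (s + 1 * t) * f ((s + 1 * t) - s))"
    by (subst lborel_integral_real_affine[of 1 _ s]) auto
  also have "\<dots> = wave \<tau> s * (LINT t|lborel. wave \<tau> t * f t)"
    by (simp add: wave_add_right mult.assoc)
  finally show ?thesis by (simp add: fourier_integral_wave)
qed

lemma fourier_integral_gauss_shift:
  "fourier_integral (\<lambda>\<tau>. gauss (\<tau> - s)) t = wave t s * gauss t"
  by (simp add: fourier_integral_shift fourier_integral_gauss)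

lemma fourier_integral_wave_gauss:
  "fourier_integral (\<lambda>\<tau>. wave s \<tau> * gauss \<tau>) t = gauss (t + s)"
  by (simp add: fourier_integral_wave_mult fourier_integral_gauss)

text \<open>Up to the factor \<open>cF\<close> the tests are the Fourier integral of
  \<open>gauss t * f t\<close>, and \<open>gauss\<close> has no zero. The weight admits functions f,
  such as transforms of L2 functions, that have no Fourier integral of their own.\<close>

lemma AE_eq_0_of_gauss_tests:
  assumes "integrable lborel (\<lambda>t. gauss t * f t)"
    and "\<And>s. (LINT t|lborel. wave s t * (gauss t * f t)) = 0"
  shows "AE t in lborel. f t = 0"
proof -
  have "AE t in lborel. gauss t * f t = 0"
    using assms by (intro fourier_integral_inject) (simp_all add: fourier_integral_wave)
  then show ?thesis by simp
qed

lemma AE_eq_of_gauss_tests: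
  assumes "integrable lborel (\<lambda>t. gauss t * f t)" "integrable lborel (\<lambda>t. gauss t * h t)"
    and "\<And>s. (LINT t|lborel. wave s t * (gauss t * f t)) = (LINT t|lborel. wave s t * (gauss t * h t))"
  shows "AE t in lborel. f t = h t"
proof -
  have "AE t in lborel. f t - h t = 0"
    using assms by (intro AE_eq_0_of_gauss_tests) (simp_all add: right_diff_distrib)
  then show ?thesis by simp
qed

lemma integrable_gauss_mult:
  "integrable lborel f \<Longrightarrow> integrable lborel (\<lambda>t. gauss t * f t)"
  by (rule integrable_bounded_mult[where B=1]) (auto simp: norm_gauss_le_1)

text \<open>Two applications of the multiplication formula. A modulated Gaussian is the transform of
  a translated one, which moves the test from f to its transform; the translated Gaussian is in turn
  the transform of a modulated one, which moves it on to the second transform.\<close>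

lemma fourier_inversion:
  assumes f: "integrable lborel f" and Ff: "integrable lborel (fourier_integral f)"
  shows "AE x in lborel. f x = fourier_integral (fourier_integral f) (- x)"
proof (rule AE_eq_of_gauss_tests)
  let ?h = "\<lambda>x. fourier_integral (fourier_integral f) (- x)"
  have hm: "?h \<in> borel_measurable borel"
    using measurable_fourier_integral[OF Ff] by measurable
  show "integrable lborel (\<lambda>t. gauss t * f t)"
    by (rule integrable_gauss_mult[OF f])
  show "integrable lborel (\<lambda>t. gauss t * ?h t)"
    using integrable_bounded_mult[OF integrable_gauss, of ?h] hm norm_fourier_integral_le
    by (auto simp: mult.commute)
  fix s
  have g: "integrable lborel (\<lambda>\<tau>. gauss (\<tau> - s))"
    by (rule integrable_gauss_shift)
  have gw: "integrable lborel (\<lambda>t. wave (- s) t * gauss t)"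
    by (intro integrable_wave_mult integrable_gauss)
  have "(LINT t|lborel. wave s t * (gauss t * f t)) = (LINT t|lborel. f t * fourier_integral (\<lambda>\<tau>. gauss (\<tau> - s)) t)"
    by (simp add: fourier_integral_gauss_shift wave_commute[of s] mult_ac)
  also have "\<dots> = (LINT \<tau>|lborel. fourier_integral f \<tau> * gauss (\<tau> - s))"
    by (rule fourier_integral_swap[OF f g, symmetric])
  also have "\<dots> = (LINT \<tau>|lborel. fourier_integral f \<tau> * fourier_integral (\<lambda>t. wave (- s) t * gauss t) \<tau>)"
    by (simp add: fourier_integral_wave_gauss)
  also have "\<dots> = (LINT t|lborel. fourier_integral (fourier_integral f) t * (wave (- s) t * gauss t))"
    by (rule fourier_integral_swap[OF Ff gw, symmetric])
  also have "\<dots> = (LINT t|lborel. ?h t * (wave (- s) (- t) * gauss (- t)))"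
    by (subst lborel_integral_real_affine[of "-1" _ 0]) auto
  also have "\<dots> = (LINT t|lborel. wave s t * (gauss t * ?h t))"
    by (simp add: wave_uminus mult_ac)
  finally show "(LINT t|lborel. wave s t * (gauss t * f t)) = (LINT t|lborel. wave s t * (gauss t * ?h t))" .
qed

text \<open>The Gaussian factor makes \<open>H\<close> integrable, so the multiplication formula
  turns the left side into the pairing of f with the transform of \<open>H\<close>, which is the
  conjugate of f smoothed by the normal density \<open>N\<close> of standard deviation c. Splitting
  |f x| |f y| into half squares and using that \<open>N\<close> has mass 1 in either variable gives
  a bound independent of c.\<close>

lemma bessel_gauss:
  assumes f: "integrable lborel f" and c: "c > 0"
  shows "(\<integral>\<^sup>+\<tau>. ennreal ((norm (fourier_integral f \<tau>))\<^sup>2 * norm (gauss (c * \<tau>))) \<partial>lborel)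
      \<le> (\<integral>\<^sup>+t. ennreal ((norm (f t))\<^sup>2) \<partial>lborel)"
proof -
  have [measurable]: "f \<in> borel_measurable lborel" using f by auto
  have Fm [measurable]: "fourier_integral f \<in> borel_measurable borel"
    by (rule measurable_fourier_integral[OF f])
  define H where "H \<tau> = cnj (fourier_integral f \<tau>) * gauss (c * \<tau>)" for \<tau>
  have H: "integrable lborel H"
    unfolding H_def using norm_fourier_integral_le[of f]
    by (intro integrable_bounded_mult[OF integrable_gauss_scale, where B="LINT t|lborel. norm (f t)"]) (use c in auto)
  define N where "N = normal_density 0 c"
  have N0: "N x \<ge> 0" for x by (simp add: N_def)
  have [measurable]: "N \<in> borel_measurable borel" by (simp add: N_def)
  have FH: "fourier_integral H x = cnj (LINT y|lborel. f y * of_real (N (y - x)))" for x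
  proof -
    have w: "integrable lborel (\<lambda>\<tau>. wave (- x) \<tau> * gauss (c * \<tau>))"
      using c by (intro integrable_wave_mult integrable_gauss_scale) auto
    have "wave x \<tau> * H \<tau> = cnj (fourier_integral f \<tau> * (wave (- x) \<tau> * gauss (c * \<tau>)))" for \<tau>
      by (simp add: H_def wave_uminus mult_ac)
    then have "(LINT \<tau>|lborel. wave x \<tau> * H \<tau>) = (LINT \<tau>|lborel. cnj (fourier_integral f \<tau> * (wave (- x) \<tau> * gauss (c * \<tau>))))"
      by presburger
    also have "\<dots> = cnj (LINT \<tau>|lborel. fourier_integral f \<tau> * (wave (- x) \<tau> * gauss (c * \<tau>)))"
      by (rule Bochner_Integration.integral_cnj)
    also have "\<dots> = cnj (LINT y|lborel. f y * fourier_integral (\<lambda>\<tau>. wave (- x) \<tau> * gauss (c * \<tau>)) y)"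
      by (subst fourier_integral_swap[OF f w]) simp
    finally have "fourier_integral H x = cnj (cF * (LINT y|lborel. f y * fourier_integral (\<lambda>\<tau>. wave (- x) \<tau> * gauss (c * \<tau>)) y))"
      by (simp add: fourier_integral_wave[of H])
    also have "(\<lambda>y. fourier_integral (\<lambda>\<tau>. wave (- x) \<tau> * gauss (c * \<tau>)) y) = (\<lambda>y. gauss ((y - x) / c) / of_real c)"
      using c by (simp add: fourier_integral_wave_mult fourier_integral_scale[where f=gauss] fourier_integral_gauss)
    also have "cF * (LINT y|lborel. f y * (gauss ((y - x) / c) / of_real c)) = (LINT y|lborel. f y * (cF * gauss ((y - x) / c) / of_real c))"
      by (simp flip: integral_mult_right_zero add: mult_ac)
    also have "\<dots> = (LINT y|lborel. f y * of_real (N (y - x)))"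
      by (simp add: gauss_conv_normal_density[OF c] N_def)
    finally show ?thesis .
  qed
  \<comment> \<open>If the smoothing integral does not exist, its Bochner value is 0 and the bound
    is trivial.\<close>
  have FHle: "ennreal (norm (fourier_integral H x)) \<le> (\<integral>\<^sup>+y. ennreal (norm (f y) * N (y - x)) \<partial>lborel)" for x
  proof (cases "integrable lborel (\<lambda>y. f y * of_real (N (y - x)))")
    case True
    have "ennreal (norm (fourier_integral H x)) \<le> ennreal (LINT y|lborel. norm (f y * of_real (N (y - x))))"
      unfolding FH complex_mod_cnj by (intro ennreal_leI integral_norm_bound)
    also have "\<dots> = (\<integral>\<^sup>+y. ennreal (norm (f y * of_real (N (y - x)))) \<partial>lborel)"
      using True by (intro nn_integral_eq_integral[symmetric]) auto
    finally show ?thesis by (simp add: norm_mult N0)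
  qed (simp add: FH not_integrable_integral_eq)
  have NN: "(\<integral>\<^sup>+y. ennreal (N (y - x)) \<partial>lborel) = 1" "(\<integral>\<^sup>+x. ennreal (N (y - x)) \<partial>lborel) = 1" for x y
  proof -
    have one: "(\<integral>\<^sup>+y. ennreal (N y) \<partial>lborel) = 1"
      unfolding N_def using c by (subst nn_integral_eq_integral) auto
    show "(\<integral>\<^sup>+y. ennreal (N (y - x)) \<partial>lborel) = 1"
      using nn_integral_real_affine[of "\<lambda>y. ennreal (N y)" 1 "-x"] one by simp
    show "(\<integral>\<^sup>+x. ennreal (N (y - x)) \<partial>lborel) = 1"
      using nn_integral_real_affine[of "\<lambda>y. ennreal (N y)" "-1" y] one by simp
  qed
  define M where "M = (\<integral>\<^sup>+t. ennreal ((norm (f t))\<^sup>2) \<partial>lborel)"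
  have pt: "(norm (fourier_integral f \<tau>))\<^sup>2 * norm (gauss (c * \<tau>)) = Re (fourier_integral f \<tau> * H \<tau>)"
     "0 \<le> Re (fourier_integral f \<tau> * H \<tau>)" for \<tau>
  proof -
    have "fourier_integral f \<tau> * H \<tau> = of_real ((norm (fourier_integral f \<tau>))\<^sup>2 * norm (gauss (c * \<tau>)))"
      using complex_norm_square[of "fourier_integral f \<tau>"] by (simp add: H_def gauss_def mult.assoc[symmetric])
    then show "(norm (fourier_integral f \<tau>))\<^sup>2 * norm (gauss (c * \<tau>)) = Re (fourier_integral f \<tau> * H \<tau>)"
     "0 \<le> Re (fourier_integral f \<tau> * H \<tau>)" by simp_all
  qed
  have iFH: "integrable lborel (\<lambda>\<tau>. fourier_integral f \<tau> * H \<tau>)"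
    by (rule integrable_fourier_integral_mult[OF f H])
  have "(\<integral>\<^sup>+\<tau>. ennreal ((norm (fourier_integral f \<tau>))\<^sup>2 * norm (gauss (c * \<tau>))) \<partial>lborel)
     = ennreal (LINT \<tau>|lborel. Re (fourier_integral f \<tau> * H \<tau>))"
    unfolding pt(1) by (intro nn_integral_eq_integral) (use integrable_Re[OF iFH] pt(2) in \<open>auto simp del: times_complex.sel\<close>)
  also have "\<dots> = ennreal (Re (LINT t|lborel. f t * fourier_integral H t))"
    by (subst integral_Re[OF iFH]) (simp add: fourier_integral_swap[OF f H])
  also have "\<dots> \<le> ennreal (norm (LINT t|lborel. f t * fourier_integral H t))"
    by (intro ennreal_leI complex_Re_le_cmod)
  also have "\<dots> \<le> ennreal (LINT t|lborel. norm (f t * fourier_integral H t))"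
    by (intro ennreal_leI integral_norm_bound)
  also have "\<dots> = (\<integral>\<^sup>+x. ennreal (norm (f x * fourier_integral H x)) \<partial>lborel)"
    using integrable_fourier_integral_mult[OF H f]
    by (intro nn_integral_eq_integral[symmetric]) (auto simp: mult.commute)
  also have "\<dots> \<le> (\<integral>\<^sup>+x. (\<integral>\<^sup>+y. ennreal ((norm (f x))\<^sup>2 / 2) * ennreal (N (y - x)) + ennreal ((norm (f y))\<^sup>2 / 2) * ennreal (N (y - x)) \<partial>lborel) \<partial>lborel)"
  proof (rule nn_integral_mono)
    fix x
    have "ennreal (norm (f x * fourier_integral H x)) = ennreal (norm (f x)) * ennreal (norm (fourier_integral H x))"
      by (simp add: norm_mult ennreal_mult)
    also have "\<dots> \<le> ennreal (norm (f x)) * (\<integral>\<^sup>+y. ennreal (norm (f y) * N (y - x)) \<partial>lborel)"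
      by (intro mult_left_mono FHle) auto
    also have "\<dots> = (\<integral>\<^sup>+y. ennreal (norm (f x)) * ennreal (norm (f y) * N (y - x)) \<partial>lborel)"
      by (subst nn_integral_cmult) auto
    also have "\<dots> \<le> (\<integral>\<^sup>+y. ennreal ((norm (f x))\<^sup>2 / 2) * ennreal (N (y - x)) + ennreal ((norm (f y))\<^sup>2 / 2) * ennreal (N (y - x)) \<partial>lborel)"
    proof (rule nn_integral_mono)
      fix y
      have "norm (f x) * norm (f y) \<le> (norm (f x))\<^sup>2 / 2 + (norm (f y))\<^sup>2 / 2"
        using sum_squares_bound[of "norm (f x)" "norm (f y)"] by simp
      then have "norm (f x) * norm (f y) * N (y - x) \<le> ((norm (f x))\<^sup>2 / 2 + (norm (f y))\<^sup>2 / 2) * N (y - x)"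
        by (intro mult_right_mono N0)
      then show "ennreal (norm (f x)) * ennreal (norm (f y) * N (y - x))
         \<le> ennreal ((norm (f x))\<^sup>2 / 2) * ennreal (N (y - x)) + ennreal ((norm (f y))\<^sup>2 / 2) * ennreal (N (y - x))"
        using N0 by (simp add: ennreal_mult[symmetric] ennreal_plus[symmetric] ring_distribs mult.assoc del: ennreal_plus)
    qed
    finally show "ennreal (norm (f x * fourier_integral H x)) \<le> (\<integral>\<^sup>+y. ennreal ((norm (f x))\<^sup>2 / 2) * ennreal (N (y - x)) + ennreal ((norm (f y))\<^sup>2 / 2) * ennreal (N (y - x)) \<partial>lborel)" .
  qed
  also have "\<dots> = (\<integral>\<^sup>+x. (\<integral>\<^sup>+y. ennreal ((norm (f x))\<^sup>2 / 2) * ennreal (N (y - x)) \<partial>lborel) \<partial>lborel) +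
      (\<integral>\<^sup>+x. (\<integral>\<^sup>+y. ennreal ((norm (f y))\<^sup>2 / 2) * ennreal (N (y - x)) \<partial>lborel) \<partial>lborel)"
    by (subst nn_integral_add[symmetric]) (auto intro!: nn_integral_cong nn_integral_add)
  also have "(\<integral>\<^sup>+x. (\<integral>\<^sup>+y. ennreal ((norm (f x))\<^sup>2 / 2) * ennreal (N (y - x)) \<partial>lborel) \<partial>lborel)
      = (\<integral>\<^sup>+x. ennreal ((norm (f x))\<^sup>2 / 2) \<partial>lborel)"
    by (simp add: nn_integral_cmult NN)
  also have "(\<integral>\<^sup>+x. (\<integral>\<^sup>+y. ennreal ((norm (f y))\<^sup>2 / 2) * ennreal (N (y - x)) \<partial>lborel) \<partial>lborel)
      = (\<integral>\<^sup>+y. (\<integral>\<^sup>+x. ennreal ((norm (f y))\<^sup>2 / 2) * ennreal (N (y - x)) \<partial>lborel) \<partial>lborel)"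
    by (rule lborel_pair.Fubini') measurable
  also have "\<dots> = (\<integral>\<^sup>+x. ennreal ((norm (f x))\<^sup>2 / 2) \<partial>lborel)"
    by (simp add: nn_integral_cmult NN)
  also have "(\<integral>\<^sup>+x. ennreal ((norm (f x))\<^sup>2 / 2) \<partial>lborel) + (\<integral>\<^sup>+x. ennreal ((norm (f x))\<^sup>2 / 2) \<partial>lborel) = (\<integral>\<^sup>+t. ennreal ((norm (f t))\<^sup>2) \<partial>lborel)"
    by (subst nn_integral_add[symmetric]) (auto intro!: nn_integral_cong simp flip: ennreal_plus)
  finally show ?thesis .
qed

text \<open>Fatou's lemma as the Gaussian cutoff widens, along c = 1/(n+1).\<close>

lemma bessel:
  assumes f: "integrable lborel f"
  shows "(\<integral>\<^sup>+\<tau>. ennreal ((norm (fourier_integral f \<tau>))\<^sup>2) \<partial>lborel)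
      \<le> (\<integral>\<^sup>+t. ennreal ((norm (f t))\<^sup>2) \<partial>lborel)"
proof -
  have Fm [measurable]: "fourier_integral f \<in> borel_measurable borel"
    by (rule measurable_fourier_integral[OF f])
  let ?u = "\<lambda>n \<tau>. ennreal ((norm (fourier_integral f \<tau>))\<^sup>2 * norm (gauss (1 / real (Suc n) * \<tau>)))"
  have lim: "liminf (\<lambda>n. ?u n \<tau>) = ennreal ((norm (fourier_integral f \<tau>))\<^sup>2)" for \<tau>
  proof -
    have "(\<lambda>n. norm (gauss (1 / real (Suc n) * \<tau>))) \<longlonglongrightarrow> norm (gauss (0 * \<tau>))"
      unfolding gauss_def by (intro tendsto_intros lim_1_over_real_power LIMSEQ_Suc[OF lim_1_over_n]) auto
    then have "(\<lambda>n. ?u n \<tau>) \<longlonglongrightarrow> ennreal ((norm (fourier_integral f \<tau>))\<^sup>2 * norm (gauss (0 * \<tau>)))"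
      by (intro tendsto_ennrealI tendsto_mult tendsto_const)
    then show ?thesis
      by (intro lim_imp_Liminf) (auto simp: gauss_def)
  qed
  have "(\<integral>\<^sup>+\<tau>. liminf (\<lambda>n. ?u n \<tau>) \<partial>lborel) \<le> liminf (\<lambda>n. \<integral>\<^sup>+\<tau>. ?u n \<tau> \<partial>lborel)"
    by (rule nn_integral_liminf) measurable
  also have "\<dots> \<le> liminf (\<lambda>n::nat. \<integral>\<^sup>+t. ennreal ((norm (f t))\<^sup>2) \<partial>lborel)"
    by (intro Liminf_mono always_eventually allI bessel_gauss[OF f]) simp
  finally show ?thesis
    unfolding lim by (simp add: Liminf_const)
qed

section \<open>The Fourier transform on \<open>L\<^sup>2\<close>\<close>

text \<open>Valued in \<open>ennreal\<close>, like the limit in \<open>is_fourier_L2\<close>: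
  finiteness expresses membership in \<open>L2\<close>, and estimates require no prior
  integrability.\<close>

definition sqnorm :: "(real \<Rightarrow> complex) \<Rightarrow> ennreal" where
  "sqnorm f = (\<integral>\<^sup>+t. ennreal ((norm (f t))\<^sup>2) \<partial>lborel)"

lemma L2_iff: "f \<in> L2 \<longleftrightarrow> f \<in> borel_measurable lborel \<and> sqnorm f < \<infinity>"
  unfolding L2_def sqnorm_def by (auto simp: integrable_iff_bounded)

lemma L2_measurable: "f \<in> L2 \<Longrightarrow> f \<in> borel_measurable lborel"
  by (simp add: L2_iff)

lemma L2_integrable: "f \<in> L2 \<Longrightarrow> integrable lborel (\<lambda>t. (norm (f t))\<^sup>2)"
  by (simp add: L2_def)

lemma L2I: "f \<in> borel_measurable lborel \<Longrightarrow> integrable lborel (\<lambda>t. (norm (f t))\<^sup>2) \<Longrightarrow> f \<in> L2"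
  by (simp add: L2_def)

lemma sqnorm_cong_AE: "AE t in lborel. f t = g t \<Longrightarrow> sqnorm f = sqnorm g"
  unfolding sqnorm_def by (intro nn_integral_cong_AE) auto

lemma sqnorm_mono: "(\<And>t. norm (f t) \<le> norm (g t)) \<Longrightarrow> sqnorm f \<le> sqnorm g"
  unfolding sqnorm_def by (intro nn_integral_mono ennreal_leI power_mono) auto

lemma sqnorm_add:
  assumes [measurable]: "f \<in> borel_measurable lborel" "g \<in> borel_measurable lborel"
  shows "sqnorm (\<lambda>t. f t + g t) \<le> 2 * sqnorm f + 2 * sqnorm g"
proof -
  have "(norm (f t + g t))\<^sup>2 \<le> 2 * (norm (f t))\<^sup>2 + 2 * (norm (g t))\<^sup>2" for t
  proof -
    have "(norm (f t + g t))\<^sup>2 \<le> (norm (f t) + norm (g t))\<^sup>2"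
      by (intro power_mono norm_triangle_ineq) auto
    also have "\<dots> \<le> 2 * (norm (f t))\<^sup>2 + 2 * (norm (g t))\<^sup>2"
      using sum_squares_bound[of "norm (f t)" "norm (g t)"] by (simp add: power2_sum)
    finally show ?thesis .
  qed
  then have "sqnorm (\<lambda>t. f t + g t) \<le> (\<integral>\<^sup>+t. ennreal (2 * (norm (f t))\<^sup>2 + 2 * (norm (g t))\<^sup>2) \<partial>lborel)"
    unfolding sqnorm_def by (intro nn_integral_mono ennreal_leI)
  also have "\<dots> = (\<integral>\<^sup>+t. 2 * ennreal ((norm (f t))\<^sup>2) + 2 * ennreal ((norm (g t))\<^sup>2) \<partial>lborel)"
    by (intro nn_integral_cong) (simp add: ennreal_mult)
  also have "\<dots> = 2 * sqnorm f + 2 * sqnorm g"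
    unfolding sqnorm_def by (subst nn_integral_add) (auto simp: nn_integral_cmult)
  finally show ?thesis .
qed

lemma sqnorm_diff:
  assumes [measurable]: "f \<in> borel_measurable lborel" "g \<in> borel_measurable lborel"
  shows "sqnorm (\<lambda>t. f t - g t) \<le> 2 * sqnorm f + 2 * sqnorm g"
  using sqnorm_add[of f "\<lambda>t. - g t"] assms by (simp add: sqnorm_def)

lemma L2_add: "f \<in> L2 \<Longrightarrow> g \<in> L2 \<Longrightarrow> (\<lambda>t. f t + g t) \<in> L2"
  using sqnorm_add[of f g] unfolding L2_iff
  by (auto simp: ennreal_mult_less_top intro: le_less_trans)

lemma L2_cmult: "f \<in> L2 \<Longrightarrow> (\<lambda>t. c * f t) \<in> L2"
  by (auto simp: L2_def norm_mult power_mult_distrib)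

lemma L2_diff: "f \<in> L2 \<Longrightarrow> g \<in> L2 \<Longrightarrow> (\<lambda>t. f t - g t) \<in> L2"
  using L2_add[of f "\<lambda>t. (- 1) * g t"] L2_cmult[of g "-1"] by simp

lemma L2_mult_integrable:
  assumes "f \<in> L2" "g \<in> L2"
  shows "integrable lborel (\<lambda>t. f t * g t)"
proof (rule Bochner_Integration.integrable_bound)
  have [measurable]: "f \<in> borel_measurable lborel" "g \<in> borel_measurable lborel"
    using assms by (auto simp: L2_iff)
  show "integrable lborel (\<lambda>t. (norm (f t))\<^sup>2 + (norm (g t))\<^sup>2)"
    using assms by (auto intro: L2_integrable)
  show "(\<lambda>t. f t * g t) \<in> borel_measurable lborel" by measurable
  show "AE t in lborel. norm (f t * g t) \<le> norm ((norm (f t))\<^sup>2 + (norm (g t))\<^sup>2)"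
  proof (intro AE_I2)
    fix t
    have "norm (f t) * norm (g t) \<le> (norm (f t))\<^sup>2 + (norm (g t))\<^sup>2"
      using sum_squares_bound[of "norm (f t)" "norm (g t)"] mult_nonneg_nonneg[OF norm_ge_zero[of "f t"] norm_ge_zero[of "g t"]]
      by (simp only: mult.assoc)
    then show "norm (f t * g t) \<le> norm ((norm (f t))\<^sup>2 + (norm (g t))\<^sup>2)"
      by (simp add: norm_mult)
  qed
qed

lemma norm_integral_mult_le:
  assumes "f \<in> L2" "g \<in> L2"
  shows "ennreal ((norm (LINT t|lborel. f t * g t))\<^sup>2) \<le> sqnorm f * sqnorm g"
proof -
  have [measurable]: "f \<in> borel_measurable lborel" "g \<in> borel_measurable lborel"
    using assms by (auto simp: L2_iff)
  have "ennreal (norm (LINT t|lborel. f t * g t)) \<le> ennreal (LINT t|lborel. norm (f t * g t))"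
    by (intro ennreal_leI integral_norm_bound)
  also have "\<dots> = (\<integral>\<^sup>+t. ennreal (norm (f t)) * ennreal (norm (g t)) \<partial>lborel)"
    using integrable_norm[OF L2_mult_integrable[OF assms]]
    by (subst nn_integral_eq_integral[symmetric]) (auto simp: norm_mult ennreal_mult)
  finally have "(ennreal (norm (LINT t|lborel. f t * g t)))\<^sup>2 \<le> (\<integral>\<^sup>+t. ennreal (norm (f t)) * ennreal (norm (g t)) \<partial>lborel)\<^sup>2"
    by (intro power_mono) auto
  also have "\<dots> \<le> sqnorm f * sqnorm g"
    unfolding sqnorm_def using Cauchy_Schwarz_nn_integral[of "\<lambda>t. ennreal (norm (f t))" lborel "\<lambda>t. ennreal (norm (g t))"]
    by (simp add: ennreal_power)
  finally show ?thesis by (simp add: ennreal_power)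
qed

text \<open>The Riesz-Fischer theorem. A subsequence with squared distances at most 4^(-k) converges
  a.e.; Fatou's lemma along it bounds the distance from the limit to \<open>f n\<close> by the
  supremum \<open>M n\<close> of the distances beyond n.\<close>

lemma sqnorm_complete:
  fixes f :: "nat \<Rightarrow> real \<Rightarrow> complex"
  assumes [measurable]: "\<And>n. f n \<in> borel_measurable lborel"
    and Cauchy: "\<And>e. e > 0 \<Longrightarrow> \<exists>N. \<forall>m\<ge>N. \<forall>n\<ge>N. sqnorm (\<lambda>t. f m t - f n t) \<le> ennreal e"
  shows "\<exists>g. g \<in> borel_measurable lborel \<and> (\<lambda>n. sqnorm (\<lambda>t. g t - f n t)) \<longlonglongrightarrow> 0"
proof -
  have "\<exists>N. \<forall>m\<ge>N. \<forall>n\<ge>N. sqnorm (\<lambda>t. f m t - f n t) \<le> ennreal ((1/4) ^ k)" for k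
    by (rule Cauchy) simp
  then obtain N0 where N0: "\<And>k m n. m \<ge> N0 k \<Longrightarrow> n \<ge> N0 k \<Longrightarrow> sqnorm (\<lambda>t. f m t - f n t) \<le> ennreal ((1/4) ^ k)"
    by metis
  \<comment> \<open>The partial sums make \<open>N\<close> nondecreasing, so that \<open>N k\<close>
    and \<open>N (Suc k)\<close> both lie beyond \<open>N0 k\<close>; the added k forces
    \<open>N\<close> to infinity.\<close>
  define N where "N k = (\<Sum>i\<le>k. N0 i) + k" for k
  have N_ge: "N k \<ge> N0 k" "N k \<ge> k" "N (Suc k) \<ge> N k" for k
    by (auto simp: N_def intro: trans_le_add1 member_le_sum)
  define h where "h k = f (N k)" for k
  have [measurable]: "h k \<in> borel_measurable lborel" for k
    by (simp add: h_def)
  have hd: "sqnorm (\<lambda>t. h (Suc k) t - h k t) \<le> ennreal ((1/4) ^ k)" for k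
    unfolding h_def using N_ge[of k] by (intro N0) auto
  have "(\<integral>\<^sup>+t. (\<Sum>k. ennreal (2 ^ k * (norm (h (Suc k) t - h k t))\<^sup>2)) \<partial>lborel)
      = (\<Sum>k. \<integral>\<^sup>+t. ennreal (2 ^ k) * ennreal ((norm (h (Suc k) t - h k t))\<^sup>2) \<partial>lborel)"
    by (subst nn_integral_suminf[symmetric]) (auto simp: ennreal_mult)
  also have "\<dots> = (\<Sum>k. ennreal (2 ^ k) * sqnorm (\<lambda>t. h (Suc k) t - h k t))"
    by (simp add: sqnorm_def nn_integral_cmult)
  also have "\<dots> \<le> (\<Sum>k. ennreal (2 ^ k) * ennreal ((1/4) ^ k))"
    by (intro suminf_le mult_left_mono hd) auto
  also have "\<dots> = (\<Sum>k. ennreal ((1/2) ^ k))"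
    by (simp add: ennreal_mult[symmetric] power_mult_distrib[symmetric])
  also have "\<dots> < \<infinity>"
    by (simp add: ennreal_suminf_neq_top less_top[symmetric] summable_geometric)
  \<comment> \<open>The weight 2^k is summable against 4^(-k), and finiteness of the weighted sum at
    t turns into geometric decay of the increments with ratio sqrt (1/2).\<close>
  finally have "AE t in lborel. (\<Sum>k. ennreal (2 ^ k * (norm (h (Suc k) t - h k t))\<^sup>2)) \<noteq> \<infinity>"
    by (intro nn_integral_PInf_AE) auto
  then have conv: "AE t in lborel. convergent (\<lambda>k. h k t)"
  proof eventually_elim
    case (elim t)
    then have "summable (\<lambda>k. 2 ^ k * (norm (h (Suc k) t - h k t))\<^sup>2)"
      by (intro summable_suminf_not_top) auto
    then have "Bseq (\<lambda>k. 2 ^ k * (norm (h (Suc k) t - h k t))\<^sup>2)"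
      by (intro convergent_imp_Bseq convergentI[of _ 0] summable_LIMSEQ_zero)
    then obtain C where C: "\<And>k. norm (2 ^ k * (norm (h (Suc k) t - h k t))\<^sup>2) \<le> C"
      unfolding Bseq_def by blast
    have bound: "norm (h (Suc k) t - h k t) \<le> sqrt C * sqrt (1/2) ^ k" for k
    proof -
      have "(norm (h (Suc k) t - h k t))\<^sup>2 \<le> C * (1/2) ^ k"
        using C[of k] by (simp add: field_simps power_one_over abs_mult)
      then have "sqrt ((norm (h (Suc k) t - h k t))\<^sup>2) \<le> sqrt (C * (1/2) ^ k)"
        by (rule real_sqrt_le_mono)
      then show ?thesis by (simp add: real_sqrt_mult real_sqrt_power)
    qed
    have "summable (\<lambda>k. sqrt C * sqrt (1/2) ^ k)"
      by (intro summable_mult summable_geometric) (auto simp: real_sqrt_divide)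
    then have "summable (\<lambda>k. h (Suc k) t - h k t)"
      by (rule summable_comparison_test') (rule bound)
    then have "convergent (\<lambda>n. \<Sum>k<n. h (Suc k) t - h k t)"
      by (simp add: summable_iff_convergent)
    then have "convergent (\<lambda>n. h n t - h 0 t)"
      by (subst (asm) sum_lessThan_telescope)
    then show ?case
      using convergent_add[OF _ convergent_const[of "h 0 t"], of "\<lambda>n. h n t - h 0 t"] by simp
  qed
  define g where "g t = lim (\<lambda>k. h k t)" for t
  have [measurable]: "g \<in> borel_measurable lborel"
    unfolding g_def by measurable
  have lim: "AE t in lborel. (\<lambda>k. h k t) \<longlonglongrightarrow> g t"
    using conv by eventually_elim (simp add: g_def convergent_LIMSEQ_iff)
  have "(\<lambda>n. sqnorm (\<lambda>t. g t - f n t)) \<longlonglongrightarrow> 0"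
  proof (rule tendsto_sandwich[OF _ _ tendsto_const])
    define M where "M n = (SUP m\<in>{n..}. sqnorm (\<lambda>t. f m t - f n t))" for n
    show "eventually (\<lambda>n. sqnorm (\<lambda>t. g t - f n t) \<le> M n) sequentially"
    proof (intro always_eventually allI)
      fix n
      have "sqnorm (\<lambda>t. g t - f n t) = (\<integral>\<^sup>+t. liminf (\<lambda>k. ennreal ((norm (h k t - f n t))\<^sup>2)) \<partial>lborel)"
        unfolding sqnorm_def
      proof (rule nn_integral_cong_AE)
        show "AE t in lborel. ennreal ((norm (g t - f n t))\<^sup>2) = liminf (\<lambda>k. ennreal ((norm (h k t - f n t))\<^sup>2))"
          using lim
        proof eventually_elim
          case (elim t)
          then have "(\<lambda>k. ennreal ((norm (h k t - f n t))\<^sup>2)) \<longlonglongrightarrow> ennreal ((norm (g t - f n t))\<^sup>2)"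
            by (intro tendsto_ennrealI tendsto_intros)
          from lim_imp_Liminf[OF sequentially_bot this] show ?case by (rule sym)
        qed
      qed
      also have "\<dots> \<le> liminf (\<lambda>k. sqnorm (\<lambda>t. h k t - f n t))"
        unfolding sqnorm_def by (rule nn_integral_liminf) measurable
      also have "\<dots> \<le> liminf (\<lambda>k::nat. M n)"
      proof (rule Liminf_mono)
        show "\<forall>\<^sub>F k in sequentially. sqnorm (\<lambda>t. h k t - f n t) \<le> M n"
        proof (rule eventually_sequentiallyI[of n])
          fix k assume "n \<le> k"
          then have "n \<le> N k" using N_ge(2)[of k] by linarith
          then show "sqnorm (\<lambda>t. h k t - f n t) \<le> M n"
            unfolding M_def h_def by (intro SUP_upper) auto
        qed
      qed
      finally show "sqnorm (\<lambda>t. g t - f n t) \<le> M n"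
        by (simp add: Liminf_const)
    qed
    show "M \<longlonglongrightarrow> 0"
    proof (rule order_tendstoI)
      fix a :: ennreal assume "a > 0"
      then obtain e where e: "e > 0" "ennreal e < a"
        by (metis dense ennreal_cases ennreal_less_zero_iff less_top_ennreal not_less_iff_gr_or_eq top.extremum_strict)
      obtain N1 where "\<forall>m\<ge>N1. \<forall>n\<ge>N1. sqnorm (\<lambda>t. f m t - f n t) \<le> ennreal e"
        using Cauchy[OF e(1)] by blast
      then have "M n \<le> ennreal e" if "n \<ge> N1" for n
        unfolding M_def using that by (intro SUP_least) auto
      then show "\<forall>\<^sub>F n in sequentially. M n < a"
        using e(2) by (intro eventually_sequentiallyI[of N1]) (auto intro: le_less_trans)
    qed simp
  qed simp
  then show ?thesis by (intro exI[of _ g]) simp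
qed

definition trunc :: "nat \<Rightarrow> (real \<Rightarrow> complex) \<Rightarrow> real \<Rightarrow> complex" where
  "trunc n \<phi> t = indicator {- real n..real n} t * \<phi> t"

lemma is_fourier_L2_iff:
  "is_fourier_L2 \<phi> g \<longleftrightarrow> g \<in> L2 \<and> (\<lambda>n. sqnorm (\<lambda>\<tau>. g \<tau> - fourier_integral (trunc n \<phi>) \<tau>)) \<longlonglongrightarrow> 0"
  by (simp add: is_fourier_L2_def sqnorm_def trunc_def[abs_def])

lemma measurable_trunc [measurable]:
  "\<phi> \<in> borel_measurable borel \<Longrightarrow> trunc n \<phi> \<in> borel_measurable borel"
  unfolding trunc_def[abs_def] by measurable

lemma trunc_L2: "\<phi> \<in> L2 \<Longrightarrow> trunc n \<phi> \<in> L2"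
proof -
  assume phi: "\<phi> \<in> L2"
  have "sqnorm (trunc n \<phi>) \<le> sqnorm \<phi>"
    by (intro sqnorm_mono) (simp add: trunc_def indicator_def)
  also have "\<dots> < \<infinity>"
    using phi by (simp add: L2_iff)
  finally show ?thesis
    using phi by (simp add: L2_iff measurable_trunc)
qed

lemma trunc_integrable:
  assumes "\<phi> \<in> L2"
  shows "integrable lborel (trunc n \<phi>)"
proof -
  have "(\<lambda>t. indicator {- real n..real n} t :: complex) \<in> L2"
  proof (rule L2I)
    have "(norm (indicator {- real n..real n} t :: complex))\<^sup>2 = (indicator {- real n..real n} t :: real)" for t
      by (simp add: indicator_def)
    then show "integrable lborel (\<lambda>t. (norm (indicator {- real n..real n} t :: complex))\<^sup>2)"
      by simp
  qed simp
  from L2_mult_integrable[OF this assms] show ?thesis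
    by (simp add: trunc_def[abs_def])
qed

lemma sqnorm_fourier_integral_le:
  "integrable lborel f \<Longrightarrow> sqnorm (fourier_integral f) \<le> sqnorm f"
  unfolding sqnorm_def by (rule bessel)

lemma fourier_integral_L2:
  assumes "f \<in> L2" "integrable lborel f"
  shows "fourier_integral f \<in> L2"
  using assms measurable_fourier_integral[of f] sqnorm_fourier_integral_le[of f]
  by (auto simp: L2_iff intro: le_less_trans)

lemma trunc_Cauchy:
  assumes phi: "\<phi> \<in> L2" and e: "e > 0"
  shows "\<exists>N. \<forall>n\<ge>N. sqnorm (\<lambda>t. \<phi> t - trunc n \<phi> t) \<le> ennreal e"
proof -
  have [measurable]: "\<phi> \<in> borel_measurable lborel" using phi by (simp add: L2_iff)
  have "(\<lambda>n. LINT t|lborel. (norm (\<phi> t - trunc n \<phi> t))\<^sup>2) \<longlonglongrightarrow> (LINT t|(lborel :: real measure). 0)"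
  proof (rule integral_dominated_convergence)
    show "integrable lborel (\<lambda>t. (norm (\<phi> t))\<^sup>2)" by (rule L2_integrable[OF phi])
    show "AE t in lborel. (\<lambda>n. (norm (\<phi> t - trunc n \<phi> t))\<^sup>2) \<longlonglongrightarrow> 0"
    proof (rule AE_I2)
      fix t :: real
      obtain n0 :: nat where n0: "\<bar>t\<bar> \<le> real n0" using real_arch_simple by blast
      have "(norm (\<phi> t - trunc n \<phi> t))\<^sup>2 = 0" if "n \<ge> n0" for n
      proof -
        have "t \<in> {- real n..real n}" using n0 that by auto
        then show ?thesis by (simp add: trunc_def)
      qed
      then show "(\<lambda>n. (norm (\<phi> t - trunc n \<phi> t))\<^sup>2) \<longlonglongrightarrow> 0"
        by (intro tendsto_eventually eventually_sequentiallyI[of n0])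
    qed
    show "AE t in lborel. norm ((norm (\<phi> t - trunc n \<phi> t))\<^sup>2) \<le> (norm (\<phi> t))\<^sup>2" for n
      by (intro AE_I2) (auto simp: trunc_def indicator_def)
  qed measurable
  then have "\<forall>\<^sub>F n in sequentially. (LINT t|lborel. (norm (\<phi> t - trunc n \<phi> t))\<^sup>2) < e"
    using e by (intro order_tendstoD(2)[where y=0]) auto
  then obtain N where N: "\<And>n. n \<ge> N \<Longrightarrow> (LINT t|lborel. (norm (\<phi> t - trunc n \<phi> t))\<^sup>2) < e"
    by (auto simp: eventually_sequentially)
  have "sqnorm (\<lambda>t. \<phi> t - trunc n \<phi> t) = ennreal (LINT t|lborel. (norm (\<phi> t - trunc n \<phi> t))\<^sup>2)" for n
    unfolding sqnorm_def
    by (intro nn_integral_eq_integral L2_integrable L2_diff phi trunc_L2) auto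
  with N show ?thesis by (intro exI[of _ N] allI impI) (simp add: ennreal_leI less_imp_le)
qed

text \<open>Bessel's inequality transfers the Cauchy property from the truncations to their
  transforms. The tolerance e/4 pays for the factors 2 in \<open>sqnorm_diff\<close>.\<close>

lemma is_fourier_L2_exists:
  assumes phi: "\<phi> \<in> L2"
  shows "\<exists>g. is_fourier_L2 \<phi> g"
proof -
  have [measurable]: "\<phi> \<in> borel_measurable lborel" using phi by (simp add: L2_iff)
  have [measurable]: "fourier_integral (trunc n \<phi>) \<in> borel_measurable lborel" for n
    using measurable_fourier_integral[OF trunc_integrable[OF phi]] by simp
  have "\<exists>g. g \<in> borel_measurable lborel \<and> (\<lambda>n. sqnorm (\<lambda>t. g t - fourier_integral (trunc n \<phi>) t)) \<longlonglongrightarrow> 0"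
  proof (rule sqnorm_complete)
    fix e :: real assume e: "e > 0"
    obtain N where N: "\<And>n. n \<ge> N \<Longrightarrow> sqnorm (\<lambda>t. \<phi> t - trunc n \<phi> t) \<le> ennreal (e / 4)"
      using trunc_Cauchy[OF phi, of "e / 4"] e by auto
    have "sqnorm (\<lambda>t. fourier_integral (trunc m \<phi>) t - fourier_integral (trunc n \<phi>) t) \<le> ennreal e"
      if "m \<ge> N" "n \<ge> N" for m n
    proof -
      have "sqnorm (\<lambda>t. fourier_integral (trunc m \<phi>) t - fourier_integral (trunc n \<phi>) t)
          = sqnorm (fourier_integral (\<lambda>t. trunc m \<phi> t - trunc n \<phi> t))"
        using trunc_integrable[OF phi] by (simp add: sqnorm_def fourier_integral_diff)
      also have "\<dots> \<le> sqnorm (\<lambda>t. trunc m \<phi> t - trunc n \<phi> t)"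
        using trunc_integrable[OF phi] by (intro sqnorm_fourier_integral_le) auto
      also have "\<dots> = sqnorm (\<lambda>t. (\<phi> t - trunc n \<phi> t) - (\<phi> t - trunc m \<phi> t))"
        by simp
      also have "\<dots> \<le> 2 * sqnorm (\<lambda>t. \<phi> t - trunc n \<phi> t) + 2 * sqnorm (\<lambda>t. \<phi> t - trunc m \<phi> t)"
        by (intro sqnorm_diff) auto
      also have "\<dots> \<le> 2 * ennreal (e / 4) + 2 * ennreal (e / 4)"
        using that by (intro add_mono mult_left_mono N) auto
      also have "\<dots> = ennreal (2 * (e / 4) + 2 * (e / 4))"
        using e by (simp only: ennreal_plus ennreal_mult) (simp add: ennreal_mult[symmetric])
      finally show ?thesis by simp
    qed
    then show "\<exists>N. \<forall>m\<ge>N. \<forall>n\<ge>N. sqnorm (\<lambda>t. fourier_integral (trunc m \<phi>) t - fourier_integral (trunc n \<phi>) t) \<le> ennreal e"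
      by blast
  qed measurable
  then obtain g where [measurable]: "g \<in> borel_measurable lborel"
    and g: "(\<lambda>n. sqnorm (\<lambda>t. g t - fourier_integral (trunc n \<phi>) t)) \<longlonglongrightarrow> 0" by blast
  have "\<forall>\<^sub>F n in sequentially. sqnorm (\<lambda>t. g t - fourier_integral (trunc n \<phi>) t) < 1"
    using g by (rule order_tendstoD(2)) simp
  then obtain n where n: "sqnorm (\<lambda>t. g t - fourier_integral (trunc n \<phi>) t) < 1"
    by (auto simp: eventually_sequentially)
  have "(\<lambda>t. g t - fourier_integral (trunc n \<phi>) t) \<in> L2"
    using n by (auto simp: L2_iff intro: less_trans)
  moreover have "fourier_integral (trunc n \<phi>) \<in> L2"
    by (intro fourier_integral_L2 trunc_L2 trunc_integrable phi)
  ultimately have "g \<in> L2"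
    using L2_add by fastforce
  with g show ?thesis by (auto simp: is_fourier_L2_iff)
qed

lemma is_fourier_L2_fourier_L2: "\<phi> \<in> L2 \<Longrightarrow> is_fourier_L2 \<phi> (fourier_L2 \<phi>)"
  unfolding fourier_L2_def by (rule someI_ex[OF is_fourier_L2_exists])

lemma fourier_L2_L2: "\<phi> \<in> L2 \<Longrightarrow> fourier_L2 \<phi> \<in> L2"
  using is_fourier_L2_fourier_L2 by (simp add: is_fourier_L2_iff)

text \<open>The main access to the chosen representative \<open>fourier_L2\<close>. The
  multiplication formula for the truncations passes to the limit, by Cauchy-Schwarz on the frequency
  side and by dominated convergence on the other.\<close>

lemma fourier_L2_swap:
  assumes phi: "\<phi> \<in> L2" and G: "G \<in> L2" "integrable lborel G"
  shows "(LINT \<tau>|lborel. fourier_L2 \<phi> \<tau> * G \<tau>) = (LINT t|lborel. \<phi> t * fourier_integral G t)"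
proof (rule LIMSEQ_unique)
  have [measurable]: "\<phi> \<in> borel_measurable lborel" using phi by (simp add: L2_iff)
  have FG: "fourier_integral G \<in> L2" by (rule fourier_integral_L2[OF G])
  then have [measurable]: "fourier_integral G \<in> borel_measurable lborel" by (simp add: L2_iff)
  let ?g = "fourier_L2 \<phi>"
  let ?f = "\<lambda>n. fourier_integral (trunc n \<phi>)"
  have g: "?g \<in> L2" "(\<lambda>n. sqnorm (\<lambda>\<tau>. ?g \<tau> - ?f n \<tau>)) \<longlonglongrightarrow> 0"
    using is_fourier_L2_fourier_L2[OF phi] by (auto simp: is_fourier_L2_iff)
  have fn: "?f n \<in> L2" for n
    by (intro fourier_integral_L2 trunc_L2 trunc_integrable phi)
  have "(\<lambda>n. sqnorm (\<lambda>\<tau>. ?g \<tau> - ?f n \<tau>) * sqnorm G) \<longlonglongrightarrow> 0 * sqnorm G"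
    using G by (intro tendsto_mult_ennreal g tendsto_const) (auto simp: L2_iff)
  then have upper: "(\<lambda>n. sqnorm (\<lambda>\<tau>. ?g \<tau> - ?f n \<tau>) * sqnorm G) \<longlonglongrightarrow> 0"
    by simp
  have "(\<lambda>n. ennreal ((norm (LINT \<tau>|lborel. (?g \<tau> - ?f n \<tau>) * G \<tau>))\<^sup>2)) \<longlonglongrightarrow> 0"
  proof (rule tendsto_sandwich[OF _ _ tendsto_const upper])
    show "\<forall>\<^sub>F n in sequentially. ennreal ((norm (LINT \<tau>|lborel. (?g \<tau> - ?f n \<tau>) * G \<tau>))\<^sup>2)
        \<le> sqnorm (\<lambda>\<tau>. ?g \<tau> - ?f n \<tau>) * sqnorm G"
      by (intro always_eventually allI norm_integral_mult_le L2_diff[OF g(1) fn] G(1))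
  qed simp
  then have "(\<lambda>n. (norm (LINT \<tau>|lborel. (?g \<tau> - ?f n \<tau>) * G \<tau>))\<^sup>2) \<longlonglongrightarrow> 0"
    by (subst (asm) ennreal_tendsto_0_iff) auto
  then have "(\<lambda>n. LINT \<tau>|lborel. (?g \<tau> - ?f n \<tau>) * G \<tau>) \<longlonglongrightarrow> 0"
    by (simp add: tendsto_norm_zero_iff)
  then have "(\<lambda>n. (LINT \<tau>|lborel. ?g \<tau> * G \<tau>) - (LINT \<tau>|lborel. ?f n \<tau> * G \<tau>)) \<longlonglongrightarrow> 0"
    using L2_mult_integrable[OF g(1) G(1)] L2_mult_integrable[OF fn G(1)] by (simp add: left_diff_distrib)
  then show "(\<lambda>n. LINT \<tau>|lborel. ?f n \<tau> * G \<tau>) \<longlonglongrightarrow> (LINT \<tau>|lborel. ?g \<tau> * G \<tau>)"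
    using tendsto_diff[OF tendsto_const[of "LINT \<tau>|lborel. ?g \<tau> * G \<tau>"]] by fastforce
  have "(\<lambda>n. LINT t|lborel. trunc n \<phi> t * fourier_integral G t) \<longlonglongrightarrow> (LINT t|lborel. \<phi> t * fourier_integral G t)"
  proof (rule integral_dominated_convergence)
    show "integrable lborel (\<lambda>t. norm (\<phi> t * fourier_integral G t))"
      using L2_mult_integrable[OF phi FG] by (rule integrable_norm)
    show "AE t in lborel. (\<lambda>n. trunc n \<phi> t * fourier_integral G t) \<longlonglongrightarrow> \<phi> t * fourier_integral G t"
    proof (rule AE_I2)
      fix t :: real
      obtain n0 :: nat where n0: "\<bar>t\<bar> \<le> real n0" using real_arch_simple by blast
      have "trunc n \<phi> t * fourier_integral G t = \<phi> t * fourier_integral G t" if "n \<ge> n0" for n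
      proof -
        have "t \<in> {- real n..real n}" using n0 that by auto
        then show ?thesis by (simp add: trunc_def)
      qed
      then show "(\<lambda>n. trunc n \<phi> t * fourier_integral G t) \<longlonglongrightarrow> \<phi> t * fourier_integral G t"
        by (intro tendsto_eventually eventually_sequentiallyI[of n0])
    qed
    show "AE t in lborel. norm (trunc n \<phi> t * fourier_integral G t) \<le> norm (\<phi> t * fourier_integral G t)" for n
      by (intro AE_I2) (auto simp: trunc_def indicator_def norm_mult)
  qed measurable
  then show "(\<lambda>n. LINT \<tau>|lborel. ?f n \<tau> * G \<tau>) \<longlonglongrightarrow> (LINT t|lborel. \<phi> t * fourier_integral G t)"
    by (simp add: fourier_integral_swap[OF trunc_integrable[OF phi] G(2)])
qed

lemma gauss_L2: "gauss \<in> L2"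
proof (rule L2I)
  have "(norm (gauss t))\<^sup>2 = norm (gauss (sqrt 2 * t))" for t
    by (simp add: gauss_def power_mult_distrib exp_double[symmetric])
  then show "integrable lborel (\<lambda>t. (norm (gauss t))\<^sup>2)"
    using integrable_gauss_scale[of "sqrt 2"] by (simp add: integrable_norm)
qed simp

lemma wave_gauss_L2: "(\<lambda>t. wave s t * gauss t) \<in> L2"
  using L2_measurable[OF gauss_L2] L2_integrable[OF gauss_L2] by (intro L2I) (auto simp: norm_mult)

lemma gauss_shift_L2: "(\<lambda>t. gauss (t - s)) \<in> L2"
  using lborel_integrable_real_affine[OF L2_integrable[OF gauss_L2], of 1 "-s"]
  by (intro L2I) (auto simp: algebra_simps)

lemma fourier_L2_eq_fourier_integral:
  assumes f: "f \<in> L2" "integrable lborel f"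
  shows "AE \<tau> in lborel. fourier_L2 f \<tau> = fourier_integral f \<tau>"
proof (rule AE_eq_of_gauss_tests)
  show "integrable lborel (\<lambda>t. gauss t * fourier_L2 f t)"
    by (intro L2_mult_integrable gauss_L2 fourier_L2_L2 f)
  show "integrable lborel (\<lambda>t. gauss t * fourier_integral f t)"
    by (intro L2_mult_integrable gauss_L2 fourier_integral_L2 f)
  fix s
  show "(LINT t|lborel. wave s t * (gauss t * fourier_L2 f t)) = (LINT t|lborel. wave s t * (gauss t * fourier_integral f t))"
    using fourier_L2_swap[OF f(1) wave_gauss_L2[of s]] fourier_integral_swap[OF f(2), of "\<lambda>t. wave s t * gauss t"]
      integrable_wave_mult[OF integrable_gauss, of s] by (simp add: mult_ac)
qed

text \<open>Uniqueness across the two notions of transform. It converts multiplier equations for L2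
  functions into convolution equations, whose right-hand sides are known to be in L1.\<close>

lemma eq_of_fourier_L2_eq_fourier_integral:
  assumes f: "f \<in> L2" and h: "integrable lborel h"
    and eq: "AE \<tau> in lborel. fourier_L2 f \<tau> = fourier_integral h \<tau>"
  shows "AE t in lborel. f t = h t"
proof (rule AE_eq_of_gauss_tests)
  have [measurable]: "fourier_L2 f \<in> borel_measurable lborel" "fourier_integral h \<in> borel_measurable lborel"
    using L2_measurable[OF fourier_L2_L2[OF f]] measurable_fourier_integral[OF h] by auto
  show "integrable lborel (\<lambda>t. gauss t * f t)"
    by (intro L2_mult_integrable gauss_L2 f)
  show "integrable lborel (\<lambda>t. gauss t * h t)"
    by (rule integrable_gauss_mult[OF h])
  fix s
  have "(LINT t|lborel. wave s t * (gauss t * f t)) = (LINT t|lborel. f t * fourier_integral (\<lambda>\<tau>. gauss (\<tau> - s)) t)"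
    by (simp add: fourier_integral_gauss_shift wave_commute[of s] mult_ac)
  also have "\<dots> = (LINT \<tau>|lborel. fourier_L2 f \<tau> * gauss (\<tau> - s))"
    by (rule fourier_L2_swap[OF f gauss_shift_L2 integrable_gauss_shift, symmetric])
  also have "\<dots> = (LINT \<tau>|lborel. fourier_integral h \<tau> * gauss (\<tau> - s))"
    using eq by (intro integral_cong_AE) auto
  also have "\<dots> = (LINT t|lborel. h t * fourier_integral (\<lambda>\<tau>. gauss (\<tau> - s)) t)"
    by (rule fourier_integral_swap[OF h integrable_gauss_shift])
  also have "\<dots> = (LINT t|lborel. wave s t * (gauss t * h t))"
    by (simp add: fourier_integral_gauss_shift wave_commute[of s] mult_ac)
  finally show "(LINT t|lborel. wave s t * (gauss t * f t)) = (LINT t|lborel. wave s t * (gauss t * h t))" .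
qed

section \<open>The symbol and its Green function\<close>

lemma integral_FTC_UNIV:
  fixes F f :: "real \<Rightarrow> 'a::euclidean_space"
  assumes F: "\<And>x. (F has_vector_derivative f x) (at x)" and f: "\<And>x. isCont f x"
    and int: "integrable lborel f"
    and A: "(F \<longlongrightarrow> A) at_bot" and B: "(F \<longlongrightarrow> B) at_top"
  shows "(LINT x|lborel. f x) = B - A"
proof -
  have "(LBINT x=-\<infinity>..\<infinity>. f x) = B - A"
    using F f A B int
    by (intro interval_integral_FTC_integrable) (auto simp: ereal_tendsto_simps set_integrable_def)
  then show ?thesis
    by (simp add: interval_lebesgue_integral_def set_lebesgue_integral_def)
qed

lemma exp_half_line:
  fixes z :: complex
  assumes z: "Re z > 0"
  shows "integrable lborel (\<lambda>t. indicator {0<..} t * exp (- (z * of_real t)))" (is "integrable lborel ?f")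
    and "(LINT t|lborel. indicator {0<..} t * exp (- (z * of_real t))) = 1 / z"
proof -
  have "(\<integral>\<^sup>+t. ennreal (exp (- (Re z * t))) * indicator {0..} t \<partial>lborel) = ennreal (0 - (- exp (- (Re z * 0)) / Re z))"
  proof (rule nn_integral_FTC_atLeast)
    show "((\<lambda>t. - exp (- (Re z * t)) / Re z) \<longlongrightarrow> 0) at_top"
      using z by real_asymp
  qed (use z in \<open>auto intro!: derivative_eq_intros\<close>)
  moreover have "(\<integral>\<^sup>+t. ennreal (norm (?f t)) \<partial>lborel) \<le> (\<integral>\<^sup>+t. ennreal (exp (- (Re z * t))) * indicator {0..} t \<partial>lborel)"
    by (intro nn_integral_mono) (auto simp: indicator_def norm_exp_eq_Re)
  ultimately show int: "integrable lborel ?f"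
    by (intro integrableI_bounded) (auto intro: le_less_trans)
  have eq: "?f t = indicator {0<..} t *\<^sub>R exp (- (z * of_real t))" for t
    by (simp add: indicator_def)
  have "(LBINT t=0..\<infinity>. exp (- (z * of_real t))) = 0 - (- 1 / z)"
  proof (rule interval_integral_FTC_integrable[where F="\<lambda>t. - exp (- (z * of_real t)) / z"])
    have znz: "z \<noteq> 0" using z by auto
    show "((\<lambda>t. - exp (- (z * of_real t)) / z) has_vector_derivative exp (- (z * of_real t))) (at t)" for t :: real
      by (rule has_vector_derivative_real_field) (use znz in \<open>auto intro!: derivative_eq_intros\<close>)
    show "isCont (\<lambda>t::real. exp (- (z * of_real t))) t" for t
      by (intro continuous_intros)
    show "set_integrable lborel (einterval 0 \<infinity>) (\<lambda>t. exp (- (z * of_real t)))"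
      using int unfolding set_integrable_def eq by (simp add: zero_ereal_def)
    have "isCont (\<lambda>t::real. - exp (- (z * of_real t)) / z) 0"
      using znz by (intro continuous_intros)
    then have "((\<lambda>t::real. - exp (- (z * of_real t)) / z) \<longlongrightarrow> - 1 / z) (at_right 0)"
      by (auto simp: isCont_def intro: tendsto_within_subset)
    then show "(((\<lambda>t::real. - exp (- (z * of_real t)) / z) \<circ> real_of_ereal) \<longlongrightarrow> - 1 / z) (at_right 0)"
      unfolding zero_ereal_def by (simp add: ereal_tendsto_simps)
    have "((\<lambda>t. exp (- (Re z * t))) \<longlongrightarrow> 0) at_top" using z by real_asymp
    then have "((\<lambda>t::real. exp (- (z * of_real t))) \<longlongrightarrow> 0) at_top"
      by (intro tendsto_norm_zero_cancel[where f="\<lambda>t::real. exp (- (z * of_real t))"]) (simp add: norm_exp_eq_Re)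
    from tendsto_divide[OF tendsto_minus[OF this] tendsto_const[of z]] znz
    have "((\<lambda>t::real. - exp (- (z * of_real t)) / z) \<longlongrightarrow> 0) at_top" by simp
    then show "(((\<lambda>t::real. - exp (- (z * of_real t)) / z) \<circ> real_of_ereal) \<longlongrightarrow> 0) (at_left \<infinity>)"
      by (simp add: ereal_tendsto_simps)
  qed simp
  then show "(LINT t|lborel. ?f t) = 1 / z"
    unfolding eq by (simp add: interval_lebesgue_integral_0_infty set_lebesgue_integral_def)
qed

text \<open>Apart from the point 0 these are two half lines with conjugate exponents z = a + i
  \<tau> and \<open>cnj z\<close>, and the value is 1/z + 1/\<open>cnj z\<close>.\<close>

lemma exp_abs_fourier:
  assumes a: "a > 0"
  shows "integrable lborel (\<lambda>t. exp (- (a * \<bar>t\<bar>)))"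
    and "(LINT t|lborel. exp (- (a * \<bar>t\<bar>))) = 2 / a"
    and "(LINT t|lborel. wave \<tau> t * of_real (exp (- (a * \<bar>t\<bar>)))) = of_real (2 * a / (a\<^sup>2 + \<tau>\<^sup>2))"
proof -
  have main: "integrable lborel (\<lambda>t. wave \<tau> t * of_real (exp (- (a * \<bar>t\<bar>)))) \<and>
     (LINT t|lborel. wave \<tau> t * of_real (exp (- (a * \<bar>t\<bar>)))) = of_real (2 * a / (a\<^sup>2 + \<tau>\<^sup>2))" for \<tau>
  proof -
    define z where "z = Complex a \<tau>"
    have zi: "z = of_real a + \<i> * of_real \<tau>" by (simp add: z_def complex_eq_iff)
    have zc: "cnj z = of_real a - \<i> * of_real \<tau>" by (simp add: z_def complex_eq_iff)
    have p: "Re z > 0" "Re (cnj z) > 0" using a by (auto simp: z_def)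
    let ?f = "\<lambda>z t. indicator {0<..} t * exp (- (z * of_real t)) :: complex"
    have i2: "integrable lborel (\<lambda>t. ?f (cnj z) (- t))"
      using lborel_integrable_real_affine[OF exp_half_line(1)[OF p(2)], of "-1" 0] by simp
    have v2: "(LINT t|lborel. ?f (cnj z) (- t)) = 1 / cnj z"
      using exp_half_line(2)[OF p(2)] by (subst (asm) lborel_integral_real_affine[of "-1" _ 0]) auto
    have eq: "AE t in lborel. wave \<tau> t * of_real (exp (- (a * \<bar>t\<bar>))) = ?f z t + ?f (cnj z) (- t)"
      using AE_lborel_singleton[of "0::real"]
    proof eventually_elim
      case (elim t)
      then show ?case
        by (cases "t > 0") (auto simp: indicator_def wave_def zi zc exp_of_real[symmetric] exp_add[symmetric] algebra_simps)
    qed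
    have m: "(\<lambda>t. wave \<tau> t * of_real (exp (- (a * \<bar>t\<bar>)))) \<in> borel_measurable lborel" by measurable
    have s: "integrable lborel (\<lambda>t. ?f z t + ?f (cnj z) (- t))"
      using exp_half_line(1)[OF p(1)] i2 by (rule Bochner_Integration.integrable_add)
    have "1 / z + 1 / cnj z = of_real (2 * a / (a\<^sup>2 + \<tau>\<^sup>2))"
    proof -
      have "z * cnj z = of_real (a\<^sup>2 + \<tau>\<^sup>2)" "z + cnj z = of_real (2 * a)"
        by (simp_all add: z_def complex_eq_iff power2_eq_square)
      moreover have "z \<noteq> 0" "cnj z \<noteq> 0" using p by auto
      then have "1 / z + 1 / cnj z = (z + cnj z) / (z * cnj z)" by (simp add: field_simps)
      ultimately show ?thesis by simp
    qed
    moreover have "(LINT t|lborel. wave \<tau> t * of_real (exp (- (a * \<bar>t\<bar>)))) = 1 / z + 1 / cnj z"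
      using integral_cong_AE[OF m _ eq] s exp_half_line[OF p(1)] i2 v2 by simp
    ultimately show ?thesis
      using integrable_cong_AE[OF m _ eq] s by auto
  qed
  from main[of 0] have i: "complex_integrable lborel (\<lambda>t. of_real (exp (- (a * \<bar>t\<bar>))))"
    and v: "(LINT t|lborel. complex_of_real (exp (- (a * \<bar>t\<bar>)))) = of_real (2 * a / a\<^sup>2)" by simp_all
  show "integrable lborel (\<lambda>t. exp (- (a * \<bar>t\<bar>)))"
    using integrable_Re[OF i] by simp
  show "(LINT t|lborel. exp (- (a * \<bar>t\<bar>))) = 2 / a"
    using v a unfolding integral_complex_of_real of_real_eq_iff by (simp add: power2_eq_square)
  show "(LINT t|lborel. wave \<tau> t * of_real (exp (- (a * \<bar>t\<bar>)))) = of_real (2 * a / (a\<^sup>2 + \<tau>\<^sup>2))"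
    using main by blast
qed

section \<open>Partial fractions of the hyperbolic cotangent\<close>

lemma sinh_product_formula:
  fixes y :: real
  shows "(\<lambda>n. pi * y * (\<Prod>k=1..n. 1 + y\<^sup>2 / (real k)\<^sup>2)) \<longlonglongrightarrow> sinh (pi * y)"
proof -
  have s: "sin (of_real pi * (\<i> * of_real y)) = \<i> * of_real (sinh (pi * y))"
  proof -
    have "sin (\<i> * of_real (pi * y)) = \<i> * sinh (complex_of_real (pi * y))"
      by (simp add: sinh_conv_sin)
    also have "sinh (complex_of_real (pi * y)) = of_real (sinh (pi * y))"
      by (simp add: sinh_def scaleR_conv_of_real flip: exp_of_real)
    finally show ?thesis by (simp add: mult_ac)
  qed
  have "(\<lambda>n. of_real pi * (\<i> * of_real y) * (\<Prod>k=1..n. 1 - (\<i> * of_real y)\<^sup>2 / (of_nat k)\<^sup>2))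
    \<longlonglongrightarrow> \<i> * of_real (sinh (pi * y))"
    using sin_product_formula_complex[of "\<i> * of_real y"] unfolding s .
  then have "(\<lambda>n. - \<i> * (of_real pi * (\<i> * of_real y) * (\<Prod>k=1..n. 1 - (\<i> * of_real y)\<^sup>2 / (of_nat k)\<^sup>2)))
    \<longlonglongrightarrow> - \<i> * (\<i> * of_real (sinh (pi * y)))"
    by (rule tendsto_mult_left)
  moreover have "- \<i> * (of_real pi * (\<i> * of_real y) * (\<Prod>k=1..n. 1 - (\<i> * of_real y)\<^sup>2 / (of_nat k)\<^sup>2))
    = complex_of_real (pi * y * (\<Prod>k=1..n. 1 + y\<^sup>2 / (real k)\<^sup>2))" for n
  proof -
    have "- \<i> * (a * (\<i> * b) * c) = - (\<i> * \<i>) * (a * b * c)" for a b c :: complex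
      by algebra
    moreover have "(\<Prod>k=1..n. 1 - (\<i> * complex_of_real y)\<^sup>2 / (of_nat k)\<^sup>2) = of_real (\<Prod>k=1..n. 1 + y\<^sup>2 / (real k)\<^sup>2)"
      by (simp add: power_mult_distrib)
    ultimately show ?thesis by simp
  qed
  moreover have "- \<i> * (\<i> * of_real (sinh (pi * y))) = complex_of_real (sinh (pi * y))"
    by simp
  ultimately show ?thesis
    by (simp only: tendsto_of_real_iff)
qed

text \<open>The logarithmic derivative of Euler's product for sinh, taken term by term and divided
  by 2 y.\<close>

lemma coth_partial_fractions:
  fixes y :: real
  assumes y: "y > 0"
  shows "(\<lambda>n. 1 / ((real n + 1)\<^sup>2 + y\<^sup>2)) sums ((pi * cosh (pi * y) / sinh (pi * y) - 1 / y) / (2 * y))"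
proof -
  define f where "f n x = ln (1 + x\<^sup>2 / (real n + 1)\<^sup>2)" for n and x :: real
  define f' where "f' n x = 2 * x / ((real n + 1)\<^sup>2 + x\<^sup>2)" for n and x :: real
  have pos: "1 + x\<^sup>2 / (real n + 1)\<^sup>2 > 0" for n and x :: real
    by (intro add_pos_nonneg) auto
  have fs: "(\<lambda>n. f n x) sums (ln (sinh (pi * x)) - ln (pi * x))" if x: "x > 0" for x
  proof -
    have "(\<lambda>n. ln (pi * x * (\<Prod>k=1..n. 1 + x\<^sup>2 / (real k)\<^sup>2))) \<longlonglongrightarrow> ln (sinh (pi * x))"
      using x by (intro tendsto_ln sinh_product_formula) auto
    moreover have "ln (pi * x * (\<Prod>k=1..n. 1 + x\<^sup>2 / (real k)\<^sup>2)) = ln (pi * x) + (\<Sum>k<n. f k x)" for n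
    proof -
      have "(\<Prod>k=1..n. 1 + x\<^sup>2 / (real k)\<^sup>2) = (\<Prod>k<n. 1 + x\<^sup>2 / (real k + 1)\<^sup>2)"
        by (rule prod.reindex_bij_witness[of _ Suc "\<lambda>k. k - 1"]) (auto simp: add.commute)
      moreover have "(\<Prod>k<n. 1 + x\<^sup>2 / (real k + 1)\<^sup>2) > 0" by (intro prod_pos ballI pos)
      moreover have "ln (\<Prod>k<n. 1 + x\<^sup>2 / (real k + 1)\<^sup>2) = (\<Sum>k<n. f k x)"
        unfolding f_def using pos[THEN less_imp_neq] by (subst ln_prod) (auto dest: sym)
      moreover have "ln (pi * x * P) = ln (pi * x) + ln P" if "P > 0" for P
        using x that by (intro ln_mult_pos) auto
      ultimately show ?thesis by (simp only:)
    qed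
    ultimately have "(\<lambda>n. ln (pi * x) + (\<Sum>k<n. f k x)) \<longlonglongrightarrow> ln (sinh (pi * x))" by simp
    from tendsto_diff[OF this tendsto_const[of "ln (pi * x)"]] show ?thesis
      by (simp add: sums_def)
  qed
  \<comment> \<open>A bounded neighbourhood of y, on which the derivatives are dominated by 4 y / (n
    + 1)^2 uniformly.\<close>
  define S where "S = {0<..<2 * y}"
  have unif: "uniformly_convergent_on S (\<lambda>n x. \<Sum>i<n. f' i x)"
  proof (rule Weierstrass_m_test')
    show "norm (f' n x) \<le> 4 * y * (1 / (real n + 1)\<^sup>2)" if "x \<in> S" for n x
    proof -
      have "norm (f' n x) = 2 * x / ((real n + 1)\<^sup>2 + x\<^sup>2)"
        using that by (simp add: f'_def S_def)
      also have "\<dots> \<le> 4 * y / (real n + 1)\<^sup>2"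
        using that by (intro frac_le) (auto simp: S_def)
      finally show ?thesis by simp
    qed
    show "summable (\<lambda>n. 4 * y * (1 / (real n + 1)\<^sup>2))"
      using inverse_squares_sums by (intro summable_mult) (auto simp: sums_iff add.commute)
  qed
  have der: "(f n has_field_derivative f' n x) (at x within S)" for n x
  proof -
    have "(f n has_field_derivative (1 / (1 + x\<^sup>2 / (real n + 1)\<^sup>2) * (2 * x / (real n + 1)\<^sup>2))) (at x within S)"
    proof -
      have "((\<lambda>x. ln (1 + x\<^sup>2 * c)) has_field_derivative (1 / (1 + x\<^sup>2 * c) * (2 * x * c))) (at x within S)"
        if "1 + x\<^sup>2 * c > 0" for c
        using that by (auto intro!: derivative_eq_intros)
      from this[of "1 / (real n + 1)\<^sup>2"] show ?thesis
        using pos[of x n] by (simp add: f_def[abs_def])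
    qed
    also have "1 / (1 + x\<^sup>2 / (real n + 1)\<^sup>2) * (2 * x / (real n + 1)\<^sup>2) = f' n x"
    proof -
      have "1 + x\<^sup>2 / (real n + 1)\<^sup>2 = ((real n + 1)\<^sup>2 + x\<^sup>2) / (real n + 1)\<^sup>2"
        by (simp add: add_divide_distrib)
      then show ?thesis by (simp add: f'_def)
    qed
    finally show ?thesis .
  qed
  have yS: "y \<in> S" "y \<in> interior S" using y by (auto simp: S_def)
  have d1: "((\<lambda>x. \<Sum>n. f n x) has_field_derivative (\<Sum>n. f' n y)) (at y)"
    by (rule has_field_derivative_series'[of S f f' y]) (use der unif fs[OF y] yS in \<open>auto simp: S_def sums_iff\<close>)
  have "((\<lambda>x. ln (sinh (pi * x)) - ln (pi * x)) has_field_derivative (pi * cosh (pi * y) / sinh (pi * y) - 1 / y)) (at y)"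
    using y by (auto intro!: derivative_eq_intros simp: field_simps)
  then have d2: "((\<lambda>x. \<Sum>n. f n x) has_field_derivative (pi * cosh (pi * y) / sinh (pi * y) - 1 / y)) (at y)"
  proof (rule has_field_derivative_transform_within_open[where S="{0<..}"])
    show "ln (sinh (pi * x)) - ln (pi * x) = (\<Sum>n. f n x)" if "x \<in> {0<..}" for x
      using fs[of x] that by (auto simp: sums_iff)
  qed (use y in auto)
  have "summable (\<lambda>n. f' n y)"
    using uniformly_convergent_imp_convergent[OF unif yS(1)] by (simp add: summable_iff_convergent)
  then have "(\<lambda>n. f' n y) sums (pi * cosh (pi * y) / sinh (pi * y) - 1 / y)"
    using DERIV_unique[OF d1 d2] by (simp add: sums_iff)
  from sums_divide[OF this, of "2 * y"] show ?thesis
    using y by (simp add: f'_def)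
qed

section \<open>Size, addition formula and reciprocal of the symbol\<close>

lemma tau_coth_uminus [simp]: "tau_coth (- \<tau>) = tau_coth \<tau>"
  by (simp add: tau_coth_def)

lemma tau_coth_0 [simp]: "tau_coth 0 = 2 / pi"
  by (simp add: tau_coth_def)

lemma tau_coth_abs: "tau_coth \<bar>\<tau>\<bar> = tau_coth \<tau>"
  by (cases "\<tau> \<ge> 0") auto

lemma measurable_tau_coth [measurable]: "tau_coth \<in> borel_measurable borel"
  unfolding tau_coth_def[abs_def] cosh_def sinh_def by measurable

lemma tau_coth_lower: "\<bar>\<tau>\<bar> \<le> tau_coth \<tau>" "0 < tau_coth \<tau>"
proof -
  have "\<tau> \<le> tau_coth \<tau> \<and> 0 < tau_coth \<tau>" if "\<tau> > 0" for \<tau>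
  proof -
    let ?x = "pi * \<tau> / 2"
    have "sinh ?x > 0" using that by simp
    moreover have "sinh ?x \<le> cosh ?x" by (simp add: sinh_def cosh_def)
    ultimately have "1 \<le> cosh ?x / sinh ?x" by simp
    then have "\<tau> * 1 \<le> \<tau> * (cosh ?x / sinh ?x)" using that by (intro mult_left_mono) auto
    then show ?thesis using that by (simp add: tau_coth_def)
  qed
  from this[of "\<bar>\<tau>\<bar>"] show "\<bar>\<tau>\<bar> \<le> tau_coth \<tau>" "0 < tau_coth \<tau>"
    by (cases "\<tau> = 0"; simp add: tau_coth_abs)+
qed

text \<open>The addition formula of the hyperbolic cotangent; without denominators it also holds where
  \<open>\<sigma>\<close>, \<open>s\<close> or \<open>\<sigma> + s\<close> vanishes.\<close>

lemma tau_coth_addition: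
  "tau_coth (\<sigma> + s) * (\<sigma> * tau_coth s + s * tau_coth \<sigma>) = (\<sigma> + s) * (\<sigma> * s + tau_coth \<sigma> * tau_coth s)"
proof (cases "\<sigma> = 0 \<or> s = 0 \<or> \<sigma> + s = 0")
  case True
  then consider "\<sigma> = 0" | "s = 0" | "\<sigma> = - s" by fastforce
  then show ?thesis by cases (auto simp: algebra_simps)
next
  case False
  have coth_add: "(B * D + A * C) / (A * D + B * C) * (D / C + B / A) = 1 + B / A * (D / C)"
    if "A \<noteq> 0" "C \<noteq> 0" "A * D + B * C \<noteq> 0" for A B C D :: real
  proof -
    have "D / C + B / A = (A * D + B * C) / (A * C)" "1 + B / A * (D / C) = (B * D + A * C) / (A * C)"
      using that by (simp_all add: add_divide_distrib)
    then show ?thesis using that by simp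
  qed
  let ?x = "pi * \<sigma> / 2" and ?y = "pi * s / 2"
  have xy: "pi * (\<sigma> + s) / 2 = ?x + ?y" by (simp add: field_simps)
  have nz: "sinh ?x \<noteq> 0" "sinh ?y \<noteq> 0" using False by auto
  have "sinh (?x + ?y) \<noteq> 0" using False unfolding xy[symmetric] by (simp only: sinh_real_zero_iff) simp
  then have nz': "sinh ?x * cosh ?y + cosh ?x * sinh ?y \<noteq> 0" by (simp only: sinh_add) (simp add: mult.commute add.commute)
  have "tau_coth (\<sigma> + s) = (\<sigma> + s) * ((cosh ?x * cosh ?y + sinh ?x * sinh ?y) / (sinh ?x * cosh ?y + cosh ?x * sinh ?y))"
    unfolding tau_coth_def xy using False by (simp only: sinh_add cosh_add) simp
  moreover have "\<sigma> * tau_coth s + s * tau_coth \<sigma> = \<sigma> * s * (cosh ?y / sinh ?y + cosh ?x / sinh ?x)"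
    "\<sigma> * s + tau_coth \<sigma> * tau_coth s = \<sigma> * s * (1 + cosh ?x / sinh ?x * (cosh ?y / sinh ?y))"
    using False by (simp_all add: tau_coth_def[of s] tau_coth_def[of \<sigma>] ring_distribs mult_ac)
  ultimately show ?thesis
    by (simp only: coth_add[OF nz nz', symmetric] mult_ac)
qed

definition odd_term :: "nat \<Rightarrow> real \<Rightarrow> real" where
  "odd_term j \<tau> = 1 / ((2 * real j + 1)\<^sup>2 + \<tau>\<^sup>2)"

text \<open>The expansion of tanh (\<pi> \<tau>/2) / \<tau>, whose poles are the odd multiples of i.
  It is a difference of two cotangent series: all integers minus the even ones, the latter being a
  quarter of the series at \<tau>/2. By coth 2x = (coth x + tanh x) / 2 only the tanh
  survives.\<close>

lemma inverse_tau_coth_sums: "(\<lambda>j. 4 / pi * odd_term j \<tau>) sums (1 / tau_coth \<tau>)"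
proof -
  have group: "(\<lambda>j. odd_term j \<tau>) sums (S1 - S2 / 4)"
    if 1: "(\<lambda>n. 1 / ((real n + 1)\<^sup>2 + \<tau>\<^sup>2)) sums S1" and 2: "(\<lambda>n. 1 / ((real n + 1)\<^sup>2 + (\<tau> / 2)\<^sup>2)) sums S2" for S1 S2 \<tau>
  proof -
    \<comment> \<open>Position n carries the integer n + 1, so the pair n = 2j, 2j + 1 consists of
      the odd integer 2j + 1 and the even integer 2j + 2.\<close>
    have "(\<lambda>j. \<Sum>n\<in>{j * 2..<j * 2 + 2}. 1 / ((real n + 1)\<^sup>2 + \<tau>\<^sup>2)) sums S1"
      by (rule sums_group[OF 1]) simp
    moreover have "(\<Sum>n\<in>{j * 2..<j * 2 + 2}. 1 / ((real n + 1)\<^sup>2 + \<tau>\<^sup>2))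
        = odd_term j \<tau> + 1 / ((real j + 1)\<^sup>2 + (\<tau> / 2)\<^sup>2) / 4" for j
    proof -
      have "{j * 2..<j * 2 + 2} = {j * 2, j * 2 + 1}" by auto
      moreover have "(real (j * 2 + 1) + 1)\<^sup>2 + \<tau>\<^sup>2 = ((real j + 1)\<^sup>2 + (\<tau> / 2)\<^sup>2) * 4"
        by (simp add: power2_eq_square field_simps)
      then have "1 / ((real (j * 2 + 1) + 1)\<^sup>2 + \<tau>\<^sup>2) = 1 / ((real j + 1)\<^sup>2 + (\<tau> / 2)\<^sup>2) / 4"
        by simp
      ultimately show ?thesis by (simp add: odd_term_def mult.commute)
    qed
    ultimately have "(\<lambda>j. odd_term j \<tau> + 1 / ((real j + 1)\<^sup>2 + (\<tau> / 2)\<^sup>2) / 4) sums S1" by simp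
    from sums_diff[OF this sums_divide[OF 2, of 4]] show ?thesis by simp
  qed
  have pos: "(\<lambda>j. 4 / pi * odd_term j \<tau>) sums (1 / tau_coth \<tau>)" if t: "\<tau> > 0" for \<tau>
  proof -
    define x where "x = pi * \<tau> / 2"
    have x: "sinh x > 0" "cosh x > 0" using t by (auto simp: x_def)
    have d: "pi * \<tau> = 2 * x" "pi * (\<tau> / 2) = x" by (auto simp: x_def)
    let ?S1 = "(pi * cosh (2 * x) / sinh (2 * x) - 1 / \<tau>) / (2 * \<tau>)"
    let ?S2 = "(pi * cosh x / sinh x - 1 / (\<tau> / 2)) / (2 * (\<tau> / 2))"
    have "(\<lambda>j. odd_term j \<tau>) sums (?S1 - ?S2 / 4)"
      using coth_partial_fractions[of \<tau>] coth_partial_fractions[of "\<tau> / 2"] t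
      unfolding d by (intro group) auto
    then have "(\<lambda>j. 4 / pi * odd_term j \<tau>) sums (4 / pi * (?S1 - ?S2 / 4))"
      by (rule sums_mult)
    moreover have "4 / pi * (?S1 - ?S2 / 4) = 1 / tau_coth \<tau>"
    proof -
      have "cosh (2 * x) / sinh (2 * x) = (cosh x / sinh x + sinh x / cosh x) / 2"
      proof -
        have "(A\<^sup>2 + B\<^sup>2) / (2 * B * A) = (A / B + B / A) / 2" if "A > 0" "B > 0" for A B :: real
          using that by (simp add: field_simps power2_eq_square)
        from this[OF x(2,1)] show ?thesis by (simp only: cosh_double sinh_double)
      qed
      then have S1: "?S1 = (pi * (cosh x / sinh x + sinh x / cosh x) / 2 - 1 / \<tau>) / (2 * \<tau>)"
        by (simp only: times_divide_eq_right[symmetric])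
      have "1 / tau_coth \<tau> = sinh x / (cosh x * \<tau>)"
        using t by (simp add: tau_coth_def x_def mult.commute)
      then show ?thesis
        using t x unfolding S1 by (simp add: field_simps)
    qed
    ultimately show ?thesis by simp
  qed
  show ?thesis
  proof (cases "\<tau> = 0")
    case True
    \<comment> \<open>At frequency 0 both series are the Basel sum: \<pi>^2/6 - \<pi>^2/24 =
      \<pi>^2/8, and 4/\<pi> times this is \<pi>/2.\<close>
    have "(\<lambda>n. 1 / ((real n + 1)\<^sup>2 + 0\<^sup>2)) sums (pi\<^sup>2 / 6)"
      using inverse_squares_sums by (simp add: add.commute)
    from group[OF this, of "pi\<^sup>2 / 6"] this
    have "(\<lambda>j. odd_term j 0) sums (pi\<^sup>2 / 6 - pi\<^sup>2 / 6 / 4)" by simp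
    from sums_mult[OF this, of "4 / pi"] show ?thesis
      using True by (simp add: power2_eq_square field_simps)
  next
    case False
    then have "(\<lambda>j. 4 / pi * odd_term j \<bar>\<tau>\<bar>) sums (1 / tau_coth \<bar>\<tau>\<bar>)"
      by (intro pos) auto
    then show ?thesis by (simp add: tau_coth_abs odd_term_def)
  qed
qed

text \<open>Each term of the series for the reciprocal is largest at frequency 0.\<close>

lemma tau_coth_ge: "2 / pi \<le> tau_coth \<tau>"
proof -
  have "1 / tau_coth \<tau> \<le> 1 / tau_coth 0"
  proof (rule sums_le[OF _ inverse_tau_coth_sums inverse_tau_coth_sums])
    show "4 / pi * odd_term j \<tau> \<le> 4 / pi * odd_term j 0" for j
      unfolding odd_term_def by (intro mult_left_mono frac_le) (auto intro!: zero_less_power)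
  qed
  then show ?thesis
    using tau_coth_lower(2)[of \<tau>] by (simp add: field_simps)
qed

text \<open>The factor 3 is made of two copies of the lower bound 2/\<pi> \<ge> 1/2 and one of
  |\<tau>|. Together with the upper bound below it says that D has order exactly one.\<close>

lemma tau_coth_ge_linear: "1 + \<bar>\<tau>\<bar> \<le> 3 * tau_coth \<tau>"
proof -
  have "1 / 2 \<le> 2 / pi" using pi_less_4 by (simp add: field_simps)
  then show ?thesis
    using tau_coth_ge[of \<tau>] tau_coth_lower(1)[of \<tau>] by linarith
qed

text \<open>Multiplying 1 + 2x \<le> exp (2x) by exp (- x) gives x exp (- x) \<le> sinh x, that is,
  x coth x \<le> x + 1, used with x = \<pi> \<tau>/2.\<close>

lemma tau_coth_le: "tau_coth \<tau> \<le> 1 + \<bar>\<tau>\<bar>"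
proof -
  have pi1: "2 / pi \<le> 1" using pi_ge_two by simp
  have "tau_coth \<tau> \<le> 1 + \<tau>" if t: "\<tau> > 0" for \<tau>
  proof -
    define x where "x = pi * \<tau> / 2"
    have x: "x > 0" using t by (simp add: x_def)
    then have s: "sinh x > 0" by simp
    have "2 * x * exp (- x) \<le> (exp (2 * x) - 1) * exp (- x)"
      by (rule mult_right_mono) (use exp_ge_add_one_self[of "2 * x"] in linarith, simp)
    also have "\<dots> = 2 * sinh x"
      by (simp add: sinh_def left_diff_distrib flip: exp_add)
    finally have "x * (cosh x - sinh x) \<le> sinh x"
      by (simp add: cosh_minus_sinh)
    then have "cosh x / sinh x \<le> 1 + 1 / x"
      using x s by (simp add: field_simps)
    then have "\<tau> * (cosh x / sinh x) \<le> \<tau> * (1 + 1 / x)"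
      using t by (intro mult_left_mono) auto
    also have "\<dots> = \<tau> + 2 / pi" using t by (simp add: x_def field_simps)
    finally have "tau_coth \<tau> \<le> \<tau> + 2 / pi" using t by (simp add: tau_coth_def x_def)
    with pi1 show ?thesis by linarith
  qed
  from this[of "\<bar>\<tau>\<bar>"] pi1 show ?thesis
    by (cases "\<tau> = 0") (auto simp: tau_coth_abs)
qed

text \<open>Expanding \<open>tanh (\<pi> \<tau> / 2) / \<tau> = (4 / \<pi>) (\<Sum>j. 1 / ((2 j + 1)\<^sup>2 + \<tau>\<^sup>2))\<close> and inverting
  the Fourier transform termwise shows that \<open>1 / tau_coth\<close> is the transform of a positive function.
  The series diverges at \<open>0\<close>.\<close>

definition green_term :: "nat \<Rightarrow> real \<Rightarrow> real" where
  "green_term j t = 2 / (pi * (2 * real j + 1)) * exp (- ((2 * real j + 1) * \<bar>t\<bar>))"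

definition green :: "real \<Rightarrow> real" where
  "green t = (if t = 0 then 0 else \<Sum>j. green_term j t)"

lemma green_term_pos: "green_term j t > 0"
  by (auto simp: green_term_def)

lemma summable_green_term:
  assumes "t \<noteq> 0"
  shows "summable (\<lambda>j. green_term j t)"
proof (rule summable_comparison_test')
  show "summable (\<lambda>j. exp (- \<bar>t\<bar>) ^ j)"
    using assms by (intro summable_geometric) auto
  fix j :: nat
  have "2 / (pi * (2 * real j + 1)) \<le> 2 / (2 * 1)"
    using pi_ge_two by (intro frac_le mult_mono) auto
  moreover have "exp (- ((2 * real j + 1) * \<bar>t\<bar>)) \<le> exp (- (real j * \<bar>t\<bar>))"
    by (intro exp_mono le_imp_neg_le mult_right_mono) auto
  ultimately have "green_term j t \<le> 1 * exp (- (real j * \<bar>t\<bar>))"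
    unfolding green_term_def by (intro mult_mono) auto
  then show "norm (green_term j t) \<le> exp (- \<bar>t\<bar>) ^ j"
    using green_term_pos[of j t] by (simp flip: exp_of_nat_mult)
qed

lemma measurable_green [measurable]: "green \<in> borel_measurable borel"
  unfolding green_def[abs_def] green_term_def by measurable

lemma green_uminus [simp]: "green (- t) = green t"
  by (simp add: green_def green_term_def)

lemma green_pos: "t \<noteq> 0 \<Longrightarrow> green t > 0"
  using suminf_pos[OF summable_green_term green_term_pos] by (simp add: green_def)

lemma green_nonneg: "green t \<ge> 0"
  using green_pos[of t] by (cases "t = 0") (auto simp: green_def)

text \<open>The terms are positive, so their L1 norms are the values of their transforms at
  frequency 0, which add up to 1 / \<open>tau_coth 0\<close>. This justifies integrating the series
  term by term at every frequency.\<close>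

lemma
  shows integrable_green: "integrable lborel green"
    and green_fourier_integral: "(LINT t|lborel. wave \<tau> t * of_real (green t)) = of_real (1 / tau_coth \<tau>)"
proof -
  let ?a = "\<lambda>j. 2 * real j + 1"
  let ?f = "\<lambda>j t. wave \<tau> t * complex_of_real (green_term j t)"
  have fint: "integrable lborel (?f j)" for j
    using exp_abs_fourier(1)[of "?a j"] by (intro integrable_wave_mult) (simp add: green_term_def)
  have fval: "integral\<^sup>L lborel (?f j) = of_real (4 / pi * odd_term j \<tau>)" for j
  proof -
    have "integral\<^sup>L lborel (?f j) = of_real (2 / (pi * ?a j)) * (LINT t|lborel. wave \<tau> t * of_real (exp (- (?a j * \<bar>t\<bar>))))"
      unfolding green_term_def of_real_mult mult.left_commute[of "wave _ _"] by (rule integral_mult_right_zero)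
    also have "\<dots> = of_real (2 / (pi * ?a j) * (2 * ?a j / ((?a j)\<^sup>2 + \<tau>\<^sup>2)))"
      by (subst exp_abs_fourier(3)) auto
    also have "2 / (pi * ?a j) * (2 * ?a j / ((?a j)\<^sup>2 + \<tau>\<^sup>2)) = 4 / pi * odd_term j \<tau>"
    proof -
      have "2 / (pi * a) * (2 * a / b) = 4 / pi * (1 / b)" if "a > 0" for a b :: real
        using that by simp
      from this[of "?a j"] show ?thesis by (simp only: odd_term_def)
    qed
    finally show ?thesis .
  qed
  have nval: "(LINT t|lborel. norm (?f j t)) = 4 / pi * odd_term j 0" for j
  proof -
    have "(LINT t|lborel. norm (?f j t)) = (LINT t|lborel. 2 / (pi * ?a j) * exp (- (?a j * \<bar>t\<bar>)))"
      using green_term_pos[of j] by (simp add: norm_mult less_imp_le) (simp add: green_term_def)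
    also have "\<dots> = 2 / (pi * ?a j) * (2 / ?a j)"
      using exp_abs_fourier(2)[of "?a j"] by simp
    finally show ?thesis by (simp add: odd_term_def power2_eq_square)
  qed
  have s1: "AE t in lborel. summable (\<lambda>j. norm (?f j t))"
    using AE_lborel_singleton[of "0::real"]
    by eventually_elim (use green_term_pos summable_green_term in \<open>simp add: norm_mult less_imp_le\<close>)
  have s2: "summable (\<lambda>j. LINT t|lborel. norm (?f j t))"
    unfolding nval using inverse_tau_coth_sums[of 0] by (rule sums_summable)
  have AEeq: "AE t in lborel. (\<Sum>j. ?f j t) = wave \<tau> t * complex_of_real (green t)"
    using AE_lborel_singleton[of "0::real"]
  proof eventually_elim
    case (elim t)
    have "summable (\<lambda>j. complex_of_real (green_term j t))"
      using summable_green_term[OF elim] by (rule summable_of_real)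
    then have "(\<Sum>j. ?f j t) = wave \<tau> t * (\<Sum>j. complex_of_real (green_term j t))"
      by (rule suminf_mult)
    also have "(\<Sum>j. complex_of_real (green_term j t)) = of_real (green t)"
      using suminf_of_real[OF summable_green_term[OF elim], where 'a=complex, symmetric] elim by (simp add: green_def)
    finally show ?case .
  qed
  have m: "(\<lambda>t. \<Sum>j. ?f j t) \<in> borel_measurable lborel"
    using integrable_suminf[OF fint s1 s2] by auto
  have int: "integrable lborel (\<lambda>t. wave \<tau> t * complex_of_real (green t))"
    using integrable_suminf[OF fint s1 s2] integrable_cong_AE[OF m _ AEeq] by simp
  from integrable_norm[OF this] show "integrable lborel green"
    by (simp add: norm_mult green_nonneg)
  have "(LINT t|lborel. wave \<tau> t * complex_of_real (green t)) = (LINT t|lborel. (\<Sum>j. ?f j t))"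
    using integral_cong_AE[OF m _ AEeq] by simp
  moreover have "(\<lambda>j. of_real (4 / pi * odd_term j \<tau>)) sums (LINT t|lborel. (\<Sum>j. ?f j t))"
    using sums_integral[OF fint s1 s2] unfolding fval .
  moreover have "(\<lambda>j. complex_of_real (4 / pi * odd_term j \<tau>)) sums of_real (1 / tau_coth \<tau>)"
    by (intro sums_of_real inverse_tau_coth_sums)
  ultimately show "(LINT t|lborel. wave \<tau> t * of_real (green t)) = of_real (1 / tau_coth \<tau>)"
    by (metis sums_unique2)
qed

text \<open>The singularity at 0 is only logarithmic, so a small power dominates it. Half of each
  exponential keeps the decay, the other half is traded for a power; the exponent 1/6 leaves
  coefficients of order j^(-7/6), which are summable, and a cube of order |t|^(-1/2), which is
  integrable at 0.\<close>

lemma green_upper_bound: "\<exists>C\<ge>0. \<forall>t. t \<noteq> 0 \<longrightarrow> green t \<le> C * (exp (- \<bar>t\<bar> / 2) * \<bar>t\<bar> powr (- (1/6)))"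
proof -
  let ?a = "\<lambda>j. 2 * real j + 1"
  have elem: "exp (- y) \<le> y powr (- (1/6))" if y: "y > 0" for y :: real
  proof -
    have "y powr (1/6) \<le> exp y"
    proof (cases "y \<ge> 1")
      case True
      then have "y powr (1/6) \<le> y powr 1" by (intro powr_mono) auto
      also have "\<dots> \<le> exp y" using y exp_ge_add_one_self[of y] unfolding powr_one[OF less_imp_le[OF y]] by linarith
      finally show ?thesis .
    next
      case False
      then have "y powr (1/6) \<le> 1 powr (1/6)" using y by (intro powr_mono2) auto
      also have "\<dots> \<le> exp y" using y by simp
      finally show ?thesis .
    qed
    then show ?thesis using y by (simp add: exp_minus powr_minus le_imp_inverse_le)
  qed
  define c where "c j = 2 / pi * (1 / ?a j * (?a j / 2) powr (- (1/6)))" for j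
  have "summable (\<lambda>j. 2 * (real (j + 1)) powr (- (7/6)))"
  proof -
    have "summable (\<lambda>n. (real n) powr (- (7/6)))"
      by (subst summable_real_powr_iff) simp
    then show ?thesis
      by (intro summable_mult) (subst summable_iff_shift[where f="\<lambda>n. (real n) powr (- (7/6))" and k=1])
  qed
  then have sc: "summable c"
  proof (rule summable_comparison_test')
    fix j :: nat
    have 1: "1 / ?a j \<le> (real j + 1) powr (- 1)"
      by (simp add: powr_minus_divide frac_le)
    have "(?a j / 2) powr (- (1/6)) \<le> ((1/2) * (real j + 1)) powr (- (1/6))"
      by (intro powr_mono2') auto
    also have "\<dots> = (1/2) powr (- (1/6)) * (real j + 1) powr (- (1/6))"
      by (intro powr_mult)
    also have "(1/2) powr (- (1/6)) = (2::real) powr (1/6)"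
      by (simp add: powr_minus powr_divide inverse_eq_divide)
    also have "(2::real) powr (1/6) * (real j + 1) powr (- (1/6)) \<le> 2 powr 1 * (real j + 1) powr (- (1/6))"
      by (intro mult_right_mono powr_mono) auto
    finally have 2: "(?a j / 2) powr (- (1/6)) \<le> 2 * (real j + 1) powr (- (1/6))" by simp
    have "c j \<le> 1 * ((real j + 1) powr (- 1) * (2 * (real j + 1) powr (- (1/6))))"
      unfolding c_def using pi_ge_two by (intro mult_mono 1 2) auto
    also have "\<dots> = 2 * real (j + 1) powr (- (7/6))"
    proof -
      have "(real j + 1) powr (- 1) * (real j + 1) powr (- (1/6)) = (real j + 1) powr (- (7/6))"
        unfolding powr_add[symmetric] by simp
      then show ?thesis by (simp only: mult_ac mult_1 of_nat_add of_nat_1)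
    qed
    finally show "norm (c j) \<le> 2 * real (j + 1) powr (- (7/6))"
      by (simp add: c_def)
  qed
  have cnn: "c j \<ge> 0" for j by (simp add: c_def)
  have bound: "green_term j t \<le> c j * (exp (- \<bar>t\<bar> / 2) * \<bar>t\<bar> powr (- (1/6)))" if t: "t \<noteq> 0" for j t
  proof -
    have "exp (- (?a j * \<bar>t\<bar>)) = exp (- (?a j * \<bar>t\<bar> / 2)) * exp (- (?a j / 2 * \<bar>t\<bar>))"
      by (simp flip: exp_add)
    also have "\<dots> \<le> exp (- \<bar>t\<bar> / 2) * (?a j / 2 * \<bar>t\<bar>) powr (- (1/6))"
    proof (intro mult_mono elem)
      have "1 * \<bar>t\<bar> \<le> ?a j * \<bar>t\<bar>" by (intro mult_right_mono) auto
      then show "exp (- (?a j * \<bar>t\<bar> / 2)) \<le> exp (- \<bar>t\<bar> / 2)" by simp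
    qed (use t in auto)
    also have "(?a j / 2 * \<bar>t\<bar>) powr (- (1/6)) = (?a j / 2) powr (- (1/6)) * \<bar>t\<bar> powr (- (1/6))"
      by (rule powr_mult) 
    finally have "green_term j t \<le> 2 / (pi * ?a j) * (exp (- \<bar>t\<bar> / 2) * ((?a j / 2) powr (- (1/6)) * \<bar>t\<bar> powr (- (1/6))))"
      unfolding green_term_def by (intro mult_left_mono) auto
    then show ?thesis by (simp add: c_def mult_ac)
  qed
  show ?thesis
  proof (intro exI[of _ "suminf c"] conjI allI impI)
    show "suminf c \<ge> 0" by (intro suminf_nonneg sc cnn)
    fix t :: real assume t: "t \<noteq> 0"
    have "green t \<le> (\<Sum>j. c j * (exp (- \<bar>t\<bar> / 2) * \<bar>t\<bar> powr (- (1/6))))"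
    proof -
      have "(\<Sum>j. green_term j t) \<le> (\<Sum>j. c j * (exp (- \<bar>t\<bar> / 2) * \<bar>t\<bar> powr (- (1/6))))"
        by (intro suminf_le bound t summable_green_term summable_mult2 sc)
      then show ?thesis using t by (simp add: green_def)
    qed
    also have "\<dots> = suminf c * (exp (- \<bar>t\<bar> / 2) * \<bar>t\<bar> powr (- (1/6)))"
      by (rule suminf_mult2[OF sc, symmetric])
    finally show "green t \<le> suminf c * (exp (- \<bar>t\<bar> / 2) * \<bar>t\<bar> powr (- (1/6)))" .
  qed
qed

text \<open>\<open>p\<close> is the integrand of Gamma (1/2), extended by 0; together with its
  reflection it dominates the cube of the previous bound.\<close>

lemma integrable_green_cubed: "integrable lborel (\<lambda>t. green t ^ 3)"
proof -
  obtain C where C: "C \<ge> 0" "\<And>t. t \<noteq> 0 \<Longrightarrow> green t \<le> C * (exp (- \<bar>t\<bar> / 2) * \<bar>t\<bar> powr (- (1/6)))"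
    using green_upper_bound by blast
  define p where "p t = indicator {0..} t * t powr (1/2 - 1) / exp t" for t :: real
  have pm [measurable]: "p \<in> borel_measurable borel" unfolding p_def by measurable
  have p0: "p t \<ge> 0" for t by (simp add: p_def)
  have "(\<integral>\<^sup>+t. ennreal (p t) \<partial>lborel) < \<infinity>"
    unfolding p_def by (subst Gamma_conv_nn_integral_real[symmetric]) auto
  then have pint: "integrable lborel p"
    using p0 by (intro integrableI_nonneg) auto
  have pint': "integrable lborel (\<lambda>t. p (- t))"
    using lborel_integrable_real_affine[OF pint, of "-1" 0] by simp
  show ?thesis
  proof (rule Bochner_Integration.integrable_bound)
    show "integrable lborel (\<lambda>t. C ^ 3 * (p t + p (- t)))"
      using pint pint' by auto
    show "AE t in lborel. norm (green t ^ 3) \<le> norm (C ^ 3 * (p t + p (- t)))"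
      using AE_lborel_singleton[of "0::real"]
    proof eventually_elim
      case (elim t)
      have "(exp (- \<bar>t\<bar> / 2) * \<bar>t\<bar> powr (- (1/6))) ^ 3 = exp (- (3 * \<bar>t\<bar> / 2)) * \<bar>t\<bar> powr (- (1/2))"
      proof -
        have "exp (- \<bar>t\<bar> / 2) ^ 3 = exp (- (3 * \<bar>t\<bar> / 2))"
          by (simp flip: exp_of_nat_mult)
        moreover have "(\<bar>t\<bar> powr (- (1/6))) ^ 3 = \<bar>t\<bar> powr (- (1/2))"
          using elim by (simp add: powr_power)
        ultimately show ?thesis by (simp add: power_mult_distrib)
      qed
      also have "\<dots> \<le> exp (- \<bar>t\<bar>) * \<bar>t\<bar> powr (- (1/2))"
        by (intro mult_right_mono exp_mono) auto
      also have "\<dots> = p t + p (- t)"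
        using elim by (cases "t > 0") (auto simp: p_def exp_minus field_simps)
      finally have 1: "(exp (- \<bar>t\<bar> / 2) * \<bar>t\<bar> powr (- (1/6))) ^ 3 \<le> p t + p (- t)" .
      have "green t ^ 3 \<le> (C * (exp (- \<bar>t\<bar> / 2) * \<bar>t\<bar> powr (- (1/6)))) ^ 3"
        using C(2)[OF elim] green_nonneg by (intro power_mono) auto
      also have "\<dots> \<le> C ^ 3 * (p t + p (- t))"
        unfolding power_mult_distrib[of C] using 1 C(1) by (intro mult_left_mono) auto
      finally show ?case using green_nonneg[of t] by simp
    qed
  qed measurable
qed

section \<open>Convolutions and regularity of solutions\<close>

definition conv :: "(real \<Rightarrow> complex) \<Rightarrow> (real \<Rightarrow> complex) \<Rightarrow> real \<Rightarrow> complex" where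
  "conv k h x = (LINT y|lborel. k y * h (x - y))"

text \<open>The inverse Fourier transform, defined at every point. Solutions are replaced by
  functions \<open>ift a\<close>, on which D and d/dx act as multipliers of
  \<open>a\<close>.\<close>

definition ift :: "(real \<Rightarrow> complex) \<Rightarrow> real \<Rightarrow> complex" where
  "ift a x = fourier_integral a (- x)"

text \<open>The inverse of D. As a convolution with an integrable kernel it also makes sense on
  bounded functions.\<close>

definition gconv :: "(real \<Rightarrow> complex) \<Rightarrow> real \<Rightarrow> complex" where
  "gconv h = conv (\<lambda>y. of_real (green y)) h"

lemma integrable_reflect_shift:
  fixes h :: "real \<Rightarrow> 'a::{banach, second_countable_topology}"
  shows "integrable lborel h \<Longrightarrow> integrable lborel (\<lambda>y. h (x - y))"
  using lborel_integrable_real_affine[of h "-1" x] by simp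

lemma integral_reflect_shift:
  fixes h :: "real \<Rightarrow> 'a::{banach, second_countable_topology}"
  shows "(LINT y|lborel. h (x - y)) = integral\<^sup>L lborel h"
  using lborel_integral_real_affine[of "-1" h x] by simp

lemma integrable_shift:
  fixes h :: "real \<Rightarrow> 'a::{banach, second_countable_topology}"
  shows "integrable lborel h \<Longrightarrow> integrable lborel (\<lambda>x. h (x - y))"
  using lborel_integrable_real_affine[of h 1 "-y"] by (simp add: algebra_simps)

lemma integral_shift:
  fixes h :: "real \<Rightarrow> 'a::{banach, second_countable_topology}"
  shows "(LINT x|lborel. h (x - y)) = integral\<^sup>L lborel h"
  using lborel_integral_real_affine[of 1 h "-y"] by (simp add: algebra_simps)

lemma conv_reflect: "conv k h x = (LINT y|lborel. k (x - y) * h y)"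
  unfolding conv_def by (subst integral_reflect_shift[symmetric, of _ x]) simp

lemma integrable_conv_pair:
  fixes k h :: "real \<Rightarrow> complex"
  assumes "integrable lborel k" "integrable lborel h"
  shows "integrable (lborel \<Otimes>\<^sub>M lborel) (\<lambda>(y, x). k y * h (x - y) :: complex)"
proof (rule lborel_pair.Fubini_integrable)
  have [measurable]: "k \<in> borel_measurable borel" "h \<in> borel_measurable borel" using assms by auto
  show "(\<lambda>(y, x). k y * h (x - y)) \<in> borel_measurable (lborel \<Otimes>\<^sub>M lborel)" by measurable
  show "integrable lborel (\<lambda>y. LINT x|lborel. norm (case (y, x) of (y, x) \<Rightarrow> k y * h (x - y)))"
    using assms integral_shift[of "\<lambda>x. norm (h x)"] by (simp add: norm_mult)
  show "AE y in lborel. integrable lborel (\<lambda>x. case (y, x) of (y, x) \<Rightarrow> k y * h (x - y))"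
    using integrable_shift[OF assms(2)] by simp
qed

lemma integrable_conv:
  assumes "integrable lborel k" "integrable lborel h"
  shows "integrable lborel (conv k h)"
  unfolding conv_def using lborel_pair.integrable_snd[OF integrable_conv_pair[OF assms]] .

lemma fourier_integral_conv:
  assumes k: "integrable lborel k" and h: "integrable lborel h"
  shows "fourier_integral (conv k h) \<tau> = (LINT y|lborel. wave \<tau> y * k y) * fourier_integral h \<tau>"
proof -
  have [measurable]: "k \<in> borel_measurable borel" "h \<in> borel_measurable borel" using k h by auto
  have int: "integrable (lborel \<Otimes>\<^sub>M lborel) (\<lambda>(y, x). wave \<tau> x * (k y * h (x - y)))"
    by (rule Bochner_Integration.integrable_bound[OF integrable_conv_pair[OF k h]])
       (measurable, auto simp: norm_mult)
  have "(LINT x|lborel. wave \<tau> x * conv k h x) = (LINT x|lborel. LINT y|lborel. wave \<tau> x * (k y * h (x - y)))"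
    by (simp add: conv_def)
  also have "\<dots> = (LINT y|lborel. LINT x|lborel. wave \<tau> x * (k y * h (x - y)))"
    by (rule lborel_pair.Fubini_integral[OF int])
  also have "\<dots> = (LINT y|lborel. k y * (LINT x|lborel. wave \<tau> x * h (x - y)))"
    by (simp add: mult.left_commute[of _ "k _"])
  finally have "fourier_integral (conv k h) \<tau> = (LINT y|lborel. k y * fourier_integral (\<lambda>x. h (x - y)) \<tau>)"
    by (simp add: fourier_integral_wave mult.left_commute[of _ cF])
  also have "\<dots> = (LINT y|lborel. wave \<tau> y * k y * fourier_integral h \<tau>)"
    by (simp add: fourier_integral_shift mult_ac)
  finally show ?thesis by simp
qed

lemma conv_ift:
  assumes k: "integrable lborel k" and b: "integrable lborel b"
  shows "conv k (ift b) x = ift (\<lambda>s. (LINT y|lborel. wave s y * k y) * b s) x"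
proof -
  have int: "integrable (lborel \<Otimes>\<^sub>M lborel) (\<lambda>(y, s). (\<lambda>(y, s). wave s (y - x)) (y, s) * (k y * b s))"
    by (rule integrable_pair_product[OF k b]) auto
  have "conv k (ift b) x = cF * (LINT y|lborel. LINT s|lborel. wave s (y - x) * (k y * b s))"
  proof -
    have "k y * ift b (x - y) = cF * (LINT s|lborel. wave s (y - x) * (k y * b s))" for y
    proof -
      have "(LINT s|lborel. wave s (y - x) * (k y * b s)) = (LINT s|lborel. k y * (wave (y - x) s * b s))"
        by (rule Bochner_Integration.integral_cong) (simp_all add: wave_commute[of _ "y - x"])
      then show ?thesis by (simp add: ift_def fourier_integral_wave)
    qed
    then show ?thesis by (simp add: conv_def)
  qed
  also have "(LINT y|lborel. LINT s|lborel. wave s (y - x) * (k y * b s)) = (LINT s|lborel. LINT y|lborel. wave s (y - x) * (k y * b s))"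
    using lborel_pair.Fubini_integral[OF int] by simp
  also have "\<dots> = (LINT s|lborel. wave s (- x) * ((LINT y|lborel. wave s y * k y) * b s))"
  proof (rule Bochner_Integration.integral_cong[OF refl])
    fix s
    have "wave s (y - x) * (k y * b s) = wave s (- x) * b s * (wave s y * k y)" for y
      using wave_add_right[of s "- x" y] by (simp add: mult_ac)
    then have "(LINT y|lborel. wave s (y - x) * (k y * b s)) = (LINT y|lborel. wave s (- x) * b s * (wave s y * k y))"
      by presburger
    also have "\<dots> = wave s (- x) * b s * (LINT y|lborel. wave s y * k y)"
      by (rule integral_mult_right_zero)
    finally show "(LINT y|lborel. wave s (y - x) * (k y * b s)) = wave s (- x) * ((LINT y|lborel. wave s y * k y) * b s)"
      by (simp only: mult_ac)
  qed
  finally show ?thesis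
    unfolding ift_def[of _ x] fourier_integral_wave by (simp only: wave_commute[of "- x"])
qed

text \<open>Turns the products Q^2 and 2 Q \<psi> into convolutions of transforms, the form in which
  decay is bootstrapped.\<close>

lemma fourier_integral_mult_ift:
  assumes u: "integrable lborel u" and a: "integrable lborel a"
  shows "fourier_integral (\<lambda>x. u x * ift a x) \<tau> = cF * (LINT s|lborel. fourier_integral u (\<tau> - s) * a s)"
proof -
  have int: "integrable (lborel \<Otimes>\<^sub>M lborel) (\<lambda>(x, s). (\<lambda>(x, s). wave (\<tau> - s) x) (x, s) * (u x * a s))"
    by (rule integrable_pair_product[OF u a]) auto
  have w: "wave \<tau> x * wave (- x) s = wave (\<tau> - s) x" for x s
    using wave_add_left[of \<tau> "- s" x] by (simp add: wave_uminus wave_commute[of x])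
  have "(LINT x|lborel. wave \<tau> x * (u x * ift a x)) = cF * (LINT x|lborel. LINT s|lborel. wave (\<tau> - s) x * (u x * a s))"
  proof -
    have "wave \<tau> x * (u x * ift a x) = cF * (LINT s|lborel. wave (\<tau> - s) x * (u x * a s))" for x
    proof -
      have "(LINT s|lborel. wave (\<tau> - s) x * (u x * a s)) = (LINT s|lborel. (wave \<tau> x * u x) * (wave (- x) s * a s))"
        by (simp add: w[symmetric] mult_ac)
      also have "\<dots> = wave \<tau> x * u x * (LINT s|lborel. wave (- x) s * a s)"
        by simp
      finally show ?thesis by (simp add: ift_def fourier_integral_wave mult_ac)
    qed
    then show ?thesis by simp
  qed
  also have "(LINT x|lborel. LINT s|lborel. wave (\<tau> - s) x * (u x * a s)) = (LINT s|lborel. LINT x|lborel. wave (\<tau> - s) x * (u x * a s))"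
    using lborel_pair.Fubini_integral[OF int] by simp
  also have "\<dots> = (LINT s|lborel. (LINT x|lborel. wave (\<tau> - s) x * u x) * a s)"
    by (simp flip: mult.assoc)
  finally show ?thesis
    by (simp add: fourier_integral_wave mult.assoc)
qed

lemma isCont_ift: "integrable lborel a \<Longrightarrow> isCont (ift a) x"
  unfolding ift_def[abs_def]
  by (intro continuous_at_compose[of _ uminus "fourier_integral a", unfolded o_def] isCont_fourier_integral continuous_intros)

lemma continuous_on_ift: "integrable lborel a \<Longrightarrow> continuous_on A (ift a)"
  by (simp add: continuous_at_imp_continuous_on isCont_ift)

lemma measurable_ift: "integrable lborel a \<Longrightarrow> ift a \<in> borel_measurable borel"
  by (rule borel_measurable_continuous_onI) (rule continuous_on_ift)

lemma norm_ift_le: "norm (ift a x) \<le> (LINT t|lborel. norm (a t))"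
  unfolding ift_def by (rule norm_fourier_integral_le)

lemma integrable_gconv: "integrable lborel h \<Longrightarrow> integrable lborel (gconv h)"
  unfolding gconv_def using integrable_green by (intro integrable_conv) auto

lemma fourier_integral_gconv:
  assumes "integrable lborel h"
  shows "fourier_integral (gconv h) \<tau> = fourier_integral h \<tau> / of_real (tau_coth \<tau>)"
  unfolding gconv_def using assms integrable_green
  by (subst fourier_integral_conv) (auto simp: green_fourier_integral)

lemma gconv_ift:
  assumes "integrable lborel b"
  shows "gconv (ift b) x = ift (\<lambda>s. b s / of_real (tau_coth s)) x"
  unfolding gconv_def using assms integrable_green
  by (subst conv_ift) (auto simp: green_fourier_integral)

lemma inverse_tau_coth_L2: "(\<lambda>\<tau>. 1 / complex_of_real (tau_coth \<tau>)) \<in> L2"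
proof (rule L2I)
  show "integrable lborel (\<lambda>t. (cmod (1 / complex_of_real (tau_coth t)))\<^sup>2)"
  proof (rule Bochner_Integration.integrable_bound)
    show "integrable lborel (\<lambda>t::real. 9 * inverse (1 + t\<^sup>2))"
      using integrable_inverse_1_plus_square by (simp add: set_integrable_def)
    show "AE t in lborel. norm ((cmod (1 / complex_of_real (tau_coth t)))\<^sup>2) \<le> norm (9 * inverse (1 + t\<^sup>2))"
    proof (rule AE_I2)
      fix t :: real
      have p: "tau_coth t > 0" by (rule tau_coth_lower)
      have "1 + t\<^sup>2 \<le> (1 + \<bar>t\<bar>)\<^sup>2" by (simp add: power2_sum)
      also have "\<dots> \<le> (3 * tau_coth t)\<^sup>2"
        by (intro power_mono tau_coth_ge_linear) auto
      finally have "1 + t\<^sup>2 \<le> 9 * (tau_coth t)\<^sup>2" by (simp add: power_mult_distrib)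
      moreover have "1 + t\<^sup>2 > 0" by (simp add: add_pos_nonneg)
      ultimately have "1 / (tau_coth t)\<^sup>2 \<le> 9 / (1 + t\<^sup>2)"
        using p by (simp add: field_simps)
      then show "norm ((cmod (1 / complex_of_real (tau_coth t)))\<^sup>2) \<le> norm (9 * inverse (1 + t\<^sup>2))"
        using p by (simp add: norm_divide power_divide divide_inverse norm_inverse power_inverse)
    qed
  qed measurable
qed measurable

text \<open>The reciprocal symbol is square integrable, so dividing a square integrable transform by
  the symbol gives an integrable one. Inversion then supplies a continuous representative of
  \<open>gconv h\<close>.\<close>

lemma gconv_regular:
  assumes h: "integrable lborel h" "h \<in> L2"
  defines "a \<equiv> \<lambda>\<tau>. fourier_integral h \<tau> / of_real (tau_coth \<tau>)"
  shows "integrable lborel a" "AE x in lborel. gconv h x = ift a x"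
proof -
  show a: "integrable lborel a"
    using L2_mult_integrable[OF fourier_integral_L2[OF h(2,1)] inverse_tau_coth_L2] by (simp add: a_def)
  have "fourier_integral (gconv h) = a"
    by (simp add: a_def fourier_integral_gconv[OF h(1)] fun_eq_iff)
  with fourier_inversion[OF integrable_gconv[OF h(1)]] a show "AE x in lborel. gconv h x = ift a x"
    by (simp add: ift_def)
qed

section \<open>Polynomial decay of transforms\<close>

definition decays :: "nat \<Rightarrow> (real \<Rightarrow> complex) \<Rightarrow> bool" where
  "decays n a \<longleftrightarrow> (\<exists>C. \<forall>s. (1 + \<bar>s\<bar>) ^ n * norm (a s) \<le> C)"

lemma decays_integrable:
  assumes "decays 2 a" and [measurable]: "a \<in> borel_measurable borel"
  shows "integrable lborel a"
proof -
  obtain C where C: "\<And>s. (1 + \<bar>s\<bar>) ^ 2 * norm (a s) \<le> C"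
    using assms by (auto simp: decays_def)
  have C0: "C \<ge> 0" using order_trans[OF norm_ge_zero[of "a 0"], of C] C[of 0] by simp
  show ?thesis
  proof (rule Bochner_Integration.integrable_bound)
    show "integrable lborel (\<lambda>t::real. C * inverse (1 + t\<^sup>2))"
      using integrable_inverse_1_plus_square by (simp add: set_integrable_def)
    show "AE t in lborel. norm (a t) \<le> norm (C * inverse (1 + t\<^sup>2))"
    proof (rule AE_I2)
      fix t :: real
      have "(1 + t\<^sup>2) * norm (a t) \<le> (1 + \<bar>t\<bar>)\<^sup>2 * norm (a t)"
        by (intro mult_right_mono) (auto simp: power2_sum)
      with C[of t] have "(1 + t\<^sup>2) * norm (a t) \<le> C" by linarith
      moreover have "1 + t\<^sup>2 > 0" by (simp add: add_pos_nonneg)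
      ultimately show "norm (a t) \<le> norm (C * inverse (1 + t\<^sup>2))"
        using C0 by (simp add: field_simps abs_mult)
    qed
  qed measurable
qed

lemma decays_mono:
  assumes "decays n a" "m \<le> n"
  shows "decays m a"
proof -
  obtain C where C: "\<And>s. (1 + \<bar>s\<bar>) ^ n * norm (a s) \<le> C"
    using assms by (auto simp: decays_def)
  have "(1 + \<bar>s\<bar>) ^ m * norm (a s) \<le> (1 + \<bar>s\<bar>) ^ n * norm (a s)" for s
    using assms(2) by (intro mult_right_mono power_increasing) auto
  with C show ?thesis unfolding decays_def by (meson order_trans)
qed

lemma decays_mult_linear:
  assumes "decays (Suc n) a" "\<And>s. norm (m s) \<le> 1 + \<bar>s\<bar>"
  shows "decays n (\<lambda>s. m s * a s)"
proof -
  obtain C where C: "\<And>s. (1 + \<bar>s\<bar>) ^ Suc n * norm (a s) \<le> C"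
    using assms(1) by (auto simp: decays_def)
  have "(1 + \<bar>s\<bar>) ^ n * norm (m s * a s) \<le> C" for s
  proof -
    have "(1 + \<bar>s\<bar>) ^ n * norm (m s * a s) = (1 + \<bar>s\<bar>) ^ n * norm (a s) * norm (m s)"
      by (simp add: norm_mult)
    also have "\<dots> \<le> (1 + \<bar>s\<bar>) ^ n * norm (a s) * (1 + \<bar>s\<bar>)"
      by (intro mult_left_mono assms(2)) auto
    also have "\<dots> = (1 + \<bar>s\<bar>) ^ Suc n * norm (a s)" by simp
    finally show ?thesis using C[of s] by linarith
  qed
  then show ?thesis by (auto simp: decays_def)
qed

lemma decays_tau_coth_mult:
  "decays (Suc n) a \<Longrightarrow> decays n (\<lambda>s. of_real (tau_coth s) * a s)"
  by (erule decays_mult_linear) (use tau_coth_lower(2) tau_coth_le in \<open>auto simp: less_imp_le\<close>)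

text \<open>The symbol grows linearly, so its inverse gains one power. This is the whole gain of the
  bootstrap.\<close>

lemma decays_tau_coth_divide:
  assumes "decays n b"
  shows "decays (Suc n) (\<lambda>s. b s / of_real (tau_coth s))"
proof -
  obtain C where C: "\<And>s. (1 + \<bar>s\<bar>) ^ n * norm (b s) \<le> C"
    using assms by (auto simp: decays_def)
  have "(1 + \<bar>s\<bar>) ^ Suc n * norm (b s / of_real (tau_coth s)) \<le> 3 * C" for s
  proof -
    have g: "tau_coth s > 0" by (rule tau_coth_lower)
    have "(1 + \<bar>s\<bar>) ^ Suc n * norm (b s / of_real (tau_coth s)) = ((1 + \<bar>s\<bar>) / tau_coth s) * ((1 + \<bar>s\<bar>) ^ n * norm (b s))"
      using g by (simp add: norm_divide)
    also have "\<dots> \<le> 3 * ((1 + \<bar>s\<bar>) ^ n * norm (b s))"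
      using g tau_coth_ge_linear[of s] by (intro mult_right_mono) (auto simp: divide_le_eq)
    also have "\<dots> \<le> 3 * C" using C by simp
    finally show ?thesis .
  qed
  then show ?thesis unfolding decays_def by blast
qed

lemma decays_fourier_integral: "decays 0 (fourier_integral f)"
  using norm_fourier_integral_le[of f] by (auto simp: decays_def)

text \<open>Since 1 + |\<tau>| is at most twice the larger of 1 + |\<tau> - s| and 1 + |s|, the
  weight can be put on the factor with the larger argument while the other one is integrated. No
  power is lost.\<close>

lemma decays_convolution:
  assumes a: "integrable lborel a" "decays n a" and b: "integrable lborel b" "decays n b"
  shows "decays n (\<lambda>\<tau>. c * (LINT s|lborel. a (\<tau> - s) * b s))"
proof -
  have [measurable]: "a \<in> borel_measurable borel" "b \<in> borel_measurable borel" using a b by auto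
  obtain A where A: "\<And>s. (1 + \<bar>s\<bar>) ^ n * norm (a s) \<le> A"
    using a by (auto simp: decays_def)
  obtain B where B: "\<And>s. (1 + \<bar>s\<bar>) ^ n * norm (b s) \<le> B"
    using b by (auto simp: decays_def)
  have pw: "(1 + \<bar>\<tau>\<bar>) ^ n \<le> 2 ^ n * ((1 + \<bar>\<tau> - s\<bar>) ^ n + (1 + \<bar>s\<bar>) ^ n)" for \<tau> s :: real
  proof -
    define m where "m = max (1 + \<bar>\<tau> - s\<bar>) (1 + \<bar>s\<bar>)"
    have "1 + \<bar>\<tau> - s\<bar> \<le> m" "1 + \<bar>s\<bar> \<le> m" by (simp_all add: m_def)
    then have "(1 + \<bar>\<tau>\<bar>) ^ n \<le> (2 * m) ^ n"
      by (intro power_mono) linarith+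
    also have "\<dots> = 2 ^ n * m ^ n" by (rule power_mult_distrib)
    also have "m ^ n \<le> (1 + \<bar>\<tau> - s\<bar>) ^ n + (1 + \<bar>s\<bar>) ^ n"
      unfolding m_def by (simp add: max_def)
    finally show ?thesis by simp
  qed
  define D where "D = 2 ^ n * (A * (LINT s|lborel. norm (b s)) + B * (LINT s|lborel. norm (a s)))"
  have "(1 + \<bar>\<tau>\<bar>) ^ n * norm (LINT s|lborel. a (\<tau> - s) * b s) \<le> D" for \<tau>
  proof -
    have int: "integrable lborel (\<lambda>s. 2 ^ n * (A * norm (b s) + B * norm (a (\<tau> - s))))"
      using b(1) integrable_reflect_shift[OF a(1), of \<tau>] by auto
    have pt: "(1 + \<bar>\<tau>\<bar>) ^ n * norm (a (\<tau> - s) * b s) \<le> 2 ^ n * (A * norm (b s) + B * norm (a (\<tau> - s)))" for s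
    proof -
      have "(1 + \<bar>\<tau>\<bar>) ^ n * norm (a (\<tau> - s) * b s)
        \<le> 2 ^ n * ((1 + \<bar>\<tau> - s\<bar>) ^ n + (1 + \<bar>s\<bar>) ^ n) * (norm (a (\<tau> - s)) * norm (b s))"
        unfolding norm_mult by (intro mult_right_mono pw) auto
      also have "\<dots> = 2 ^ n * (((1 + \<bar>\<tau> - s\<bar>) ^ n * norm (a (\<tau> - s))) * norm (b s) + ((1 + \<bar>s\<bar>) ^ n * norm (b s)) * norm (a (\<tau> - s)))"
        by (simp add: algebra_simps)
      also have "\<dots> \<le> 2 ^ n * (A * norm (b s) + B * norm (a (\<tau> - s)))"
        by (intro mult_left_mono add_mono mult_right_mono A B) auto
      finally show ?thesis .
    qed
    have "(1 + \<bar>\<tau>\<bar>) ^ n * norm (LINT s|lborel. a (\<tau> - s) * b s) \<le> (1 + \<bar>\<tau>\<bar>) ^ n * (LINT s|lborel. norm (a (\<tau> - s) * b s))"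
      by (intro mult_left_mono integral_norm_bound) auto
    also have "\<dots> = (LINT s|lborel. (1 + \<bar>\<tau>\<bar>) ^ n * norm (a (\<tau> - s) * b s))"
      by simp
    also have "\<dots> \<le> (LINT s|lborel. 2 ^ n * (A * norm (b s) + B * norm (a (\<tau> - s))))"
    proof (rule integral_mono[OF _ int pt])
      show "integrable lborel (\<lambda>s. (1 + \<bar>\<tau>\<bar>) ^ n * norm (a (\<tau> - s) * b s))"
      proof (rule Bochner_Integration.integrable_bound[OF int])
        show "AE s in lborel. norm ((1 + \<bar>\<tau>\<bar>) ^ n * norm (a (\<tau> - s) * b s)) \<le> norm (2 ^ n * (A * norm (b s) + B * norm (a (\<tau> - s))))"
        proof (rule AE_I2)
          fix s
          have "0 \<le> (1 + \<bar>\<tau>\<bar>) ^ n * norm (a (\<tau> - s) * b s)" by simp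
          with pt[of s] show "norm ((1 + \<bar>\<tau>\<bar>) ^ n * norm (a (\<tau> - s) * b s)) \<le> norm (2 ^ n * (A * norm (b s) + B * norm (a (\<tau> - s))))"
            unfolding real_norm_def by linarith
        qed
      qed measurable
    qed
    also have "\<dots> = D"
      using b(1) integrable_reflect_shift[OF a(1), of \<tau>] integral_reflect_shift[of "\<lambda>s. norm (a s)" \<tau>]
      by (simp add: D_def)
    finally show ?thesis .
  qed
  then have "norm c * ((1 + \<bar>\<tau>\<bar>) ^ n * norm (LINT s|lborel. a (\<tau> - s) * b s)) \<le> norm c * D" for \<tau>
    by (intro mult_left_mono) auto
  then show ?thesis unfolding decays_def norm_mult
    by (intro exI[of _ "norm c * D"]) (simp add: mult_ac)
qed

lemma continuous_eq_of_AE: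
  fixes f g :: "real \<Rightarrow> complex"
  assumes f: "\<And>x. isCont f x" and g: "\<And>x. isCont g x" and eq: "AE x in lborel. f x = g x"
  shows "f x = g x"
proof (rule ccontr)
  assume neq: "f x \<noteq> g x"
  let ?S = "{x. f x \<noteq> g x}"
  have op: "open ?S"
    using f g by (intro open_Collect_neq) (auto simp: continuous_at_imp_continuous_on)
  then have "?S \<in> sets lborel" by simp
  with eq have "?S \<in> null_sets lborel"
    by (simp add: AE_iff_null_sets[of ?S] Collect_neg_eq[symmetric])
  then have "negligible ?S"
    by (simp add: negligible_iff_null_sets null_sets_completionI)
  with op neq show False
    using open_not_negligible[of ?S] by auto
qed

lemma gauss_weight: "(1 + \<bar>\<tau>\<bar>)\<^sup>2 * norm (gauss \<tau>) \<le> 4"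
proof -
  have "(1 + \<bar>\<tau>\<bar>)\<^sup>2 \<le> 4 * (1 + \<tau>\<^sup>2 / 2)"
    using sum_squares_bound[of 1 "\<bar>\<tau>\<bar>"] by (simp add: power2_sum)
  also have "\<dots> \<le> 4 * exp (\<tau>\<^sup>2 / 2)"
    by (intro mult_left_mono exp_ge_add_one_self) simp
  finally have "(1 + \<bar>\<tau>\<bar>)\<^sup>2 * exp (- \<tau>\<^sup>2 / 2) \<le> 4 * exp (\<tau>\<^sup>2 / 2) * exp (- \<tau>\<^sup>2 / 2)"
    by (intro mult_right_mono) auto
  also have "\<dots> = 4" by (simp flip: exp_add)
  finally show ?thesis by (simp add: gauss_def)
qed

lemma gauss_weight_integrable:
  assumes [measurable]: "m \<in> borel_measurable borel" and m: "\<And>\<tau>. \<bar>m \<tau>\<bar> \<le> (1 + \<bar>\<tau>\<bar>)\<^sup>2"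
  shows "integrable lborel (\<lambda>\<tau>. m \<tau> * (norm (gauss \<tau>))\<^sup>2)"
proof (rule Bochner_Integration.integrable_bound)
  show "integrable lborel (\<lambda>\<tau>. 4 * norm (gauss \<tau>))"
    using integrable_gauss by (intro integrable_mult_right integrable_norm)
  have "\<bar>m \<tau>\<bar> * (norm (gauss \<tau>))\<^sup>2 \<le> 4 * norm (gauss \<tau>)" for \<tau>
  proof -
    have "\<bar>m \<tau>\<bar> * (norm (gauss \<tau>))\<^sup>2 \<le> (1 + \<bar>\<tau>\<bar>)\<^sup>2 * (norm (gauss \<tau>))\<^sup>2"
      by (intro mult_right_mono m) auto
    also have "\<dots> = (1 + \<bar>\<tau>\<bar>)\<^sup>2 * norm (gauss \<tau>) * norm (gauss \<tau>)"
      by (simp add: power2_eq_square)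
    also have "\<dots> \<le> 4 * norm (gauss \<tau>)"
      by (intro mult_right_mono gauss_weight) auto
    finally show ?thesis .
  qed
  then show "AE \<tau> in lborel. norm (m \<tau> * (norm (gauss \<tau>))\<^sup>2) \<le> norm (4 * norm (gauss \<tau>))"
    by (simp add: abs_mult)
qed measurable

text \<open>Makes translated Gaussians admissible as test functions in the weak equation.\<close>

lemma gauss_shift_H_half: "(\<lambda>t. gauss (t - x)) \<in> H_half"
proof -
  let ?f = "\<lambda>t. gauss (t - x)"
  have eq: "AE \<tau> in lborel. fourier_L2 ?f \<tau> = wave \<tau> x * gauss \<tau>"
    using fourier_L2_eq_fourier_integral[OF gauss_shift_L2 integrable_gauss_shift, of x]
    by (simp add: fourier_integral_gauss_shift)
  have [measurable]: "fourier_L2 ?f \<in> borel_measurable borel"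
    using L2_measurable[OF fourier_L2_L2[OF gauss_shift_L2, of x]] by simp
  have "integrable lborel (\<lambda>\<tau>. sqrt (1 + \<tau>\<^sup>2) * (norm (gauss \<tau>))\<^sup>2)"
  proof (rule gauss_weight_integrable)
    fix \<tau> :: real
    have "sqrt (1 + \<tau>\<^sup>2) \<le> 1 + \<tau>\<^sup>2"
      using self_le_power[of "1 + \<tau>\<^sup>2" 2] by (intro real_le_lsqrt) auto
    also have "\<dots> \<le> (1 + \<bar>\<tau>\<bar>)\<^sup>2" by (simp add: power2_sum)
    finally show "\<bar>sqrt (1 + \<tau>\<^sup>2)\<bar> \<le> (1 + \<bar>\<tau>\<bar>)\<^sup>2" by simp
  qed measurable
  moreover have "AE \<tau> in lborel. sqrt (1 + \<tau>\<^sup>2) * (norm (gauss \<tau>))\<^sup>2 = sqrt (1 + \<tau>\<^sup>2) * (norm (fourier_L2 ?f \<tau>))\<^sup>2"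
    using eq by eventually_elim (simp add: norm_mult)
  ultimately have "integrable lborel (\<lambda>\<tau>. sqrt (1 + \<tau>\<^sup>2) * (norm (fourier_L2 ?f \<tau>))\<^sup>2)"
    by (subst (asm) integrable_cong_AE) auto
  with gauss_shift_L2[of x] show ?thesis by (simp add: H_half_def)
qed

text \<open>Gaussian tests already determine the product of the symbol with the transform of Q. It
  agrees a.e. with the Fourier integral of the integrable function Q^2, and dividing by the symbol
  is convolution with \<open>green\<close>.\<close>

lemma solution_eq_gconv:
  fixes Q :: "real \<Rightarrow> real"
  assumes Q: "(\<lambda>t. complex_of_real (Q t)) \<in> L2" and eq: "solves_Q_equation Q"
  shows "AE t in lborel. complex_of_real (Q t) = gconv (\<lambda>y. of_real ((Q y)\<^sup>2)) t"
proof -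
  let ?Q = "\<lambda>t. complex_of_real (Q t)" and ?q = "\<lambda>t. complex_of_real ((Q t)\<^sup>2)"
  have q: "integrable lborel ?q"
    using L2_mult_integrable[OF Q Q] by (simp add: power2_eq_square)
  have FQ: "fourier_L2 ?Q \<in> L2" by (rule fourier_L2_L2[OF Q])
  have Fq [measurable]: "fourier_integral ?q \<in> borel_measurable borel" by (rule measurable_fourier_integral[OF q])
  have FQm [measurable]: "fourier_L2 ?Q \<in> borel_measurable borel" using L2_measurable[OF FQ] by simp
  have gg: "(\<lambda>\<tau>. gauss \<tau> * of_real (tau_coth \<tau>)) \<in> L2"
  proof (rule L2I)
    have "integrable lborel (\<lambda>\<tau>. (tau_coth \<tau>)\<^sup>2 * (norm (gauss \<tau>))\<^sup>2)"
      using tau_coth_le tau_coth_lower(2)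
      by (intro gauss_weight_integrable) (auto intro!: power_mono simp: less_imp_le)
    then show "integrable lborel (\<lambda>\<tau>. (norm (gauss \<tau> * of_real (tau_coth \<tau>)))\<^sup>2)"
      by (simp add: norm_mult power_mult_distrib mult.commute)
  qed measurable
  have "AE \<tau> in lborel. of_real (tau_coth \<tau>) * fourier_L2 ?Q \<tau> = fourier_integral ?q \<tau>"
  proof (rule AE_eq_of_gauss_tests)
    show "integrable lborel (\<lambda>t. gauss t * (of_real (tau_coth t) * fourier_L2 ?Q t))"
      using L2_mult_integrable[OF gg FQ] by (simp add: mult.assoc)
    show "integrable lborel (\<lambda>t. gauss t * fourier_integral ?q t)"
      using integrable_fourier_integral_mult[OF q integrable_gauss] by (simp add: mult.commute)
    fix x
    let ?f = "\<lambda>t. gauss (t + x)"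
    \<comment> \<open>The weak equation conjugates the transform of the test function, so
      translation by -x produces the factor \<open>wave x\<close>.\<close>
    have f: "?f = (\<lambda>t. gauss (t - (- x)))" by simp
    have fH: "?f \<in> H_half" unfolding f by (rule gauss_shift_H_half)
    have fL: "?f \<in> L2" "integrable lborel ?f"
      unfolding f by (rule gauss_shift_L2, rule integrable_gauss_shift)
    have fF: "AE \<tau> in lborel. fourier_L2 ?f \<tau> = cnj (wave x \<tau>) * gauss \<tau>"
      using fourier_L2_eq_fourier_integral[OF fL] unfolding f fourier_integral_gauss_shift
      by (simp add: wave_uminus wave_commute[of x])
    have [measurable]: "fourier_L2 ?f \<in> borel_measurable borel"
      using L2_measurable[OF fourier_L2_L2[OF fL(1)]] by simp
    have "(LINT \<tau>|lborel. wave x \<tau> * (gauss \<tau> * (of_real (tau_coth \<tau>) * fourier_L2 ?Q \<tau>)))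
       = (LINT \<tau>|lborel. of_real (tau_coth \<tau>) * cnj (fourier_L2 ?f \<tau>) * fourier_L2 ?Q \<tau>)"
    proof (rule integral_cong_AE)
      show "AE \<tau> in lborel. wave x \<tau> * (gauss \<tau> * (of_real (tau_coth \<tau>) * fourier_L2 ?Q \<tau>))
         = of_real (tau_coth \<tau>) * cnj (fourier_L2 ?f \<tau>) * fourier_L2 ?Q \<tau>"
        using fF by eventually_elim (simp add: mult_ac)
    qed measurable
    also have "\<dots> = (LINT t|lborel. cnj (?f t) * ?q t)"
      using eq fH unfolding solves_Q_equation_def by blast
    also have "\<dots> = (LINT t|lborel. ?q t * fourier_integral (\<lambda>\<tau>. wave x \<tau> * gauss \<tau>) t)"
      unfolding fourier_integral_wave_gauss by (simp add: mult.commute)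
    also have "\<dots> = (LINT \<tau>|lborel. fourier_integral ?q \<tau> * (wave x \<tau> * gauss \<tau>))"
      using fourier_integral_swap[OF q integrable_wave_mult[OF integrable_gauss], of x] by simp
    finally show "(LINT t|lborel. wave x t * (gauss t * (of_real (tau_coth t) * fourier_L2 ?Q t)))
      = (LINT t|lborel. wave x t * (gauss t * fourier_integral ?q t))"
      by (simp add: mult_ac)
  qed
  then have "AE \<tau> in lborel. fourier_L2 ?Q \<tau> = fourier_integral (gconv ?q) \<tau>"
  proof eventually_elim
    case (elim \<tau>)
    have "tau_coth \<tau> \<noteq> 0" using tau_coth_lower(2)[of \<tau>] by simp
    then show ?case using elim by (simp add: fourier_integral_gconv[OF q] field_simps del: of_real_power)
  qed
  then show ?thesis
    by (rule eq_of_fourier_L2_eq_fourier_integral[OF Q integrable_gconv[OF q]])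
qed

text \<open>With \<open>M = \<integral>Q\<^sup>2\<close>, Cauchy--Schwarz for the measure \<open>Q\<^sup>2 dy\<close> gives \<open>Q\<^sup>2 \<le> M (green\<^sup>2 * Q\<^sup>2)\<close>.
  Inserted once more into \<open>Q = green * Q\<^sup>2\<close>, this bounds \<open>Q\<close> by a multiple of \<open>\<integral>green\<^sup>3\<close>.\<close>

lemma solution_bounded:
  fixes Q :: "real \<Rightarrow> real"
  assumes Q: "(\<lambda>t. complex_of_real (Q t)) \<in> L2"
    and eq: "AE t in lborel. complex_of_real (Q t) = gconv (\<lambda>y. of_real ((Q y)\<^sup>2)) t"
  shows "\<exists>B. AE t in lborel. \<bar>Q t\<bar> \<le> B"
proof -
  have [measurable]: "Q \<in> borel_measurable borel"
    using L2_measurable[OF Q] by (auto simp: borel_measurable_complex_iff)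
  define M where "M = (\<integral>\<^sup>+y. ennreal ((Q y)\<^sup>2) \<partial>lborel)"
  have M: "M < \<infinity>"
    using Q by (simp add: L2_iff sqnorm_def M_def)
  define G where "G = (\<integral>\<^sup>+y. ennreal (green y ^ 3) \<partial>lborel)"
  have G: "G < \<infinity>"
    using integrable_green_cubed green_nonneg by (simp add: integrable_iff_bounded G_def)
  define P where "P x = (\<integral>\<^sup>+y. ennreal (green (x - y)) * ennreal ((Q y)\<^sup>2) \<partial>lborel)" for x
  have QP: "AE x in lborel. ennreal \<bar>Q x\<bar> \<le> P x"
    using eq
  proof eventually_elim
    case (elim x)
    have "ennreal \<bar>Q x\<bar> = ennreal (norm (gconv (\<lambda>y. of_real ((Q y)\<^sup>2)) x))"
      using elim by (metis norm_of_real)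
    also have "\<dots> \<le> P x"
    \<comment> \<open>If the convolution integral diverges, the Bochner integral is 0 by convention
      and the bound in \<open>ennreal\<close> still holds.\<close>
    proof (cases "integrable lborel (\<lambda>y. complex_of_real (green (x - y)) * of_real ((Q y)\<^sup>2))")
      case True
      have "ennreal (norm (gconv (\<lambda>y. of_real ((Q y)\<^sup>2)) x)) \<le> ennreal (LINT y|lborel. norm (complex_of_real (green (x - y)) * of_real ((Q y)\<^sup>2)))"
        unfolding gconv_def conv_reflect by (intro ennreal_leI integral_norm_bound)
      also have "\<dots> = (\<integral>\<^sup>+y. ennreal (norm (complex_of_real (green (x - y)) * of_real ((Q y)\<^sup>2))) \<partial>lborel)"
        using True by (intro nn_integral_eq_integral[symmetric]) auto
      also have "\<dots> = P x"
        unfolding P_def by (intro nn_integral_cong) (simp add: norm_mult norm_power green_nonneg ennreal_mult)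
      finally show ?thesis .
    qed (simp add: gconv_def conv_reflect not_integrable_integral_eq)
    finally show ?case .
  qed
  have sq: "AE y in lborel. ennreal ((Q y)\<^sup>2) \<le> M * (\<integral>\<^sup>+z. ennreal ((green (y - z))\<^sup>2) * ennreal ((Q z)\<^sup>2) \<partial>lborel)"
    using QP
  proof eventually_elim
    case (elim y)
    have "ennreal ((Q y)\<^sup>2) = (ennreal \<bar>Q y\<bar>)\<^sup>2" by (simp add: ennreal_power)
    also have "\<dots> \<le> (P y)\<^sup>2" by (rule power_mono[OF elim]) simp
    also have "P y = (\<integral>\<^sup>+z. (ennreal (green (y - z)) * ennreal \<bar>Q z\<bar>) * ennreal \<bar>Q z\<bar> \<partial>lborel)"
      unfolding P_def by (intro nn_integral_cong) (simp add: ennreal_mult[symmetric] mult.assoc green_nonneg power2_eq_square)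
    also have "(\<dots>)\<^sup>2 \<le> (\<integral>\<^sup>+z. (ennreal (green (y - z)) * ennreal \<bar>Q z\<bar>)\<^sup>2 \<partial>lborel) * (\<integral>\<^sup>+z. (ennreal \<bar>Q z\<bar>)\<^sup>2 \<partial>lborel)"
      by (rule Cauchy_Schwarz_nn_integral) measurable
    also have "\<dots> = M * (\<integral>\<^sup>+z. ennreal ((green (y - z))\<^sup>2) * ennreal ((Q z)\<^sup>2) \<partial>lborel)"
      by (simp add: M_def power_mult_distrib ennreal_power green_nonneg mult.commute)
    finally show ?case .
  qed
  \<comment> \<open>Takes the place of Hoelder's inequality: it separates the two Green functions,
    so that the integral over y is at most \<open>G + G\<close> whatever x and z are.\<close>
  have cube: "ennreal (green (x - y)) * ennreal ((green (y - z))\<^sup>2) \<le> ennreal (green (x - y) ^ 3) + ennreal (green (y - z) ^ 3)" for x y z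
  proof -
    have "a * b\<^sup>2 \<le> a ^ 3 + b ^ 3" if "a \<ge> 0" "b \<ge> 0" for a b :: real
    proof (cases "a \<le> b")
      case True
      then have "a * b\<^sup>2 \<le> b * b\<^sup>2" using that by (intro mult_right_mono) auto
      also have "\<dots> = b ^ 3" by (simp add: power2_eq_square power3_eq_cube)
      finally show ?thesis using that by (simp add: add_increasing)
    next
      case False
      then have "a * b\<^sup>2 \<le> a * a\<^sup>2" using that by (intro mult_left_mono power_mono) auto
      also have "\<dots> = a ^ 3" by (simp add: power2_eq_square power3_eq_cube)
      finally show ?thesis using that by (simp add: add_increasing2)
    qed
    from this[OF green_nonneg green_nonneg, of "x - y" "y - z"] show ?thesis
      using green_nonneg by (simp add: ennreal_mult[symmetric] ennreal_plus[symmetric] del: ennreal_plus)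
  qed
  have Gs: "(\<integral>\<^sup>+y. ennreal (green (x - y) ^ 3) \<partial>lborel) = G" "(\<integral>\<^sup>+y. ennreal (green (y - x) ^ 3) \<partial>lborel) = G" for x
  proof -
    show 1: "(\<integral>\<^sup>+y. ennreal (green (x - y) ^ 3) \<partial>lborel) = G"
      using nn_integral_real_affine[of "\<lambda>y. ennreal (green y ^ 3)" "-1" x] by (simp add: G_def)
    have "green (y - x) = green (x - y)" for y
      using green_uminus[of "x - y"] by simp
    with 1 show "(\<integral>\<^sup>+y. ennreal (green (y - x) ^ 3) \<partial>lborel) = G" by simp
  qed
  have P_le: "P x \<le> M * (M * (G + G))" for x
  proof -
    have "P x \<le> (\<integral>\<^sup>+y. ennreal (green (x - y)) * (M * (\<integral>\<^sup>+z. ennreal ((green (y - z))\<^sup>2) * ennreal ((Q z)\<^sup>2) \<partial>lborel)) \<partial>lborel)"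
      unfolding P_def by (intro nn_integral_mono_AE) (use sq in \<open>eventually_elim, auto intro: mult_left_mono\<close>)
    also have "\<dots> = M * (\<integral>\<^sup>+y. (\<integral>\<^sup>+z. ennreal (green (x - y)) * (ennreal ((green (y - z))\<^sup>2) * ennreal ((Q z)\<^sup>2)) \<partial>lborel) \<partial>lborel)"
      by (subst nn_integral_cmult[symmetric], measurable, intro nn_integral_cong) (simp add: nn_integral_cmult mult.left_commute)
    also have "(\<integral>\<^sup>+y. (\<integral>\<^sup>+z. ennreal (green (x - y)) * (ennreal ((green (y - z))\<^sup>2) * ennreal ((Q z)\<^sup>2)) \<partial>lborel) \<partial>lborel)
      = (\<integral>\<^sup>+z. (\<integral>\<^sup>+y. ennreal (green (x - y)) * (ennreal ((green (y - z))\<^sup>2) * ennreal ((Q z)\<^sup>2)) \<partial>lborel) \<partial>lborel)"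
      by (rule lborel_pair.Fubini') measurable
    also have "\<dots> \<le> (\<integral>\<^sup>+z. (G + G) * ennreal ((Q z)\<^sup>2) \<partial>lborel)"
    proof (rule nn_integral_mono)
      fix z
      have "(\<integral>\<^sup>+y. ennreal (green (x - y)) * (ennreal ((green (y - z))\<^sup>2) * ennreal ((Q z)\<^sup>2)) \<partial>lborel)
        = (\<integral>\<^sup>+y. ennreal (green (x - y)) * ennreal ((green (y - z))\<^sup>2) \<partial>lborel) * ennreal ((Q z)\<^sup>2)"
        by (subst nn_integral_multc[symmetric]) (auto simp: mult.assoc)
      also have "\<dots> \<le> (\<integral>\<^sup>+y. ennreal (green (x - y) ^ 3) + ennreal (green (y - z) ^ 3) \<partial>lborel) * ennreal ((Q z)\<^sup>2)"
        by (intro mult_right_mono nn_integral_mono cube) auto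
      also have "\<dots> = (G + G) * ennreal ((Q z)\<^sup>2)"
        by (subst nn_integral_add) (auto simp: Gs)
      finally show "(\<integral>\<^sup>+y. ennreal (green (x - y)) * (ennreal ((green (y - z))\<^sup>2) * ennreal ((Q z)\<^sup>2)) \<partial>lborel) \<le> (G + G) * ennreal ((Q z)\<^sup>2)" .
    qed
    also have "\<dots> = M * (G + G)"
      by (subst nn_integral_cmult) (auto simp: M_def mult.commute)
    finally show ?thesis by (simp add: mult_left_mono)
  qed
  define B where "B = enn2real (M * (M * (G + G)))"
  have "M * (M * (G + G)) < \<infinity>"
    using M G by (simp add: ennreal_mult_less_top)
  then have B: "M * (M * (G + G)) = ennreal B"
    by (simp add: B_def)
  have "AE x in lborel. \<bar>Q x\<bar> \<le> B"
    using QP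
  proof eventually_elim
    case (elim x)
    then have "ennreal \<bar>Q x\<bar> \<le> ennreal B" using P_le[of x] B by simp
    then show ?case by (simp add: B_def ennreal_le_iff)
  qed
  then show ?thesis by blast
qed

text \<open>A Schwartz-like class on the frequency side. The last two clauses record that
  \<open>ift a\<close> is integrable with transform \<open>a\<close>, so that one may pass freely
  between a function and its transform.\<close>

definition rapid :: "(real \<Rightarrow> complex) \<Rightarrow> bool" where
  "rapid a \<longleftrightarrow> a \<in> borel_measurable borel \<and> (\<forall>n. decays n a) \<and> integrable lborel (ift a) \<and> fourier_integral (ift a) = a"

text \<open>The passage from an a.e. identity to a continuous representative \<open>ift a\<close>;
  it serves both Q and the elements of the kernel.\<close>

lemma gconv_solution_profile:
  assumes h: "integrable lborel h" "h \<in> L2" and [measurable]: "v \<in> borel_measurable borel"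
    and v: "AE t in lborel. v t = gconv h t"
  defines "a \<equiv> \<lambda>\<tau>. fourier_integral h \<tau> / of_real (tau_coth \<tau>)"
  shows "AE t in lborel. v t = ift a t" "integrable lborel a" "integrable lborel (ift a)"
    "fourier_integral (ift a) = a" "integrable lborel v"
proof -
  have a: "integrable lborel a" "AE x in lborel. gconv h x = ift a x"
    unfolding a_def by (rule gconv_regular[OF h])+
  have [measurable]: "ift a \<in> borel_measurable borel" by (rule measurable_ift[OF a(1)])
  have gi: "integrable lborel (gconv h)" by (rule integrable_gconv[OF h(1)])
  then have [measurable]: "gconv h \<in> borel_measurable borel" by auto
  show "integrable lborel a" by (rule a)
  show "AE t in lborel. v t = ift a t"
    using v a(2) by eventually_elim simp
  show "integrable lborel (ift a)"
    using integrable_cong_AE[OF _ _ a(2)] gi by simp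
  show "integrable lborel v"
    using integrable_cong_AE[OF _ _ v] gi by simp
  have "fourier_integral (ift a) \<tau> = fourier_integral (gconv h) \<tau>" for \<tau>
    by (rule fourier_integral_cong_AE) (use a(2) in auto)
  then show "fourier_integral (ift a) = a"
    by (simp add: fun_eq_iff a_def fourier_integral_gconv[OF h(1)])
qed

text \<open>The bootstrap: division by the symbol raises the order of decay by one, and the step
  hands the new order back to f, starting from a bounded f.\<close>

lemma decays_all_of_step:
  assumes "decays 0 f" "\<And>n. decays n (\<lambda>\<tau>. f \<tau> / of_real (tau_coth \<tau>)) \<Longrightarrow> decays n f"
  shows "decays n (\<lambda>\<tau>. f \<tau> / of_real (tau_coth \<tau>))"
proof (induction n)
  case 0
  then show ?case using decays_tau_coth_divide[OF assms(1)] by (rule decays_mono) simp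
next
  case (Suc n)
  from decays_tau_coth_divide[OF assms(2)[OF Suc]] show ?case .
qed

text \<open>The transform of Q^2 is \<open>a\<close> convolved with itself, hence decays as fast as
  \<open>a\<close>, while \<open>a\<close> is that transform divided by the symbol: the bootstrap
  applies. Boundedness of Q enters to place Q^2 in L2, which makes \<open>a\<close> integrable to
  begin with.\<close>

lemma solution_profile:
  fixes Q :: "real \<Rightarrow> real"
  assumes Q: "(\<lambda>t. complex_of_real (Q t)) \<in> L2"
    and eq: "AE t in lborel. complex_of_real (Q t) = gconv (\<lambda>y. of_real ((Q y)\<^sup>2)) t"
  shows "\<exists>a. rapid a \<and> (AE t in lborel. complex_of_real (Q t) = ift a t) \<and>
     (\<forall>\<tau>. fourier_integral (\<lambda>t. ift a t * ift a t) \<tau> = of_real (tau_coth \<tau>) * a \<tau>)"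
proof -
  let ?Q = "\<lambda>t. complex_of_real (Q t)"
  let ?h = "\<lambda>t. complex_of_real ((Q t)\<^sup>2)"
  have [measurable]: "Q \<in> borel_measurable borel"
    using L2_measurable[OF Q] by (auto simp: borel_measurable_complex_iff)
  obtain B where B: "AE t in lborel. \<bar>Q t\<bar> \<le> B"
    using solution_bounded[OF Q eq] by blast
  have h: "integrable lborel ?h"
    using L2_mult_integrable[OF Q Q] by (simp add: power2_eq_square)
  have h2: "?h \<in> L2"
  proof (rule L2I)
    show "integrable lborel (\<lambda>t. (norm (?h t))\<^sup>2)"
    proof (rule Bochner_Integration.integrable_bound)
      show "integrable lborel (\<lambda>t. B\<^sup>2 * norm (?h t))"
        by (rule integrable_mult_right[OF integrable_norm[OF h]])
      show "AE t in lborel. norm ((norm (?h t))\<^sup>2) \<le> norm (B\<^sup>2 * norm (?h t))"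
        using B
      proof eventually_elim
        case (elim t)
        then have "(Q t)\<^sup>2 \<le> B\<^sup>2" by (metis abs_ge_zero power2_abs power_mono)
        then have "(Q t)\<^sup>2 * (Q t)\<^sup>2 \<le> B\<^sup>2 * (Q t)\<^sup>2" by (rule mult_right_mono) simp
        then show ?case by (simp add: norm_mult power2_eq_square)
      qed
    qed measurable
  qed measurable
  define a where "a = (\<lambda>\<tau>. fourier_integral ?h \<tau> / of_real (tau_coth \<tau>))"
  have Qm: "?Q \<in> borel_measurable borel" by measurable
  note pr = gconv_solution_profile[OF h h2 Qm eq, folded a_def]
  have Qa: "AE t in lborel. ?Q t = ift a t" and a: "integrable lborel a"
    and ia: "integrable lborel (ift a)" and Fa: "fourier_integral (ift a) = a"
    by (rule pr)+
  have am [measurable]: "a \<in> borel_measurable borel" using a by auto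
  have [measurable]: "ift a \<in> borel_measurable borel" using ia by auto
  have Fh: "fourier_integral ?h \<tau> = fourier_integral (\<lambda>t. ift a t * ift a t) \<tau>" for \<tau>
  proof (rule fourier_integral_cong_AE)
    show "AE t in lborel. ?h t = ift a t * ift a t"
      using Qa by eventually_elim (simp add: power2_eq_square)
  qed measurable
  have Fh': "fourier_integral ?h = (\<lambda>\<tau>. cF * (LINT s|lborel. a (\<tau> - s) * a s))"
    by (simp add: fun_eq_iff Fh fourier_integral_mult_ift[OF ia a] Fa del: of_real_power)
  have dec: "decays n a" for n
    unfolding a_def
  proof (rule decays_all_of_step)
    show "decays 0 (fourier_integral ?h)" by (rule decays_fourier_integral)
    show "decays n (fourier_integral ?h)" if "decays n (\<lambda>\<tau>. fourier_integral ?h \<tau> / of_real (tau_coth \<tau>))" for n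
    proof -
      have "decays n a" using that by (simp add: a_def)
      from decays_convolution[OF a this a this, of cF] show ?thesis unfolding Fh' .
    qed
  qed
  show ?thesis
  proof (intro exI[of _ a] conjI allI)
    show "rapid a" by (simp add: rapid_def dec ia Fa)
    show "AE t in lborel. ?Q t = ift a t" by (rule Qa)
    show "fourier_integral (\<lambda>t. ift a t * ift a t) \<tau> = of_real (tau_coth \<tau>) * a \<tau>" for \<tau>
      using tau_coth_lower(2)[of \<tau>] unfolding Fh[symmetric] by (simp add: a_def del: of_real_power)
  qed
qed

section \<open>The bilinear identity\<close>

text \<open>Differentiation under the integral with an explicit remainder: |exp (i h s) - 1 - i h s|
  \<le> (h s)^2, so the difference quotient errs by at most |h| times the second absolute moment of
  a.\<close>

lemma ift_has_vector_derivative: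
  assumes a: "integrable lborel a" and a1: "integrable lborel (\<lambda>s. \<i> * of_real s * a s)"
    and a2: "integrable lborel (\<lambda>s. of_real (s\<^sup>2) * a s)"
  shows "(ift a has_vector_derivative ift (\<lambda>s. \<i> * of_real s * a s) x) (at x)"
proof -
  define I where "I = (LINT s|lborel. norm (of_real (s\<^sup>2) * a s))"
  have bound: "norm (ift a (x + h) - ift a x - h *\<^sub>R ift (\<lambda>s. \<i> * of_real s * a s) x) \<le> h\<^sup>2 * I" for h
  proof -
    let ?d = "\<lambda>s. wave (- (x + h)) s * a s - wave (- x) s * a s - of_real h * (wave (- x) s * (\<i> * of_real s * a s))"
    have int: "integrable lborel ?d"
      using a a1 by (intro Bochner_Integration.integrable_diff integrable_mult_right integrable_wave_mult)
    have "ift a (x + h) - ift a x - h *\<^sub>R ift (\<lambda>s. \<i> * of_real s * a s) x = cF * (LINT s|lborel. ?d s)"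
      using a a1 by (simp add: ift_def fourier_integral_wave scaleR_conv_of_real right_diff_distrib)
    then have "norm (ift a (x + h) - ift a x - h *\<^sub>R ift (\<lambda>s. \<i> * of_real s * a s) x) \<le> norm (LINT s|lborel. ?d s)"
      using norm_cF_le_1 by (simp only: norm_mult) (simp add: mult_left_le_one_le)
    also have "\<dots> \<le> (LINT s|lborel. norm (?d s))"
      by (rule integral_norm_bound)
    also have "\<dots> \<le> (LINT s|lborel. h\<^sup>2 * norm (of_real (s\<^sup>2) * a s))"
    proof (rule integral_mono)
      fix s
      have e: "norm (iexp (h * s) - (1 + \<i> * of_real (h * s))) \<le> (h * s)\<^sup>2"
      proof -
        have "norm (iexp (h * s) - (1 + \<i> * of_real (h * s))) \<le> \<bar>h * s\<bar>\<^sup>2 / 2"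
          using iexp_approx1[of "h * s" 1] by (simp add: numeral_2_eq_2)
        also have "\<dots> \<le> (h * s)\<^sup>2"
          unfolding power2_abs using zero_le_power2[of "h * s"] by linarith
        finally show ?thesis .
      qed
      have "?d s = wave (- x) s * a s * (iexp (h * s) - (1 + \<i> * of_real (h * s)))"
        using wave_add_left[of "- x" "- h" s] by (simp add: wave_def[of "- h"] algebra_simps)
      then have "norm (?d s) = norm (a s) * norm (iexp (h * s) - (1 + \<i> * of_real (h * s)))"
        by (simp add: norm_mult)
      also have "\<dots> \<le> norm (a s) * (h * s)\<^sup>2"
        by (intro mult_left_mono e) auto
      finally show "norm (?d s) \<le> h\<^sup>2 * norm (of_real (s\<^sup>2) * a s)"
        by (simp add: norm_mult norm_power power_mult_distrib mult_ac)
    qed (use int a2 in \<open>auto intro: integrable_norm simp del: of_real_power\<close>)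
    also have "\<dots> = h\<^sup>2 * I" by (simp add: I_def)
    finally show ?thesis .
  qed
  show ?thesis
    unfolding has_vector_derivative_def has_derivative_at
  proof (intro conjI bounded_linear_scaleR_left)
    show "(\<lambda>h. norm (ift a (x + h) - ift a x - h *\<^sub>R ift (\<lambda>s. \<i> * of_real s * a s) x) / norm h) \<midarrow>0\<rightarrow> 0"
    proof (rule tendsto_sandwich[OF _ _ tendsto_const])
      show "\<forall>\<^sub>F h in at 0. norm (ift a (x + h) - ift a x - h *\<^sub>R ift (\<lambda>s. \<i> * of_real s * a s) x) / norm h \<le> \<bar>h\<bar> * I"
      proof (intro eventually_at_topological[THEN iffD2] exI[of _ UNIV] conjI ballI impI)
        fix h :: real assume "h \<noteq> 0"
        then have "h\<^sup>2 * I / \<bar>h\<bar> = \<bar>h\<bar> * I" by (simp add: power2_eq_square field_simps abs_mult_self_eq)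
        then show "norm (ift a (x + h) - ift a x - h *\<^sub>R ift (\<lambda>s. \<i> * of_real s * a s) x) / norm h \<le> \<bar>h\<bar> * I"
          using divide_right_mono[OF bound[of h], of "\<bar>h\<bar>"] by simp
      qed auto
      show "(\<lambda>h. \<bar>h\<bar> * I) \<midarrow>0\<rightarrow> 0"
        by (auto intro!: tendsto_eq_intros)
    qed simp
  qed
qed

definition ift' :: "(real \<Rightarrow> complex) \<Rightarrow> real \<Rightarrow> complex" where
  "ift' a = ift (\<lambda>s. \<i> * of_real s * a s)"

lemma decays_monomial: "decays (Suc n) a \<Longrightarrow> decays n (\<lambda>s. \<i> * of_real s * a s)"
  by (erule decays_mult_linear) (simp add: norm_mult)

lemma rapid_integrable:
  assumes "rapid a"
  shows "integrable lborel a" "integrable lborel (\<lambda>s. \<i> * of_real s * a s)"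
    "integrable lborel (\<lambda>s. of_real (tau_coth s) * a s)"
    "integrable lborel (\<lambda>s. \<i> * of_real s * (of_real (tau_coth s) * a s))"
    "integrable lborel (\<lambda>s. of_real (s\<^sup>2) * a s)"
    "integrable lborel (\<lambda>s. of_real (s\<^sup>2) * (of_real (tau_coth s) * a s))"
proof -
  \<comment> \<open>Five powers suffice for the most demanding claim, the last: two for
    integrability, two for the factor s^2 and one for the symbol.\<close>
  have [measurable]: "a \<in> borel_measurable borel" and d: "decays 5 a" using assms by (auto simp: rapid_def)
  have d3: "decays (Suc 2) a" using d by (rule decays_mono) simp
  have d4: "decays (Suc (Suc 2)) a" using d by (rule decays_mono) simp
  show "integrable lborel a"
    by (rule decays_integrable[OF decays_mono[OF d]]) auto
  show "integrable lborel (\<lambda>s. \<i> * of_real s * a s)"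
    by (rule decays_integrable[OF decays_monomial[OF d3]]) measurable
  show "integrable lborel (\<lambda>s. of_real (tau_coth s) * a s)"
    by (rule decays_integrable[OF decays_tau_coth_mult[OF d3]]) measurable
  show "integrable lborel (\<lambda>s. \<i> * of_real s * (of_real (tau_coth s) * a s))"
    by (rule decays_integrable[OF decays_monomial[OF decays_tau_coth_mult[OF d4]]]) measurable
  have d5: "decays (Suc (Suc (Suc 2))) a" using d by (rule decays_mono) simp
  have sq: "integrable lborel (\<lambda>s. of_real (s\<^sup>2) * b s)"
    if "decays (Suc (Suc 2)) b" and [measurable]: "b \<in> borel_measurable borel" for b
  proof -
    have "integrable lborel (\<lambda>s. - (\<i> * of_real s * (\<i> * of_real s * b s)))"
      by (intro Bochner_Integration.integrable_minus decays_integrable decays_monomial that(1)) measurable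
    moreover have "- (\<i> * of_real s * (\<i> * of_real s * b s)) = of_real (s\<^sup>2) * b s" for s
    proof -
      have "- (\<i> * of_real s * (\<i> * of_real s * b s)) = - (\<i> * \<i>) * (of_real s * of_real s * b s)"
        by (simp only: mult_ac minus_mult_left)
      then show ?thesis by (simp add: power2_eq_square)
    qed
    ultimately show ?thesis by (simp only:)
  qed
  show "integrable lborel (\<lambda>s. of_real (s\<^sup>2) * a s)"
    by (rule sq[OF d4]) measurable
  show "integrable lborel (\<lambda>s. of_real (s\<^sup>2) * (of_real (tau_coth s) * a s))"
    by (rule sq[OF decays_tau_coth_mult[OF d5]]) measurable
qed

lemma rapid_has_derivative: "rapid a \<Longrightarrow> (ift a has_vector_derivative ift' a x) (at x)"
  unfolding ift'_def by (intro ift_has_vector_derivative rapid_integrable)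

text \<open>The primitive \<open>V\<close> of an integrable function need not vanish at infinity, so it has no Fourier
  integral. Convolution with \<open>expker \<delta>\<close>, which inverts \<open>d/dx + \<delta>\<close>, replaces it by integrable
  functions that tend to \<open>V\<close> as \<open>\<delta> \<rightarrow> 0\<close>.\<close>

definition expker :: "real \<Rightarrow> real \<Rightarrow> complex" where
  "expker \<delta> y = indicator {0<..} y * of_real (exp (- (\<delta> * y)))"

text \<open>At \<delta> = 0 the kernel is the indicator of the positive half line, which selects the
  primitive vanishing at -\<infinity>. Other constants of integration enter later as real
  shifts.\<close>

definition primit :: "(real \<Rightarrow> complex) \<Rightarrow> real \<Rightarrow> complex" where
  "primit = conv (expker 0)"

lemma measurable_expker [measurable]: "expker \<delta> \<in> borel_measurable borel"
  unfolding expker_def[abs_def] by measurable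

lemma norm_expker_le: "\<delta> \<ge> 0 \<Longrightarrow> norm (expker \<delta> y) \<le> 1"
  by (auto simp: expker_def indicator_def)

lemma expker_fourier:
  assumes "\<delta> > 0"
  shows "integrable lborel (expker \<delta>)" "(LINT y|lborel. wave \<tau> y * expker \<delta> y) = 1 / (of_real \<delta> + \<i> * of_real \<tau>)"
proof -
  have eq: "wave \<tau> y * expker \<delta> y = indicator {0<..} y * exp (- ((of_real \<delta> + \<i> * of_real \<tau>) * of_real y))" for \<tau> y
    by (simp add: expker_def wave_def indicator_def exp_of_real[symmetric] exp_add[symmetric] algebra_simps)
  have z: "Re (of_real \<delta> + \<i> * of_real \<tau>) > 0" for \<tau> using assms by simp
  show "integrable lborel (expker \<delta>)"
    using exp_half_line(1)[OF z[of 0]] unfolding eq[symmetric] by simp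
  show "(LINT y|lborel. wave \<tau> y * expker \<delta> y) = 1 / (of_real \<delta> + \<i> * of_real \<tau>)"
    unfolding eq by (rule exp_half_line(2)[OF z])
qed

text \<open>Uniform in \<delta>: it provides the dominating function for \<delta> -> 0 and, at
  \<delta> = 0, the bound on the primitive.\<close>

lemma norm_conv_expker_le:
  assumes "\<delta> \<ge> 0" "integrable lborel \<beta>"
  shows "norm (conv (expker \<delta>) \<beta> x) \<le> (LINT y|lborel. norm (\<beta> y))"
proof -
  have i: "integrable lborel (\<lambda>y. \<beta> (x - y))" by (rule integrable_reflect_shift[OF assms(2)])
  have "norm (conv (expker \<delta>) \<beta> x) \<le> (LINT y|lborel. norm (expker \<delta> y * \<beta> (x - y)))"
    unfolding conv_def by (rule integral_norm_bound)
  also have "\<dots> \<le> (LINT y|lborel. norm (\<beta> (x - y)))"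
    using i assms(1) norm_expker_le
    by (intro integral_mono integrable_norm integrable_bounded_mult[where B=1]) (auto simp: norm_mult mult_left_le_one_le)
  also have "\<dots> = (LINT y|lborel. norm (\<beta> y))" by (rule integral_reflect_shift)
  finally show ?thesis .
qed

lemma conv_expker_tendsto:
  assumes "integrable lborel \<beta>"
  shows "(\<lambda>n. conv (expker (1 / real (Suc n))) \<beta> x) \<longlonglongrightarrow> primit \<beta> x"
  unfolding primit_def conv_def
proof (rule integral_dominated_convergence)
  have [measurable]: "\<beta> \<in> borel_measurable borel" using assms by auto
  show "integrable lborel (\<lambda>y. norm (\<beta> (x - y)))"
    by (intro integrable_norm integrable_reflect_shift assms)
  show "AE y in lborel. (\<lambda>n. expker (1 / real (Suc n)) y * \<beta> (x - y)) \<longlonglongrightarrow> expker 0 y * \<beta> (x - y)"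
  proof (rule AE_I2)
    fix y
    have "(\<lambda>n. exp (- (1 / real (Suc n) * y))) \<longlonglongrightarrow> exp (- (0 * y))"
      by (intro tendsto_intros LIMSEQ_Suc[OF lim_1_over_n])
    then show "(\<lambda>n. expker (1 / real (Suc n)) y * \<beta> (x - y)) \<longlonglongrightarrow> expker 0 y * \<beta> (x - y)"
      unfolding expker_def by (intro tendsto_mult tendsto_of_real tendsto_const)
  qed
  show "AE y in lborel. norm (expker (1 / real (Suc n)) y * \<beta> (x - y)) \<le> norm (\<beta> (x - y))" for n
    using norm_expker_le[of "1 / real (Suc n)"] by (simp add: norm_mult mult_left_le_one_le)
qed (use assms in measurable)

lemma primit_has_derivative:
  assumes b: "integrable lborel \<beta>" and c: "\<And>x. isCont \<beta> x"
  shows "(primit \<beta> has_vector_derivative \<beta> x) (at x)"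
proof -
  have eq: "primit \<beta> y = primit \<beta> (x - 1) + integral {x - 1..y} \<beta>" if y: "y \<in> {x - 1..x + 1}" for y
  proof -
    have si: "set_integrable lborel A \<beta>" if "A \<in> sets borel" for A
      using integrable_mult_indicator[OF _ b, of A] that by (simp add: set_integrable_def)
    have pe: "primit \<beta> z = set_lebesgue_integral lborel {..<z} \<beta>" for z
    proof -
      have "primit \<beta> z = (LINT w|lborel. expker 0 (z - w) * \<beta> w)"
        by (simp add: primit_def conv_reflect)
      also have "\<dots> = (LINT w|lborel. indicator {..<z} w *\<^sub>R \<beta> w)"
        by (intro Bochner_Integration.integral_cong) (auto simp: expker_def indicator_def)
      finally show ?thesis by (simp add: set_lebesgue_integral_def)
    qed
    have "set_lebesgue_integral lborel ({..<x - 1} \<union> {x - 1..<y}) \<beta> = set_lebesgue_integral lborel {..<x - 1} \<beta> + set_lebesgue_integral lborel {x - 1..<y} \<beta>"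
      by (intro set_integral_Un si) auto
    moreover have "{..<x - 1} \<union> {x - 1..<y} = {..<y}" using y by auto
    moreover have "set_lebesgue_integral lborel {x - 1..<y} \<beta> = set_lebesgue_integral lborel {x - 1..y} \<beta>"
      unfolding set_lebesgue_integral_def
    proof (rule integral_cong_AE)
      show "AE w in lborel. indicator {x - 1..<y} w *\<^sub>R \<beta> w = indicator {x - 1..y} w *\<^sub>R \<beta> w"
        using AE_lborel_singleton[of y] by eventually_elim (auto simp: indicator_def)
    qed (use b in measurable)
    moreover have "set_lebesgue_integral lborel {x - 1..y} \<beta> = integral {x - 1..y} \<beta>"
      by (rule set_borel_integral_eq_integral(2)[OF si]) simp
    ultimately show ?thesis by (simp add: pe)
  qed
  have "((\<lambda>y. integral {x - 1..y} \<beta>) has_vector_derivative \<beta> x) (at x within {x - 1..x + 1})"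
    by (rule integral_has_vector_derivative) (use c in \<open>auto simp: continuous_at_imp_continuous_on\<close>)
  from has_vector_derivative_add[OF has_vector_derivative_const[of "primit \<beta> (x - 1)"] this]
  have "((\<lambda>y. primit \<beta> (x - 1) + integral {x - 1..y} \<beta>) has_vector_derivative \<beta> x) (at x within {x - 1..x + 1})"
    by simp
  then have "(primit \<beta> has_vector_derivative \<beta> x) (at x within {x - 1..x + 1})"
    by (intro has_vector_derivative_transform[OF _ eq]) auto
  then show ?thesis
    by (simp add: at_within_Icc_at)
qed

lemma isCont_conv:
  assumes k: "integrable lborel k" and h: "\<And>x. isCont h x" "\<And>x. norm (h x) \<le> B"
  shows "isCont (conv k h) x"
proof (rule continuous_at_sequentiallyI)
  fix u :: "nat \<Rightarrow> real" assume u: "u \<longlonglongrightarrow> x"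
  have [measurable]: "k \<in> borel_measurable borel" using k by auto
  have [measurable]: "h \<in> borel_measurable borel"
    by (rule borel_measurable_continuous_onI) (simp add: continuous_at_imp_continuous_on h)
  show "(\<lambda>n. conv k h (u n)) \<longlonglongrightarrow> conv k h x"
    unfolding conv_def
  proof (rule integral_dominated_convergence[where w="\<lambda>y. norm (k y) * B"])
    show "AE y in lborel. (\<lambda>n. k y * h (u n - y)) \<longlonglongrightarrow> k y * h (x - y)"
      using u by (intro AE_I2 tendsto_mult tendsto_const isCont_tendsto_compose[OF h(1)] tendsto_diff)
    show "AE y in lborel. norm (k y * h (u n - y)) \<le> norm (k y) * B" for n
      using h(2) by (intro AE_I2) (simp add: norm_mult mult_left_mono)
  qed (use k in \<open>auto intro: integrable_mult_left\<close>)
qed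

lemma isCont_gconv:
  assumes "\<And>x. isCont h x" "\<And>x. norm (h x) \<le> B"
  shows "isCont (gconv h) x"
  unfolding gconv_def using integrable_green assms by (intro isCont_conv) auto

text \<open>\<open>\<beta> = D u\<close> for \<open>u = ift a\<close>, where \<open>D\<close> is the operator with symbol \<^const>\<open>tau_coth\<close>.\<close>

definition dtn_pair :: "(real \<Rightarrow> complex) \<Rightarrow> (real \<Rightarrow> complex) \<Rightarrow> bool" where
  "dtn_pair a \<beta> \<longleftrightarrow> rapid a \<and> integrable lborel \<beta> \<and>
     fourier_integral \<beta> = (\<lambda>\<tau>. of_real (tau_coth \<tau>) * a \<tau>) \<and> \<beta> = ift (\<lambda>\<tau>. of_real (tau_coth \<tau>) * a \<tau>)"

text \<open>By the addition formula the numerator contains a factor s (this is \<open>key\<close>),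
  and |\<delta> + i s| \<ge> |s|. The pole is thereby cancelled uniformly in \<delta>, leaving the
  linear growth of the symbol in each variable.\<close>

lemma multiplier_bound:
  assumes \<tau>: "\<sigma> + s \<noteq> 0" and s: "s \<noteq> 0"
  shows "norm (of_real (tau_coth s * (tau_coth (\<sigma> + s) - tau_coth \<sigma>)) / (of_real \<delta> + \<i> * of_real s) :: complex)
     \<le> (2 * tau_coth (\<sigma> + s) / \<bar>\<sigma> + s\<bar> + 1) * ((1 + \<bar>\<sigma>\<bar>) * (1 + \<bar>s\<bar>))"
proof -
  let ?g = tau_coth
  let ?\<tau> = "\<sigma> + s"
  have key: "?g s * (?g ?\<tau> - ?g \<sigma>) = s * (?g ?\<tau> * (?g s - ?g \<sigma>) / ?\<tau> + \<sigma>)"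
  proof -
    have "?\<tau> * (?g s * (?g ?\<tau> - ?g \<sigma>)) = s * (?g ?\<tau> * (?g s - ?g \<sigma>) + ?\<tau> * \<sigma>)"
      using tau_coth_addition[of \<sigma> s] by (simp add: algebra_simps)
    then show ?thesis using \<tau> by (simp add: field_simps)
  qed
  have "\<bar>s\<bar> \<le> norm (of_real \<delta> + \<i> * of_real s :: complex)"
    using abs_Im_le_cmod[of "of_real \<delta> + \<i> * of_real s"] by simp
  then have "norm (of_real (?g s * (?g ?\<tau> - ?g \<sigma>)) / (of_real \<delta> + \<i> * of_real s) :: complex) \<le> \<bar>?g s * (?g ?\<tau> - ?g \<sigma>)\<bar> / \<bar>s\<bar>"
    using s unfolding norm_divide norm_of_real by (intro frac_le) auto
  also have "\<dots> = \<bar>?g ?\<tau> * (?g s - ?g \<sigma>) / ?\<tau> + \<sigma>\<bar>"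
    unfolding key using s by (simp add: abs_mult)
  also have "\<dots> \<le> \<bar>?g ?\<tau> * (?g s - ?g \<sigma>) / ?\<tau>\<bar> + \<bar>\<sigma>\<bar>" by (rule abs_triangle_ineq)
  finally have "norm (of_real (?g s * (?g ?\<tau> - ?g \<sigma>)) / (of_real \<delta> + \<i> * of_real s) :: complex)
    \<le> \<bar>?g ?\<tau> * (?g s - ?g \<sigma>) / ?\<tau>\<bar> + \<bar>\<sigma>\<bar>" .
  moreover have "\<bar>?g ?\<tau> * (?g s - ?g \<sigma>) / ?\<tau>\<bar> \<le> ?g ?\<tau> / \<bar>?\<tau>\<bar> * (2 * ((1 + \<bar>\<sigma>\<bar>) * (1 + \<bar>s\<bar>)))"
  proof -
    have "\<bar>?g ?\<tau> * (?g s - ?g \<sigma>) / ?\<tau>\<bar> = ?g ?\<tau> / \<bar>?\<tau>\<bar> * \<bar>?g s - ?g \<sigma>\<bar>"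
      using tau_coth_lower(2)[of ?\<tau>] by (simp add: abs_mult)
    also have "\<dots> \<le> ?g ?\<tau> / \<bar>?\<tau>\<bar> * (2 * ((1 + \<bar>\<sigma>\<bar>) * (1 + \<bar>s\<bar>)))"
    proof (intro mult_left_mono)
      have "\<bar>?g s - ?g \<sigma>\<bar> \<le> ?g s + ?g \<sigma>"
        using tau_coth_lower(2)[of s] tau_coth_lower(2)[of \<sigma>] by linarith
      also have "\<dots> \<le> (1 + \<bar>s\<bar>) + (1 + \<bar>\<sigma>\<bar>)"
        by (intro add_mono tau_coth_le)
      also have "\<dots> \<le> 2 * ((1 + \<bar>\<sigma>\<bar>) * (1 + \<bar>s\<bar>))"
        by (simp add: algebra_simps)
      finally show "\<bar>?g s - ?g \<sigma>\<bar> \<le> 2 * ((1 + \<bar>\<sigma>\<bar>) * (1 + \<bar>s\<bar>))" .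
    qed (use tau_coth_lower(2)[of ?\<tau>] in auto)
    finally show ?thesis .
  qed
  moreover have "\<bar>\<sigma>\<bar> \<le> (1 + \<bar>\<sigma>\<bar>) * (1 + \<bar>s\<bar>)" by (simp add: algebra_simps)
  moreover have "?g ?\<tau> / \<bar>?\<tau>\<bar> * (2 * W) + W = (2 * ?g ?\<tau> / \<bar>?\<tau>\<bar> + 1) * W" for W
    by (simp add: ring_distribs)
  ultimately show ?thesis by (smt (verit))
qed

text \<open>The addition formula divided by \<sigma> s. The three terms come from D applied to the
  products, from the products with \<beta> and \<gamma>, and from the derivative terms of the
  bilinear identity; at \<delta> = 0 their symbols cancel.\<close>

lemma multiplier_limit:
  assumes "s \<noteq> 0" "\<sigma> \<noteq> 0"
  shows "of_real (tau_coth s * (tau_coth (\<sigma> + s) - tau_coth \<sigma>)) / (\<i> * of_real s)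
    + of_real (tau_coth \<sigma> * (tau_coth (\<sigma> + s) - tau_coth s)) / (\<i> * of_real \<sigma>) + \<i> * of_real (\<sigma> + s) = (0::complex)"
proof -
  let ?X = "tau_coth s * (tau_coth (\<sigma> + s) - tau_coth \<sigma>)" and ?Y = "tau_coth \<sigma> * (tau_coth (\<sigma> + s) - tau_coth s)"
  have "\<sigma> * ?X + s * ?Y = (\<sigma> + s) * (\<sigma> * s)"
    using tau_coth_addition[of \<sigma> s] by (simp add: algebra_simps)
  then have "?X / s + ?Y / \<sigma> = \<sigma> + s"
    using assms by (simp add: field_simps)
  then have "complex_of_real (?X / s + ?Y / \<sigma>) = of_real (\<sigma> + s)" by simp
  then have "- \<i> * (complex_of_real ?X / of_real s + of_real ?Y / of_real \<sigma>) = - \<i> * of_real (\<sigma> + s)"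
    by (simp only: of_real_add of_real_divide)
  moreover have "X / (\<i> * S) = - \<i> * (X / S)" for X S :: complex
    by (simp add: divide_inverse)
  ultimately show ?thesis
    by (simp only: ring_distribs) (simp add: algebra_simps)
qed

text \<open>Polarization of the fact that \<open>(u + i V)\<^sup>2\<close> extends holomorphically to the strip
  \<open>0 < Im z < \<pi>/2\<close> when \<open>u + i V\<close> does. The addition formula makes the multiplier vanish in the
  limit \<open>\<delta> \<rightarrow> 0\<close>; it also cancels the poles of \<open>1 / (\<delta> + i s)\<close>, which gives an integrable bound.\<close>

lemma dtn_bilinear_fourier:
  assumes aB: "dtn_pair a \<beta>" and alC: "dtn_pair \<alpha> \<gamma>" and \<tau>: "\<tau> \<noteq> 0"
  defines "u \<equiv> ift a" and "w \<equiv> ift \<alpha>" and "V \<equiv> primit \<beta>" and "Z \<equiv> primit \<gamma>"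
  shows "of_real (tau_coth \<tau>) * (fourier_integral (\<lambda>x. u x * Z x) \<tau> + fourier_integral (\<lambda>x. w x * V x) \<tau>)
    = fourier_integral (\<lambda>x. Z x * \<beta> x) \<tau> + fourier_integral (\<lambda>x. V x * \<gamma> x) \<tau>
      - (fourier_integral (\<lambda>x. u x * ift' \<alpha> x) \<tau> + fourier_integral (\<lambda>x. w x * ift' a x) \<tau>)"
proof -
  let ?g = "\<lambda>\<tau>. complex_of_real (tau_coth \<tau>)"
  have na: "rapid a" and bi: "integrable lborel \<beta>" and Fb: "fourier_integral \<beta> = (\<lambda>\<tau>. ?g \<tau> * a \<tau>)"
    and b: "\<beta> = ift (\<lambda>\<tau>. ?g \<tau> * a \<tau>)"
    using aB by (auto simp: dtn_pair_def)
  have nal: "rapid \<alpha>" and ci: "integrable lborel \<gamma>" and Fc: "fourier_integral \<gamma> = (\<lambda>\<tau>. ?g \<tau> * \<alpha> \<tau>)"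
    and c: "\<gamma> = ift (\<lambda>\<tau>. ?g \<tau> * \<alpha> \<tau>)"
    using alC by (auto simp: dtn_pair_def)
  have ui: "integrable lborel u" and Fu: "fourier_integral u = a" using na by (auto simp: rapid_def u_def)
  have wi: "integrable lborel w" and Fw: "fourier_integral w = \<alpha>" using nal by (auto simp: rapid_def w_def)
  have [measurable]: "a \<in> borel_measurable borel" "\<alpha> \<in> borel_measurable borel" using na nal by (auto simp: rapid_def)
  have [measurable]: "u \<in> borel_measurable borel" "w \<in> borel_measurable borel" "\<beta> \<in> borel_measurable borel" "\<gamma> \<in> borel_measurable borel"
    using ui wi bi ci by auto
  note ai = rapid_integrable[OF na] and ali = rapid_integrable[OF nal]
  define \<delta> where "\<delta> n = 1 / real (Suc n)" for n
  have d: "\<delta> n > 0" for n by (simp add: \<delta>_def)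
  define Vn where "Vn n = conv (expker (\<delta> n)) \<beta>" for n
  define Zn where "Zn n = conv (expker (\<delta> n)) \<gamma>" for n
  have Vi: "integrable lborel (Vn n)" and Zi: "integrable lborel (Zn n)" for n
    unfolding Vn_def Zn_def by (intro integrable_conv expker_fourier d bi ci)+
  have [measurable]: "Vn n \<in> borel_measurable borel" "Zn n \<in> borel_measurable borel" for n
    using Vi[of n] Zi[of n] by auto
  define P where "P n s = 1 / (complex_of_real (\<delta> n) + \<i> * of_real s)" for n s
  have FV: "fourier_integral (Vn n) s = P n s * (?g s * a s)" and FZ: "fourier_integral (Zn n) s = P n s * (?g s * \<alpha> s)" for n s
    using expker_fourier[OF d] by (simp_all add: Vn_def Zn_def fourier_integral_conv bi ci Fb Fc P_def)
  have lim_mult: "(\<lambda>n. fourier_integral (\<lambda>x. h x * conv (expker (\<delta> n)) f x) \<tau>) \<longlonglongrightarrow> fourier_integral (\<lambda>x. h x * primit f x) \<tau>"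
    if h: "integrable lborel h" and f: "integrable lborel f" for h f
    unfolding fourier_integral_wave
  proof (intro tendsto_mult tendsto_const integral_dominated_convergence)
    have [measurable]: "h \<in> borel_measurable borel" "f \<in> borel_measurable borel" using h f by auto
    have [measurable]: "conv (expker (\<delta> n)) f \<in> borel_measurable borel" for n
      using integrable_conv[OF expker_fourier(1)[OF d] f] by auto
    have lim: "(\<lambda>n. conv (expker (\<delta> n)) f x) \<longlonglongrightarrow> primit f x" for x
      unfolding \<delta>_def by (rule conv_expker_tendsto[OF f])
    have [measurable]: "primit f \<in> borel_measurable borel"
      by (rule borel_measurable_LIMSEQ_metric[OF _ lim]) auto
    show "integrable lborel (\<lambda>x. norm (h x) * (LINT y|lborel. norm (f y)))"
      using h by (intro integrable_mult_left integrable_norm)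
    show "AE x in lborel. (\<lambda>n. wave \<tau> x * (h x * conv (expker (\<delta> n)) f x)) \<longlonglongrightarrow> wave \<tau> x * (h x * primit f x)"
      by (intro AE_I2 tendsto_mult tendsto_const lim)
    show "AE x in lborel. norm (wave \<tau> x * (h x * conv (expker (\<delta> n)) f x)) \<le> norm (h x) * (LINT y|lborel. norm (f y))" for n
      using norm_conv_expker_le[OF less_imp_le[OF d] f] by (simp add: norm_mult mult_left_mono)
    show "(\<lambda>x. wave \<tau> x * (h x * primit f x)) \<in> borel_measurable lborel"
      "(\<lambda>x. wave \<tau> x * (h x * conv (expker (\<delta> n)) f x)) \<in> borel_measurable lborel" for n by measurable
  qed
  \<comment> \<open>The defect of the claimed identity when both primitives are regularized.\<close>
  define L where "L n = ?g \<tau> * (fourier_integral (\<lambda>x. u x * Zn n x) \<tau> + fourier_integral (\<lambda>x. w x * Vn n x) \<tau>)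
     - (fourier_integral (\<lambda>x. \<beta> x * Zn n x) \<tau> + fourier_integral (\<lambda>x. \<gamma> x * Vn n x) \<tau>)
     + (fourier_integral (\<lambda>x. u x * ift' \<alpha> x) \<tau> + fourier_integral (\<lambda>x. w x * ift' a x) \<tau>)" for n
  have L_lim: "L \<longlonglongrightarrow> ?g \<tau> * (fourier_integral (\<lambda>x. u x * Z x) \<tau> + fourier_integral (\<lambda>x. w x * V x) \<tau>)
     - (fourier_integral (\<lambda>x. \<beta> x * Z x) \<tau> + fourier_integral (\<lambda>x. \<gamma> x * V x) \<tau>)
     + (fourier_integral (\<lambda>x. u x * ift' \<alpha> x) \<tau> + fourier_integral (\<lambda>x. w x * ift' a x) \<tau>)"
    unfolding L_def V_def Z_def Vn_def Zn_def
    by (intro tendsto_add tendsto_diff tendsto_mult tendsto_const lim_mult ui wi bi ci)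
  \<comment> \<open>The symbol of the defect: \<open>L n\<close> becomes the integral of
    \<open>m n s\<close> against a (\<tau> - s) \<alpha> s, once every product is written as a
    convolution.\<close>
  define m where "m n s = ?g s * (?g \<tau> - ?g (\<tau> - s)) * P n s + ?g (\<tau> - s) * (?g \<tau> - ?g s) * P n (\<tau> - s) + \<i> * of_real \<tau>" for n s
  have int_bdd: "integrable lborel (\<lambda>s. fourier_integral f (\<tau> - s) * y s)"
      "integrable lborel (\<lambda>s. fourier_integral f s * y (\<tau> - s))"
    if f: "integrable lborel f" and y: "integrable lborel y" for f y
  proof -
    show 1: "integrable lborel (\<lambda>s. fourier_integral f (\<tau> - s) * y s)"
      using measurable_fourier_integral[OF f] norm_fourier_integral_le[of f]
      by (intro integrable_bounded_mult[OF y, where B="LINT t|lborel. norm (f t)"]) auto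
    show "integrable lborel (\<lambda>s. fourier_integral f s * y (\<tau> - s))"
      using integrable_reflect_shift[OF 1, of \<tau>] by simp
  qed
  have mult1: "fourier_integral (\<lambda>x. ift y x * f x) \<tau> = cF * (LINT s|lborel. fourier_integral f (\<tau> - s) * y s)"
    and mult2: "fourier_integral (\<lambda>x. ift y x * f x) \<tau> = cF * (LINT s|lborel. fourier_integral f s * y (\<tau> - s))"
    if f: "integrable lborel f" and y: "integrable lborel y" for f y
  proof -
    show 1: "fourier_integral (\<lambda>x. ift y x * f x) \<tau> = cF * (LINT s|lborel. fourier_integral f (\<tau> - s) * y s)"
      using fourier_integral_mult_ift[OF f y] by (simp add: mult.commute)
    show "fourier_integral (\<lambda>x. ift y x * f x) \<tau> = cF * (LINT s|lborel. fourier_integral f s * y (\<tau> - s))"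
      unfolding 1 by (subst integral_reflect_shift[symmetric, of _ \<tau>]) simp
  qed
  have L_eq: "L n = cF * (LINT s|lborel. m n s * (a (\<tau> - s) * \<alpha> s))" for n
  proof -
    have e1: "fourier_integral (\<lambda>x. u x * Zn n x) \<tau> = cF * (LINT s|lborel. P n s * (?g s * \<alpha> s) * a (\<tau> - s))"
      and i1: "integrable lborel (\<lambda>s. P n s * (?g s * \<alpha> s) * a (\<tau> - s))"
      using mult2[OF Zi[of n] ai(1)] int_bdd(2)[OF Zi[of n] ai(1)] by (simp_all add: u_def FZ)
    have e2: "fourier_integral (\<lambda>x. w x * Vn n x) \<tau> = cF * (LINT s|lborel. P n (\<tau> - s) * (?g (\<tau> - s) * a (\<tau> - s)) * \<alpha> s)"
      and i2: "integrable lborel (\<lambda>s. P n (\<tau> - s) * (?g (\<tau> - s) * a (\<tau> - s)) * \<alpha> s)"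
      using mult1[OF Vi[of n] ali(1)] int_bdd(1)[OF Vi[of n] ali(1)] by (simp_all add: w_def FV)
    have e3: "fourier_integral (\<lambda>x. \<beta> x * Zn n x) \<tau> = cF * (LINT s|lborel. P n s * (?g s * \<alpha> s) * (?g (\<tau> - s) * a (\<tau> - s)))"
      and i3: "integrable lborel (\<lambda>s. P n s * (?g s * \<alpha> s) * (?g (\<tau> - s) * a (\<tau> - s)))"
      using mult2[OF Zi[of n] ai(3)] int_bdd(2)[OF Zi[of n] ai(3)] by (simp_all add: b[symmetric] FZ)
    have e4: "fourier_integral (\<lambda>x. \<gamma> x * Vn n x) \<tau> = cF * (LINT s|lborel. P n (\<tau> - s) * (?g (\<tau> - s) * a (\<tau> - s)) * (?g s * \<alpha> s))"
      and i4: "integrable lborel (\<lambda>s. P n (\<tau> - s) * (?g (\<tau> - s) * a (\<tau> - s)) * (?g s * \<alpha> s))"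
      using mult1[OF Vi[of n] ali(3)] int_bdd(1)[OF Vi[of n] ali(3)] by (simp_all add: c[symmetric] FV)
    have e5: "fourier_integral (\<lambda>x. u x * ift' \<alpha> x) \<tau> = cF * (LINT s|lborel. a (\<tau> - s) * (\<i> * of_real s * \<alpha> s))"
      and i5: "integrable lborel (\<lambda>s. a (\<tau> - s) * (\<i> * of_real s * \<alpha> s))"
      using mult1[OF ui ali(2)] int_bdd(1)[OF ui ali(2)] by (simp_all add: ift'_def Fu mult.commute)
    have e6: "fourier_integral (\<lambda>x. w x * ift' a x) \<tau> = cF * (LINT s|lborel. \<alpha> s * (\<i> * of_real (\<tau> - s) * a (\<tau> - s)))"
      and i6: "integrable lborel (\<lambda>s. \<alpha> s * (\<i> * of_real (\<tau> - s) * a (\<tau> - s)))"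
      using mult2[OF wi ai(2)] int_bdd(2)[OF wi ai(2)] by (simp_all add: ift'_def Fw mult.commute)
    have pt: "m n s * (a (\<tau> - s) * \<alpha> s) = ?g \<tau> * (P n s * (?g s * \<alpha> s) * a (\<tau> - s) + P n (\<tau> - s) * (?g (\<tau> - s) * a (\<tau> - s)) * \<alpha> s)
        - (P n s * (?g s * \<alpha> s) * (?g (\<tau> - s) * a (\<tau> - s)) + P n (\<tau> - s) * (?g (\<tau> - s) * a (\<tau> - s)) * (?g s * \<alpha> s))
        + (a (\<tau> - s) * (\<i> * of_real s * \<alpha> s) + \<alpha> s * (\<i> * of_real (\<tau> - s) * a (\<tau> - s)))" for s
      by (simp add: m_def algebra_simps)
    show ?thesis
      unfolding pt L_def e1 e2 e3 e4 e5 e6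
      by (subst Bochner_Integration.integral_add Bochner_Integration.integral_diff integral_mult_right_zero;
          (intro Bochner_Integration.integrable_add Bochner_Integration.integrable_diff integrable_mult_right i1 i2 i3 i4 i5 i6)?)+
         (simp add: algebra_simps)
  qed
  define D where "D = 2 * (2 * tau_coth \<tau> / \<bar>\<tau>\<bar> + 1) + \<bar>\<tau>\<bar>"
  have int0: "(\<lambda>n. LINT s|lborel. m n s * (a (\<tau> - s) * \<alpha> s)) \<longlonglongrightarrow> (LINT s|(lborel::real measure). 0)"
  proof (rule integral_dominated_convergence)
    have d3: "decays (Suc 2) a" "decays (Suc 2) \<alpha>" using na nal by (auto simp: rapid_def intro: decays_mono)
    define A where "A s = of_real (1 + \<bar>s\<bar>) * a s" for s
    define B where "B s = of_real (1 + \<bar>s\<bar>) * \<alpha> s" for s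
    have dA: "decays 2 A" and dB: "decays 2 B"
      unfolding A_def B_def by (intro decays_mult_linear d3; simp del: of_real_add)+
    have [measurable]: "A \<in> borel_measurable borel" "B \<in> borel_measurable borel"
      unfolding A_def B_def by measurable
    have iB: "integrable lborel B" by (rule decays_integrable[OF dB]) measurable
    have "decays 0 A" using dA by (rule decays_mono) simp
    then obtain C where C: "\<And>s. norm (A s) \<le> C" by (auto simp: decays_def)
    have iAB: "integrable lborel (\<lambda>s. A (\<tau> - s) * B s)"
      by (rule integrable_bounded_mult[OF iB _ C]) measurable
    show "integrable lborel (\<lambda>s. D * norm (A (\<tau> - s) * B s))"
      by (intro integrable_mult_right integrable_norm iAB)
    have ne: "AE s in lborel. s \<noteq> 0 \<and> \<tau> - s \<noteq> 0"
      using AE_lborel_singleton[of "0::real"] AE_lborel_singleton[of \<tau>] by eventually_elim auto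
    show "AE s in lborel. (\<lambda>n. m n s * (a (\<tau> - s) * \<alpha> s)) \<longlonglongrightarrow> 0"
      using ne
    proof eventually_elim
      case (elim s)
      have Plim: "(\<lambda>n. P n r) \<longlonglongrightarrow> 1 / (\<i> * of_real r)" if "r \<noteq> 0" for r
      proof -
        have "\<delta> \<longlonglongrightarrow> 0" unfolding \<delta>_def by (rule LIMSEQ_Suc[OF lim_1_over_n])
        then have "(\<lambda>n. P n r) \<longlonglongrightarrow> 1 / (of_real 0 + \<i> * of_real r)"
          unfolding P_def using that by (intro tendsto_intros) auto
        then show ?thesis by simp
      qed
      have "(\<lambda>n. m n s) \<longlonglongrightarrow> ?g s * (?g \<tau> - ?g (\<tau> - s)) * (1 / (\<i> * of_real s)) + ?g (\<tau> - s) * (?g \<tau> - ?g s) * (1 / (\<i> * of_real (\<tau> - s))) + \<i> * of_real \<tau>"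
        unfolding m_def using elim by (intro tendsto_intros Plim) auto
      also have "?g s * (?g \<tau> - ?g (\<tau> - s)) * (1 / (\<i> * of_real s)) + ?g (\<tau> - s) * (?g \<tau> - ?g s) * (1 / (\<i> * of_real (\<tau> - s))) + \<i> * of_real \<tau> = 0"
        using multiplier_limit[of s "\<tau> - s"] elim by simp
      finally show ?case by (rule tendsto_mult_left_zero)
    qed
    show "AE s in lborel. norm (m n s * (a (\<tau> - s) * \<alpha> s)) \<le> D * norm (A (\<tau> - s) * B s)" for n
      using ne
    proof eventually_elim
      case (elim s)
      let ?W = "(1 + \<bar>\<tau> - s\<bar>) * (1 + \<bar>s\<bar>)"
      have n1: "norm (?g s * (?g \<tau> - ?g (\<tau> - s)) * P n s) \<le> (2 * tau_coth \<tau> / \<bar>\<tau>\<bar> + 1) * ?W"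
        using multiplier_bound[of "\<tau> - s" s "\<delta> n"] elim \<tau> by (simp add: P_def)
      have n2: "norm (?g (\<tau> - s) * (?g \<tau> - ?g s) * P n (\<tau> - s)) \<le> (2 * tau_coth \<tau> / \<bar>\<tau>\<bar> + 1) * ?W"
        using multiplier_bound[of s "\<tau> - s" "\<delta> n"] elim \<tau> by (simp add: P_def mult.commute)
      have "1 * 1 \<le> ?W" by (intro mult_mono) auto
      then have n3: "norm (\<i> * complex_of_real \<tau>) \<le> \<bar>\<tau>\<bar> * ?W"
        using mult_left_mono[of 1 ?W "\<bar>\<tau>\<bar>"] by (simp add: norm_mult)
      have "norm (m n s) \<le> norm (?g s * (?g \<tau> - ?g (\<tau> - s)) * P n s) + norm (?g (\<tau> - s) * (?g \<tau> - ?g s) * P n (\<tau> - s)) + norm (\<i> * complex_of_real \<tau>)"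
        unfolding m_def by (intro order_trans[OF norm_triangle_ineq] add_mono order_refl norm_triangle_ineq)
      also have "\<dots> \<le> D * ?W"
        unfolding D_def using n1 n2 n3 by (simp add: ring_distribs)
      finally have "norm (m n s) * norm (a (\<tau> - s) * \<alpha> s) \<le> D * ?W * norm (a (\<tau> - s) * \<alpha> s)"
        by (rule mult_right_mono) simp
      also have "\<dots> = D * norm (A (\<tau> - s) * B s)"
        by (simp add: A_def B_def norm_mult del: of_real_add)
      finally show ?case by (simp add: norm_mult)
    qed
    show "(\<lambda>s. m n s * (a (\<tau> - s) * \<alpha> s)) \<in> borel_measurable lborel" for n
      unfolding m_def P_def by measurable
  qed simp
  have "L \<longlonglongrightarrow> 0"
    using tendsto_mult_left[OF int0, of cF] by (simp add: L_eq[abs_def])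
  from LIMSEQ_unique[OF L_lim this] show ?thesis
    by (simp add: mult.commute[of "\<beta> _"] mult.commute[of "\<gamma> _"] algebra_simps)
qed

lemma isCont_primit:
  "integrable lborel \<beta> \<Longrightarrow> (\<And>x. isCont \<beta> x) \<Longrightarrow> isCont (primit \<beta>) x"
  using has_vector_derivative_continuous[OF primit_has_derivative] .

lemma norm_primit_le: "integrable lborel \<beta> \<Longrightarrow> norm (primit \<beta> x) \<le> (LINT y|lborel. norm (\<beta> y))"
  unfolding primit_def by (rule norm_conv_expker_le) auto

lemma isCont_imp_borel: "(\<And>x. isCont f x) \<Longrightarrow> (f :: real \<Rightarrow> complex) \<in> borel_measurable borel"
  by (rule borel_measurable_continuous_onI) (simp add: continuous_at_imp_continuous_on)

text \<open>In differential form D (u Z + w V) = Z \<beta> + V \<gamma> - (u w)'. The Fourier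
  identity leaves out frequency 0, which continuity of the transforms recovers; injectivity gives
  equality a.e. and continuity of both sides gives it everywhere.\<close>

lemma dtn_bilinear:
  assumes aB: "dtn_pair a \<beta>" and alC: "dtn_pair \<alpha> \<gamma>"
  defines "u \<equiv> ift a" and "w \<equiv> ift \<alpha>" and "V \<equiv> primit \<beta>" and "Z \<equiv> primit \<gamma>"
  shows "u x * Z x + w x * V x = gconv (\<lambda>x. Z x * \<beta> x + V x * \<gamma> x - (u x * ift' \<alpha> x + w x * ift' a x)) x"
proof -
  have na: "rapid a" and bi: "integrable lborel \<beta>" and b: "\<beta> = ift (\<lambda>\<tau>. of_real (tau_coth \<tau>) * a \<tau>)"
    using aB by (auto simp: dtn_pair_def)
  have nal: "rapid \<alpha>" and ci: "integrable lborel \<gamma>" and c: "\<gamma> = ift (\<lambda>\<tau>. of_real (tau_coth \<tau>) * \<alpha> \<tau>)"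
    using alC by (auto simp: dtn_pair_def)
  have ui: "integrable lborel u" and wi: "integrable lborel w" using na nal by (auto simp: rapid_def u_def w_def)
  note ai = rapid_integrable[OF na] and ali = rapid_integrable[OF nal]
  have uc: "isCont u x" and wc: "isCont w x" and bc: "isCont \<beta> x" and cc: "isCont \<gamma> x"
    and u'c: "isCont (ift' a) x" and w'c: "isCont (ift' \<alpha>) x" for x
    unfolding u_def w_def b c ift'_def by (intro isCont_ift ai ali)+
  have Vc: "isCont V x" and Zc: "isCont Z x" for x
    unfolding V_def Z_def by (intro isCont_primit bi ci bc cc)+
  have bnd: "\<exists>B. \<forall>x. norm (u x) \<le> B" "\<exists>B. \<forall>x. norm (w x) \<le> B" "\<exists>B. \<forall>x. norm (\<beta> x) \<le> B" "\<exists>B. \<forall>x. norm (\<gamma> x) \<le> B"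
    "\<exists>B. \<forall>x. norm (ift' a x) \<le> B" "\<exists>B. \<forall>x. norm (ift' \<alpha> x) \<le> B" "\<exists>B. \<forall>x. norm (V x) \<le> B" "\<exists>B. \<forall>x. norm (Z x) \<le> B"
    unfolding u_def w_def b c ift'_def V_def Z_def using norm_ift_le norm_primit_le[OF bi[unfolded b]] norm_primit_le[OF ci[unfolded c]]
    by meson+
  have int: "integrable lborel (\<lambda>x. f x * g x)"
    if "integrable lborel g" "\<exists>B. \<forall>x. norm (f x) \<le> B" "\<And>x. isCont f x" for f g :: "real \<Rightarrow> complex"
    using that isCont_imp_borel[of f] by (auto intro: integrable_bounded_mult)
  let ?h = "\<lambda>x. Z x * \<beta> x + V x * \<gamma> x - (u x * ift' \<alpha> x + w x * ift' a x)"
  let ?f = "\<lambda>x. u x * Z x + w x * V x"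
  have i1: "integrable lborel (\<lambda>x. u x * Z x)" "integrable lborel (\<lambda>x. w x * V x)"
    using int[OF ui bnd(8) Zc] int[OF wi bnd(7) Vc] by (simp_all add: mult.commute)
  have i2: "integrable lborel (\<lambda>x. Z x * \<beta> x)" "integrable lborel (\<lambda>x. V x * \<gamma> x)"
    by (rule int[OF bi bnd(8) Zc], rule int[OF ci bnd(7) Vc])
  have i3: "integrable lborel (\<lambda>x. u x * ift' \<alpha> x)" "integrable lborel (\<lambda>x. w x * ift' a x)"
    using int[OF ui bnd(6) w'c] int[OF wi bnd(5) u'c] by (simp_all add: mult.commute)
  have hi: "integrable lborel ?h" by (intro Bochner_Integration.integrable_add Bochner_Integration.integrable_diff i2 i3)
  have fi: "integrable lborel ?f" by (intro Bochner_Integration.integrable_add i1)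
  have gi: "integrable lborel (gconv ?h)" by (rule integrable_gconv[OF hi])
  have F_eq: "fourier_integral ?f \<tau> = fourier_integral (gconv ?h) \<tau>" if "\<tau> \<noteq> 0" for \<tau>
  proof -
    have "of_real (tau_coth \<tau>) * fourier_integral ?f \<tau> = fourier_integral ?h \<tau>"
      using dtn_bilinear_fourier[OF aB alC that] i1 i2 i3
      by (simp add: u_def w_def V_def Z_def fourier_integral_add fourier_integral_diff)
    then have "fourier_integral ?f \<tau> * of_real (tau_coth \<tau>) = fourier_integral ?h \<tau>"
      by (subst mult.commute)
    moreover have "complex_of_real (tau_coth \<tau>) \<noteq> 0" using tau_coth_lower(2)[of \<tau>] by simp
    ultimately show ?thesis
      unfolding fourier_integral_gconv[OF hi] by (intro nonzero_eq_divide_eq[THEN iffD2])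
  qed
  have F_eq0: "fourier_integral ?f \<tau> = fourier_integral (gconv ?h) \<tau>" for \<tau>
  proof (rule continuous_eq_of_AE)
    show "AE \<tau> in lborel. fourier_integral ?f \<tau> = fourier_integral (gconv ?h) \<tau>"
      using AE_lborel_singleton[of "0::real"] by eventually_elim (rule F_eq)
  qed (rule isCont_fourier_integral[OF fi], rule isCont_fourier_integral[OF gi])
  have "AE x in lborel. ?f x - gconv ?h x = 0"
  proof (rule fourier_integral_inject)
    show "integrable lborel (\<lambda>x. ?f x - gconv ?h x)" using fi gi by (rule Bochner_Integration.integrable_diff)
    show "fourier_integral (\<lambda>x. ?f x - gconv ?h x) \<tau> = 0" for \<tau>
      by (simp only: fourier_integral_diff[OF fi gi] F_eq0) simp
  qed
  then have ae: "AE x in lborel. ?f x = gconv ?h x" by simp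
  obtain B where B: "norm (?h x) \<le> B" for x
  proof -
    obtain B1 B2 B3 B4 B5 B6 B7 B8 where bb: "\<forall>x. norm (u x) \<le> B1" "\<forall>x. norm (w x) \<le> B2" "\<forall>x. norm (\<beta> x) \<le> B3" "\<forall>x. norm (\<gamma> x) \<le> B4"
      "\<forall>x. norm (ift' a x) \<le> B5" "\<forall>x. norm (ift' \<alpha> x) \<le> B6" "\<forall>x. norm (V x) \<le> B7" "\<forall>x. norm (Z x) \<le> B8"
      using bnd by blast
    have mm: "norm (p * q) \<le> P * R" if "norm p \<le> P" "norm q \<le> R" for p q :: complex and P R
      unfolding norm_mult using that by (intro mult_mono) (auto intro: order_trans[OF norm_ge_zero])
    have "norm (?h x) \<le> (B8 * B3 + B7 * B4) + (B1 * B6 + B2 * B5)" for x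
      by (intro order_trans[OF norm_triangle_ineq4] order_trans[OF norm_triangle_ineq] add_mono mm bb[rule_format])
    then show ?thesis using that by blast
  qed
  have "?f x = gconv ?h x" for x
  proof (rule continuous_eq_of_AE[OF _ _ ae])
    show "isCont ?f x" for x by (intro continuous_intros uc wc Vc Zc)
    show "isCont (gconv ?h) x" for x
      by (intro isCont_gconv[OF _ B] continuous_intros uc wc Vc Zc bc cc u'c w'c)
  qed
  then show ?thesis .
qed

text \<open>D commutes with d/dx because both are multipliers on \<open>a\<close>, and
  \<open>gconv\<close> divides by the symbol.\<close>

lemma dtn_derivative:
  assumes "dtn_pair a \<beta>"
  shows "(\<beta> has_vector_derivative ift' (\<lambda>\<tau>. of_real (tau_coth \<tau>) * a \<tau>) x) (at x)"
    and "ift' a x = gconv (ift' (\<lambda>\<tau>. of_real (tau_coth \<tau>) * a \<tau>)) x"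
    and "ift a x = gconv \<beta> x"
proof -
  have na: "rapid a" and b: "\<beta> = ift (\<lambda>\<tau>. of_real (tau_coth \<tau>) * a \<tau>)"
    using assms by (auto simp: dtn_pair_def)
  have nz: "complex_of_real (tau_coth \<tau>) \<noteq> 0" for \<tau> using tau_coth_lower(2)[of \<tau>] by simp
  show "(\<beta> has_vector_derivative ift' (\<lambda>\<tau>. of_real (tau_coth \<tau>) * a \<tau>) x) (at x)"
    unfolding b ift'_def by (intro ift_has_vector_derivative rapid_integrable na)
  show "ift' a x = gconv (ift' (\<lambda>\<tau>. of_real (tau_coth \<tau>) * a \<tau>)) x"
  proof -
    have "(\<lambda>s. \<i> * of_real s * (of_real (tau_coth s) * a s) / of_real (tau_coth s)) = (\<lambda>s. \<i> * of_real s * a s)"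
      using nz by (simp add: fun_eq_iff)
    then show ?thesis unfolding ift'_def gconv_ift[OF rapid_integrable(4)[OF na]] by (simp only:)
  qed
  show "ift a x = gconv \<beta> x"
    unfolding b gconv_ift[OF rapid_integrable(3)[OF na]] using nz by simp
qed

section \<open>Simplicity of the ground state\<close>

definition rgconv :: "(real \<Rightarrow> real) \<Rightarrow> real \<Rightarrow> real" where
  "rgconv h x = (LINT y|lborel. green (x - y) * h y)"

lemma gconv_of_real: "gconv (\<lambda>y. of_real (h y)) x = of_real (rgconv h x)"
  unfolding gconv_def conv_reflect rgconv_def of_real_mult[symmetric] integral_complex_of_real ..

lemma Re_gconv:
  assumes "\<And>x. isCont h x" "\<And>x. norm (h x) \<le> B"
  shows "Re (gconv h x) = rgconv (\<lambda>y. Re (h y)) x" "Im (gconv h x) = rgconv (\<lambda>y. Im (h y)) x"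
proof -
  have [measurable]: "h \<in> borel_measurable borel" by (rule isCont_imp_borel[OF assms(1)])
  have "integrable lborel (\<lambda>y. h y * complex_of_real (green (x - y)))"
    using integrable_reflect_shift[OF integrable_green, of x] assms(2) by (intro integrable_bounded_mult) auto
  then have i: "integrable lborel (\<lambda>y. complex_of_real (green (x - y)) * h y)" by (simp add: mult.commute)
  show "Re (gconv h x) = rgconv (\<lambda>y. Re (h y)) x" "Im (gconv h x) = rgconv (\<lambda>y. Im (h y)) x"
    unfolding gconv_def conv_reflect rgconv_def using integral_Re[OF i] integral_Im[OF i] by simp_all
qed

lemma integrable_green_bounded:
  assumes "h \<in> borel_measurable borel" "\<And>x. \<bar>h x\<bar> \<le> B"
  shows "integrable lborel (\<lambda>y. green (x - y) * h y)"
  using integrable_bounded_mult[OF integrable_reflect_shift[OF integrable_green, of x], of h B] assms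
  by (simp add: mult.commute)

lemma AE_green_pos: "AE y in lborel. green (x - y) > 0"
  using AE_lborel_singleton[of x] by eventually_elim (simp add: green_pos)

text \<open>The strong maximum principle in integral form, from the strict positivity of
  \<open>green\<close> off 0.\<close>

lemma rgconv_eq_0:
  assumes "integrable lborel (\<lambda>y. green (x - y) * h y)" "AE y in lborel. h y \<ge> 0" "rgconv h x = 0"
  shows "AE y in lborel. h y = 0"
proof -
  have "AE y in lborel. green (x - y) * h y = 0"
  proof -
    have "AE y in lborel. 0 \<le> green (x - y) * h y"
      using assms(2) by eventually_elim (simp add: green_nonneg)
    from integral_nonneg_eq_0_iff_AE[OF assms(1) this] assms(3) show ?thesis
      by (simp add: rgconv_def)
  qed
  then show ?thesis using AE_green_pos[of x] by eventually_elim auto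
qed

text \<open>\<open>Q_eq\<close> says that Q is a positive fixed point of the linear map sending p to
  green convolved with Q p, an operator with positive kernel that is symmetric for the weight Q.
  This is the Perron-Frobenius setting.\<close>

locale ground_state =
  fixes Q :: "real \<Rightarrow> real" and B :: real
  assumes Q_meas [measurable]: "Q \<in> borel_measurable borel"
    and Q_pos: "\<And>x. Q x > 0" and Q_le: "\<And>x. Q x \<le> B"
    and Q_sq: "integrable lborel (\<lambda>x. (Q x)\<^sup>2)"
    and Q_eq: "\<And>x. Q x = rgconv (\<lambda>y. (Q y)\<^sup>2) x"
begin

lemma B_pos: "B > 0" using Q_pos[of 0] Q_le[of 0] by linarith

text \<open>Pairing \<open>\<bar>p\<bar> \<le> green * (Q \<bar>p\<bar>)\<close> with \<open>Q\<^sup>2\<close> yields equality almost everywhere, so \<open>p\<close> has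
  constant sign; a solution of constant sign with a zero vanishes identically.\<close>

lemma vanishing_solution:
  assumes pm [measurable]: "p \<in> borel_measurable borel" and pC: "\<And>x. \<bar>p x\<bar> \<le> C"
    and p: "\<And>x. p x = rgconv (\<lambda>y. Q y * p y) x" and p0: "p z = 0"
  shows "p x = 0"
proof -
  define P where "P = rgconv (\<lambda>y. Q y * \<bar>p y\<bar>)"
  have bd: "\<bar>Q y * p y\<bar> \<le> B * C" "\<bar>Q y * \<bar>p y\<bar>\<bar> \<le> B * C" for y
    using Q_le[of y] Q_pos[of y] pC[of y] B_pos by (auto simp: abs_mult intro!: mult_mono)
  have i1: "integrable lborel (\<lambda>y. green (x - y) * (Q y * p y))" for x
    by (rule integrable_green_bounded[OF _ bd(1)]) measurable
  have i2: "integrable lborel (\<lambda>y. green (x - y) * (Q y * \<bar>p y\<bar>))" for x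
    by (rule integrable_green_bounded[OF _ bd(2)]) measurable
  have Pp: "\<bar>p x\<bar> \<le> P x" for x
  proof -
    have "\<bar>p x\<bar> \<le> (LINT y|lborel. \<bar>green (x - y) * (Q y * p y)\<bar>)"
      unfolding p[of x] rgconv_def by (rule integral_abs_bound)
    also have "\<dots> = P x"
      unfolding P_def rgconv_def using green_nonneg Q_pos by (simp add: abs_mult less_imp_le)
    finally show ?thesis .
  qed
  have P_le: "P x \<le> B * C * integral\<^sup>L lborel green" for x
  proof -
    have "P x \<le> (LINT y|lborel. green (x - y) * (B * C))"
      unfolding P_def rgconv_def
    proof (rule integral_mono[OF i2])
      show "integrable lborel (\<lambda>y. green (x - y) * (B * C))"
        by (intro integrable_mult_left integrable_reflect_shift integrable_green)
      show "green (x - y) * (Q y * \<bar>p y\<bar>) \<le> green (x - y) * (B * C)" for y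
        using bd(2)[of y] green_nonneg by (intro mult_left_mono) auto
    qed
    then show ?thesis by (simp add: integral_reflect_shift[of green] mult.commute)
  qed
  have Pm [measurable]: "P \<in> borel_measurable borel"
    unfolding P_def rgconv_def by measurable
  have int_bd: "integrable lborel (\<lambda>x. (Q x)\<^sup>2 * f x)" if [measurable]: "f \<in> borel_measurable borel" and "\<And>x. \<bar>f x\<bar> \<le> K" for f K
    using integrable_bounded_mult[OF Q_sq, of f K] that by (simp add: mult.commute)
  have QP: "integrable lborel (\<lambda>x. (Q x)\<^sup>2 * P x)"
  proof (rule int_bd[OF Pm, where K="B * C * integral\<^sup>L lborel green"])
    show "\<bar>P x\<bar> \<le> B * C * integral\<^sup>L lborel green" for x
      using Pp[of x] P_le[of x] by linarith
  qed
  have Qp: "integrable lborel (\<lambda>x. (Q x)\<^sup>2 * \<bar>p x\<bar>)"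
    by (rule int_bd[where K=C]) (use pC in auto)
  let ?k = "\<lambda>x y. (Q x)\<^sup>2 * (green (x - y) * (Q y * \<bar>p y\<bar>))"
  have pair: "integrable (lborel \<Otimes>\<^sub>M lborel) (\<lambda>(x, y). ?k x y)"
  proof (rule lborel_pair.Fubini_integrable)
    have "(LINT y|lborel. norm (?k x y)) = (Q x)\<^sup>2 * P x" for x
    proof -
      have "norm (?k x y) = ?k x y" for y
        using green_nonneg Q_pos by (simp add: abs_mult less_imp_le)
      then show ?thesis by (simp add: P_def rgconv_def)
    qed
    then show "integrable lborel (\<lambda>x. LINT y|lborel. norm (case (x, y) of (x, y) \<Rightarrow> ?k x y))"
      using QP by simp
    show "AE x in lborel. integrable lborel (\<lambda>y. case (x, y) of (x, y) \<Rightarrow> ?k x y)"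
      using i2 by simp
  qed measurable
  have "(LINT x|lborel. (Q x)\<^sup>2 * P x) = (LINT x|lborel. LINT y|lborel. ?k x y)"
    by (simp add: P_def rgconv_def)
  also have "\<dots> = (LINT y|lborel. LINT x|lborel. ?k x y)"
    by (rule lborel_pair.Fubini_integral[OF pair, symmetric])
  also have "\<dots> = (LINT y|lborel. (Q y)\<^sup>2 * \<bar>p y\<bar>)"
  proof (rule Bochner_Integration.integral_cong[OF refl])
    fix y
    \<comment> \<open>Symmetry of \<open>green\<close> moves the convolution onto Q^2, where the
      equation for Q turns it into Q.\<close>
    have sym: "green (x - y) = green (y - x)" for x using green_uminus[of "x - y"] by simp
    have "(LINT x|lborel. ?k x y) = (LINT x|lborel. Q y * \<bar>p y\<bar> * (green (y - x) * (Q x)\<^sup>2))"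
      by (simp add: sym mult_ac)
    also have "\<dots> = Q y * \<bar>p y\<bar> * rgconv (\<lambda>x. (Q x)\<^sup>2) y"
      unfolding rgconv_def by (rule integral_mult_right_zero)
    also have "\<dots> = (Q y)\<^sup>2 * \<bar>p y\<bar>"
      using Q_eq[of y] by (simp add: power2_eq_square)
    finally show "(LINT x|lborel. ?k x y) = (Q y)\<^sup>2 * \<bar>p y\<bar>" .
  qed
  finally have "(LINT x|lborel. (Q x)\<^sup>2 * P x - (Q x)\<^sup>2 * \<bar>p x\<bar>) = 0"
    using QP Qp by simp
  moreover have "integrable lborel (\<lambda>x. (Q x)\<^sup>2 * P x - (Q x)\<^sup>2 * \<bar>p x\<bar>)"
    using QP Qp by (rule Bochner_Integration.integrable_diff)
  moreover have "(Q x)\<^sup>2 * P x - (Q x)\<^sup>2 * \<bar>p x\<bar> \<ge> 0" for x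
    using Pp[of x] by (simp add: mult_left_mono)
  ultimately have "AE x in lborel. (Q x)\<^sup>2 * P x - (Q x)\<^sup>2 * \<bar>p x\<bar> = 0"
    by (subst (asm) integral_nonneg_eq_0_iff_AE) auto
  then have "AE x in lborel. P x = \<bar>p x\<bar>"
  proof eventually_elim
    case (elim x)
    then show ?case using Q_pos[of x] by (simp flip: right_diff_distrib)
  qed
  \<comment> \<open>One point of equality is enough: there the convolution of the nonnegative
    function Q |p| - e Q p vanishes, so by the maximum principle p has the sign e a.e.\<close>
  then obtain x0 where x0: "P x0 = \<bar>p x0\<bar>"
    using eventually_happens[of "\<lambda>x. P x = \<bar>p x\<bar>" "ae_filter lborel"] by (auto simp: ae_filter_eq_bot_iff)
  define e :: real where "e = (if p x0 \<ge> 0 then 1 else -1)"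
  have e: "e = 1 \<or> e = -1" "\<bar>p x0\<bar> = e * p x0"
    by (auto simp: e_def)
  have "rgconv (\<lambda>y. Q y * \<bar>p y\<bar> - e * (Q y * p y)) x0 = P x0 - e * p x0"
    unfolding P_def p[of x0] rgconv_def
    using i1[of x0] i2[of x0] by (simp add: right_diff_distrib mult.left_commute[of _ e])
  then have z: "rgconv (\<lambda>y. Q y * \<bar>p y\<bar> - e * (Q y * p y)) x0 = 0" using x0 e by simp
  have "AE y in lborel. Q y * \<bar>p y\<bar> - e * (Q y * p y) = 0"
  proof (rule rgconv_eq_0[OF _ _ z])
    show "integrable lborel (\<lambda>y. green (x0 - y) * (Q y * \<bar>p y\<bar> - e * (Q y * p y)))"
      using i1[of x0] i2[of x0] by (simp add: right_diff_distrib mult.left_commute[of _ e])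
    have "Q y * \<bar>p y\<bar> - e * (Q y * p y) \<ge> 0" for y
    proof -
      have "e * p y \<le> \<bar>p y\<bar>" using e(1) by auto
      then have "Q y * (e * p y) \<le> Q y * \<bar>p y\<bar>" using Q_pos[of y] by (intro mult_left_mono) auto
      then show ?thesis by (simp add: mult.left_commute)
    qed
    then show "AE y in lborel. Q y * \<bar>p y\<bar> - e * (Q y * p y) \<ge> 0" by simp
  qed
  then have ep: "AE y in lborel. Q y * \<bar>p y\<bar> = e * (Q y * p y)" by simp
  \<comment> \<open>With constant sign, the zero of p at z is also a zero of the convolution of Q
    |p|, so p vanishes a.e.; the fixed point equation then gives 0 at every point.\<close>
  have "P z = (LINT y|lborel. green (z - y) * (e * (Q y * p y)))"
    unfolding P_def rgconv_def by (rule integral_cong_AE) (use ep in auto)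
  also have "\<dots> = e * p z"
    unfolding p[of z] rgconv_def by (simp add: mult.left_commute[of _ e])
  finally have "P z = 0" using p0 by simp
  then have "AE y in lborel. Q y * \<bar>p y\<bar> = 0"
    unfolding P_def using Q_pos by (intro rgconv_eq_0[OF i2]) (auto simp: less_imp_le)
  then have "AE y in lborel. green (x - y) * (Q y * p y) = 0"
    by eventually_elim auto
  then show ?thesis
    unfolding p[of x] rgconv_def by (rule integral_eq_zero_AE)
qed

text \<open>The multiple of Q to subtract is the one that creates a zero at the origin, possible
  since Q 0 > 0.\<close>

lemma simple_eigenvalue:
  assumes pm [measurable]: "p \<in> borel_measurable borel" and pC: "\<And>x. \<bar>p x\<bar> \<le> C"
    and p: "\<And>x. p x = rgconv (\<lambda>y. Q y * p y) x"
  shows "\<exists>\<kappa>. \<forall>x. p x = \<kappa> * Q x"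
proof -
  define \<kappa> where "\<kappa> = p 0 / Q 0"
  have "p x - \<kappa> * Q x = 0" for x
  proof (rule vanishing_solution[where C="C + \<bar>\<kappa>\<bar> * B" and z=0 and p="\<lambda>x. p x - \<kappa> * Q x"])
    show "\<bar>p x - \<kappa> * Q x\<bar> \<le> C + \<bar>\<kappa>\<bar> * B" for x
    proof -
      have "\<bar>\<kappa> * Q x\<bar> \<le> \<bar>\<kappa>\<bar> * B"
        unfolding abs_mult using Q_le[of x] Q_pos[of x] by (intro mult_left_mono) auto
      with pC[of x] show ?thesis by linarith
    qed
    have i1: "integrable lborel (\<lambda>y. green (x - y) * (Q y * p y))" for x
    proof (rule integrable_green_bounded[where B="B * C"])
      show "\<bar>Q y * p y\<bar> \<le> B * C" for y
        using Q_le[of y] Q_pos[of y] pC[of y] B_pos by (auto simp: abs_mult intro!: mult_mono)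
    qed measurable
    have i2: "integrable lborel (\<lambda>y. green (x - y) * (Q y)\<^sup>2)" for x
    proof (rule integrable_green_bounded[where B="B\<^sup>2"])
      show "\<bar>(Q y)\<^sup>2\<bar> \<le> B\<^sup>2" for y
        using Q_le[of y] Q_pos[of y] by (simp add: power_mono less_imp_le)
    qed measurable
    show "p x - \<kappa> * Q x = rgconv (\<lambda>y. Q y * (p y - \<kappa> * Q y)) x" for x
    proof -
      have "green (x - y) * (Q y * (p y - \<kappa> * Q y)) = green (x - y) * (Q y * p y) - \<kappa> * (green (x - y) * (Q y)\<^sup>2)" for y
        by (simp add: power2_eq_square algebra_simps)
      then have "rgconv (\<lambda>y. Q y * (p y - \<kappa> * Q y)) x = rgconv (\<lambda>y. Q y * p y) x - \<kappa> * rgconv (\<lambda>y. (Q y)\<^sup>2) x"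
        unfolding rgconv_def using i1[of x] i2[of x] by simp
      then show ?thesis using p[of x] Q_eq[of x] by simp
    qed
    show "p 0 - \<kappa> * Q 0 = 0" using Q_pos[of 0] by (simp add: \<kappa>_def)
  qed measurable
  then show ?thesis by (intro exI[of _ \<kappa>]) simp
qed

end

section \<open>The differential equations\<close>

text \<open>The function \<open>E = (Z + A) / Q\<close> with \<open>A\<^sup>2 = Q\<^sup>2 + Z\<^sup>2\<close> (a constant) satisfies \<open>E' = A E\<close>.\<close>

lemma soliton_ode:
  fixes Q Z :: "real \<Rightarrow> real"
  assumes Q: "\<And>x. Q x > 0" and dQ: "\<And>x. (Q has_real_derivative - Q x * Z x) (at x)"
    and dZ: "\<And>x. (Z has_real_derivative (Q x)\<^sup>2) (at x)"
  shows "\<exists>A>0. \<exists>\<alpha>. \<forall>x. Q x = A / cosh (A * (x - \<alpha>)) \<and> Z x = A * tanh (A * (x - \<alpha>))"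
proof -
  define A where "A = sqrt ((Q 0)\<^sup>2 + (Z 0)\<^sup>2)"
  have A: "A > 0" using Q[of 0] by (simp add: A_def add_pos_nonneg)
  have "((\<lambda>x. (Q x)\<^sup>2 + (Z x)\<^sup>2) has_real_derivative 0) (at x)" for x
    by (auto intro!: derivative_eq_intros dQ dZ simp: power2_eq_square algebra_simps)
  then have "(Q x)\<^sup>2 + (Z x)\<^sup>2 = (Q 0)\<^sup>2 + (Z 0)\<^sup>2" for x
    using DERIV_isconst_all by blast
  then have QZ: "(Q x)\<^sup>2 + (Z x)\<^sup>2 = A\<^sup>2" for x by (simp add: A_def)
  define E where "E x = (Z x + A) / Q x" for x
  have dE: "(E has_real_derivative A * E x) (at x)" for x
  proof -
    have "(E has_real_derivative ((Q x)\<^sup>2 * Q x - (Z x + A) * (- Q x * Z x)) / (Q x * Q x)) (at x)"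
      unfolding E_def using Q[of x] by (auto intro!: derivative_eq_intros dQ dZ)
    also have "((Q x)\<^sup>2 * Q x - (Z x + A) * (- Q x * Z x)) / (Q x * Q x) = ((Q x)\<^sup>2 + (Z x)\<^sup>2 + A * Z x) / Q x"
      using Q[of x] by (simp add: field_simps power2_eq_square)
    also have "\<dots> = A * E x" unfolding QZ by (simp add: E_def power2_eq_square algebra_simps add_divide_distrib)
    finally show ?thesis .
  qed
  have "((\<lambda>x. E x * exp (- (A * x))) has_real_derivative 0) (at x)" for x
    by (auto intro!: derivative_eq_intros dE)
  then have e: "E x * exp (- (A * x)) = E 0 * exp (- (A * 0))" for x
    using DERIV_isconst_all by blast
  have Ex: "E x = E 0 * exp (A * x)" for x
  proof -
    have "E x = E x * exp (- (A * x)) * exp (A * x)" by (simp add: exp_minus)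
    then show ?thesis by (simp only: e[of x]) simp
  qed
  have E0: "E 0 > 0"
  proof -
    have "(Q 0)\<^sup>2 > 0" using Q[of 0] by simp
    then have "\<bar>Z 0\<bar>\<^sup>2 < A\<^sup>2" unfolding power2_abs using QZ[of 0] by linarith
    then have "\<bar>Z 0\<bar> < A" using A by (rule power2_less_imp_less[OF _ less_imp_le])
    then show ?thesis using Q[of 0] by (simp add: E_def)
  qed
  define \<alpha> where "\<alpha> = - ln (E 0) / A"
  have Eexp: "E x = exp (A * (x - \<alpha>))" for x
  proof -
    have "A * (x - \<alpha>) = A * x + ln (E 0)" using A by (simp add: \<alpha>_def field_simps)
    then show ?thesis using E0 Ex[of x] by (simp add: exp_add mult.commute)
  qed
  \<comment> \<open>By the conserved quantity this quotient is 1/E; half the sum and half the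
    difference with E are A/Q and Z/Q, that is, cosh and sinh.\<close>
  have inv: "(A - Z x) / Q x = exp (- (A * (x - \<alpha>)))" for x
  proof -
    have "(A - Z x) * (Z x + A) = (Q x)\<^sup>2" using QZ[of x] by (simp add: power2_eq_square algebra_simps)
    then have "E x * ((A - Z x) / Q x) = 1" using Q[of x] by (simp add: E_def power2_eq_square mult.commute)
    then show ?thesis unfolding Eexp exp_minus by (rule inverse_unique[symmetric])
  qed
  have "Q x = A / cosh (A * (x - \<alpha>)) \<and> Z x = A * tanh (A * (x - \<alpha>))" for x
  proof -
    let ?y = "A * (x - \<alpha>)"
    have "2 * A / Q x = exp ?y + exp (- ?y)" "2 * Z x / Q x = exp ?y - exp (- ?y)"
      unfolding Eexp[symmetric] inv[symmetric] using Q[of x] by (simp_all add: E_def field_simps)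
    then have c: "A / Q x = cosh ?y" and s: "Z x / Q x = sinh ?y"
      by (simp_all add: cosh_def sinh_def mult.commute)
    have "Q x = A / cosh ?y" unfolding c[symmetric] using A Q[of x] by simp
    moreover have "Z x = A * tanh ?y" unfolding tanh_def c[symmetric] s[symmetric] using A Q[of x] by simp
    ultimately show ?thesis by simp
  qed
  with A show ?thesis by blast
qed

text \<open>The system is the linearization of Q' = - Q Z, Z' = Q^2 at Q = 1/cosh, Z = tanh. The
  constant k is the linearization of the conserved (Q^2 + Z^2)/2; eliminating \<psi> with it leaves
  a scalar equation for \<zeta>. In the solution k belongs to changes of scale and m to
  translations.\<close>

lemma linearized_ode:
  fixes \<psi> \<zeta> :: "real \<Rightarrow> real" and \<alpha> :: real
  assumes dp: "\<And>x. (\<psi> has_real_derivative - tanh (x - \<alpha>) * \<psi> x - \<zeta> x / cosh (x - \<alpha>)) (at x)"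
    and dz: "\<And>x. (\<zeta> has_real_derivative 2 * \<psi> x / cosh (x - \<alpha>)) (at x)"
  shows "\<exists>k m. \<forall>x. \<psi> x = k * (1 / cosh (x - \<alpha>) - (x - \<alpha>) * sinh (x - \<alpha>) / (cosh (x - \<alpha>))\<^sup>2) - m * (sinh (x - \<alpha>) / (cosh (x - \<alpha>))\<^sup>2)"
proof -
  let ?c = "\<lambda>x. cosh (x - \<alpha>)" and ?s = "\<lambda>x. sinh (x - \<alpha>)"
  have cp: "?c x > 0" for x by simp
  have cs: "(?c x)\<^sup>2 = 1 + (?s x)\<^sup>2" for x by (simp add: cosh_square_eq)
  have ts: "tanh (x - \<alpha>) = ?s x / ?c x" for x by (simp add: tanh_def)
  have d1: "((\<lambda>x. \<psi> x / ?c x + ?s x / ?c x * \<zeta> x) has_real_derivative 0) (at x)" for x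
  proof -
    have "((\<lambda>x. \<psi> x / ?c x + ?s x / ?c x * \<zeta> x) has_real_derivative
       ((- tanh (x - \<alpha>) * \<psi> x - \<zeta> x / ?c x) * ?c x - \<psi> x * ?s x) / (?c x * ?c x)
       + (((?c x * ?c x - ?s x * ?s x) / (?c x * ?c x)) * \<zeta> x + ?s x / ?c x * (2 * \<psi> x / ?c x))) (at x)"
    proof -
      have "((\<lambda>x. ?s x / ?c x) has_real_derivative (?c x * ?c x - ?s x * ?s x) / (?c x * ?c x)) (at x)"
        "((\<lambda>x. \<psi> x / ?c x) has_real_derivative ((- tanh (x - \<alpha>) * \<psi> x - \<zeta> x / ?c x) * ?c x - \<psi> x * ?s x) / (?c x * ?c x)) (at x)"
        using cp[of x] by (auto intro!: derivative_eq_intros dp)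
      from DERIV_add[OF this(2) DERIV_mult[OF this(1) dz]] show ?thesis by (simp add: mult.commute add.commute)
    qed
    also have "((- tanh (x - \<alpha>) * \<psi> x - \<zeta> x / ?c x) * ?c x - \<psi> x * ?s x) / (?c x * ?c x)
       + (((?c x * ?c x - ?s x * ?s x) / (?c x * ?c x)) * \<zeta> x + ?s x / ?c x * (2 * \<psi> x / ?c x)) = 0"
    proof -
      have "?c x * ?c x - ?s x * ?s x = 1" using cs[of x] by (simp add: power2_eq_square)
      moreover have "((- (s / c) * p - z / c) * c - p * s) / (c * c) + (1 / (c * c) * z + s / c * (2 * p / c)) = 0"
        if "c > 0" for c s p z :: real
        using that by (simp add: field_simps)
      ultimately show ?thesis using cp[of x] unfolding ts by (simp only:)
    qed
    finally show ?thesis .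
  qed
  define k where "k = \<psi> 0 / ?c 0 + ?s 0 / ?c 0 * \<zeta> 0"
  have k: "\<psi> x / ?c x + ?s x / ?c x * \<zeta> x = k" for x
    unfolding k_def using DERIV_isconst_all[OF allI, OF d1] by blast
  then have psi: "\<psi> x = k * ?c x - ?s x * \<zeta> x" for x
    using cp[of x] k[of x] by (simp add: field_simps)
  \<comment> \<open>After elimination \<zeta>' = 2 k - 2 tanh (x - \<alpha>) \<zeta>, which has the
    integrating factor cosh^2; the subtracted term is the primitive of 2 k cosh^2.\<close>
  have d2: "((\<lambda>x. \<zeta> x * (?c x)\<^sup>2 - k * ((x - \<alpha>) + ?s x * ?c x)) has_real_derivative 0) (at x)" for x
  proof -
    have "((\<lambda>x. \<zeta> x * (?c x)\<^sup>2 - k * ((x - \<alpha>) + ?s x * ?c x)) has_real_derivative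
      (2 * \<psi> x / ?c x) * (?c x)\<^sup>2 + \<zeta> x * (2 * ?c x * ?s x) - k * (1 + (?c x * ?c x + ?s x * ?s x))) (at x)"
      by (auto intro!: derivative_eq_intros dz simp: algebra_simps)
    also have "(2 * \<psi> x / ?c x) * (?c x)\<^sup>2 + \<zeta> x * (2 * ?c x * ?s x) - k * (1 + (?c x * ?c x + ?s x * ?s x)) = 0"
    proof -
      have e1: "(2 * \<psi> x / ?c x) * (?c x)\<^sup>2 = 2 * \<psi> x * ?c x" using cp[of x] by (simp add: power2_eq_square)
      have e2: "1 + (?c x * ?c x + ?s x * ?s x) = 2 * (?c x * ?c x)" using cs[of x] by (simp add: power2_eq_square)
      show ?thesis unfolding e1 e2 by (simp add: psi algebra_simps)
    qed
    finally show ?thesis .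
  qed
  define m where "m = \<zeta> 0 * (?c 0)\<^sup>2 - k * ((0 - \<alpha>) + ?s 0 * ?c 0)"
  have m: "\<zeta> x * (?c x)\<^sup>2 - k * ((x - \<alpha>) + ?s x * ?c x) = m" for x
    unfolding m_def using DERIV_isconst_all[OF allI, OF d2] by blast
  have "\<psi> x = k * (1 / ?c x - (x - \<alpha>) * ?s x / (?c x)\<^sup>2) - m * (?s x / (?c x)\<^sup>2)" for x
  proof -
    have z: "\<zeta> x = (m + k * ((x - \<alpha>) + ?s x * ?c x)) / (?c x)\<^sup>2"
      using m[of x] cp[of x] by (simp add: field_simps)
    have "k * ?c x - ?s x * (k * (?s x * ?c x) / (?c x)\<^sup>2) = k * (1 / ?c x)"
    proof -
      have "k * ?c x - ?s x * (k * (?s x * ?c x) / (?c x)\<^sup>2) = k * ((?c x * ?c x - ?s x * ?s x) / ?c x)"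
        using cp[of x] by (simp add: field_simps power2_eq_square)
      also have "?c x * ?c x - ?s x * ?s x = 1" using cs[of x] by (simp add: power2_eq_square)
      finally show ?thesis .
    qed
    then show ?thesis
      unfolding psi z by (simp add: ring_distribs add_divide_distrib) (simp add: algebra_simps)
  qed
  then show ?thesis by blast
qed

lemma sech_derivatives:
  fixes x \<alpha> A :: real
  shows "((\<lambda>x. 2 * arctan (exp (A * (x - \<alpha>)))) has_real_derivative A / cosh (A * (x - \<alpha>))) (at x)"
    and "((\<lambda>x. A * tanh (A * (x - \<alpha>))) has_real_derivative (A / cosh (A * (x - \<alpha>)))\<^sup>2) (at x)"
    and "((\<lambda>x. 1 / cosh (x - \<alpha>)) has_real_derivative - sinh (x - \<alpha>) / (cosh (x - \<alpha>))\<^sup>2) (at x)"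
proof -
  have e: "2 * (inverse (1 + (exp y)\<^sup>2) * (exp y * A)) = A / cosh y" for y
  proof -
    have "2 * (inverse (1 + E\<^sup>2) * (E * A)) = A / ((E + inverse E) / 2)" if "E > 0" for E :: real
    proof -
      have "(E + inverse E) / 2 = (1 + E\<^sup>2) / (2 * E)"
        using that by (simp add: inverse_eq_divide add_divide_distrib power2_eq_square)
      then have "A / ((E + inverse E) / 2) = A * (2 * E) / (1 + E\<^sup>2)"
        by (simp only: divide_divide_eq_right)
      then show ?thesis by (simp only: divide_inverse mult_ac)
    qed
    from this[of "exp y"] show ?thesis by (simp only: cosh_field_def exp_minus) simp
  qed
  have "((\<lambda>x. A * (x - \<alpha>)) has_real_derivative A) (at x)"
    by (auto intro!: derivative_eq_intros)
  from DERIV_cmult[OF DERIV_chain2[OF DERIV_arctan DERIV_chain2[OF DERIV_exp this]], of 2]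
  show "((\<lambda>x. 2 * arctan (exp (A * (x - \<alpha>)))) has_real_derivative A / cosh (A * (x - \<alpha>))) (at x)"
    unfolding e .
  have "1 - (tanh y)\<^sup>2 = 1 / (cosh y)\<^sup>2" for y :: real
  proof -
    have "1 - (sinh y / cosh y)\<^sup>2 = ((cosh y)\<^sup>2 - (sinh y)\<^sup>2) / (cosh y)\<^sup>2"
      by (simp add: power_divide diff_divide_distrib)
    then show ?thesis by (simp add: tanh_def cosh_square_eq)
  qed
  then show "((\<lambda>x. A * tanh (A * (x - \<alpha>))) has_real_derivative (A / cosh (A * (x - \<alpha>)))\<^sup>2) (at x)"
    by (auto intro!: derivative_eq_intros simp: power_divide power2_eq_square)
  show "((\<lambda>x. 1 / cosh (x - \<alpha>)) has_real_derivative - sinh (x - \<alpha>) / (cosh (x - \<alpha>))\<^sup>2) (at x)"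
    by (auto intro!: derivative_eq_intros simp: power2_eq_square)
qed

lemma has_real_derivative_vector: "(f has_real_derivative f') F \<Longrightarrow> (f has_vector_derivative f') F"
  by (simp add: has_real_derivative_iff_has_vector_derivative)

text \<open>The value is independent of A, in contrast to that of the square; this difference
  singles out the scale.\<close>

lemma integral_sech:
  fixes A \<alpha> :: real
  assumes A: "A > 0" and int: "integrable lborel (\<lambda>x. A / cosh (A * (x - \<alpha>)))"
  shows "(LINT x|lborel. A / cosh (A * (x - \<alpha>))) = pi"
proof -
  have "(LINT x|lborel. A / cosh (A * (x - \<alpha>))) = pi - 0"
  proof (rule integral_FTC_UNIV[OF has_real_derivative_vector[OF sech_derivatives(1)[of A \<alpha>]] _ int])
    show "isCont (\<lambda>x. A / cosh (A * (x - \<alpha>))) x" for x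
      by (intro continuous_intros) auto
    have "filterlim (\<lambda>x. A * (x - \<alpha>)) at_bot at_bot" "filterlim (\<lambda>x. A * (x - \<alpha>)) at_top at_top"
      using A by real_asymp+
    then have b: "((\<lambda>x. exp (A * (x - \<alpha>))) \<longlongrightarrow> 0) at_bot" and t: "filterlim (\<lambda>x. exp (A * (x - \<alpha>))) at_top at_top"
      by (auto intro: filterlim_compose[OF exp_at_bot] filterlim_compose[OF exp_at_top])
    show "((\<lambda>x. 2 * arctan (exp (A * (x - \<alpha>)))) \<longlongrightarrow> 0) at_bot"
      using tendsto_mult_left[OF tendsto_arctan[OF b], of 2] by simp
    show "((\<lambda>x. 2 * arctan (exp (A * (x - \<alpha>)))) \<longlongrightarrow> pi) at_top"
      using tendsto_mult_left[OF filterlim_compose[OF tendsto_arctan_at_top t], of 2] by simp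
  qed
  then show ?thesis by simp
qed

lemma integral_sech_squared:
  fixes A \<alpha> :: real
  assumes A: "A > 0" and int: "integrable lborel (\<lambda>x. (A / cosh (A * (x - \<alpha>)))\<^sup>2)"
  shows "(LINT x|lborel. (A / cosh (A * (x - \<alpha>)))\<^sup>2) = 2 * A"
proof -
  have "(LINT x|lborel. (A / cosh (A * (x - \<alpha>)))\<^sup>2) = A * 1 - A * (- 1)"
  proof (rule integral_FTC_UNIV[OF has_real_derivative_vector[OF sech_derivatives(2)[of A \<alpha>]] _ int])
    show "isCont (\<lambda>x. (A / cosh (A * (x - \<alpha>)))\<^sup>2) x" for x
      by (intro continuous_intros) auto
    have lin: "filterlim (\<lambda>x. A * (x - \<alpha>)) at_bot at_bot" "filterlim (\<lambda>x. A * (x - \<alpha>)) at_top at_top"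
      using A by real_asymp+
    show "((\<lambda>x. A * tanh (A * (x - \<alpha>))) \<longlongrightarrow> A * (- 1)) at_bot"
      by (intro tendsto_mult_left filterlim_compose[OF tanh_real_at_bot] lin)
    show "((\<lambda>x. A * tanh (A * (x - \<alpha>))) \<longlongrightarrow> A * 1) at_top"
      by (intro tendsto_mult_left filterlim_compose[OF tanh_real_at_top] lin)
  qed
  then show ?thesis by simp
qed

lemma sech_decay:
  "((\<lambda>y::real. 1 / cosh y) \<longlongrightarrow> 0) at_bot" "((\<lambda>y::real. 1 / cosh y) \<longlongrightarrow> 0) at_top"
  "((\<lambda>y::real. y * (1 / cosh y)) \<longlongrightarrow> 0) at_bot" "((\<lambda>y::real. y * (1 / cosh y)) \<longlongrightarrow> 0) at_top"
  unfolding cosh_field_def by real_asymp+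

text \<open>\<open>eq\<close> is the equation D \<psi> = 2 Q \<psi> read at frequency 0. For the
  general solution of the system \<psi> is the derivative of a decaying function, so its integral is
  0, whereas the left side equals 2 k. Hence k = 0.\<close>

lemma linearized_real_solution:
  fixes \<psi> \<zeta> :: "real \<Rightarrow> real" and \<alpha> :: real
  assumes dp: "\<And>x. (\<psi> has_real_derivative - tanh (x - \<alpha>) * \<psi> x - \<zeta> x / cosh (x - \<alpha>)) (at x)"
    and dz: "\<And>x. (\<zeta> has_real_derivative 2 * \<psi> x / cosh (x - \<alpha>)) (at x)"
    and i1: "integrable lborel \<psi>" and i2: "integrable lborel (\<lambda>x. 2 * \<psi> x / cosh (x - \<alpha>))"
    and eq: "(LINT x|lborel. 2 * \<psi> x / cosh (x - \<alpha>)) = c * (LINT x|lborel. \<psi> x)"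
  shows "\<exists>m. \<forall>x. \<psi> x = m * (- sinh (x - \<alpha>) / (cosh (x - \<alpha>))\<^sup>2)"
proof -
  obtain k m where psi: "\<And>x. \<psi> x = k * (1 / cosh (x - \<alpha>) - (x - \<alpha>) * sinh (x - \<alpha>) / (cosh (x - \<alpha>))\<^sup>2) - m * (sinh (x - \<alpha>) / (cosh (x - \<alpha>))\<^sup>2)"
    using linearized_ode[OF dp dz] by blast
  have cont: "isCont \<psi> x" for x
    using DERIV_isCont[OF dp] .
  have "(LINT x|lborel. \<psi> x) = 0 - 0"
  proof (rule integral_FTC_UNIV[OF has_real_derivative_vector cont i1])
    show "((\<lambda>x. k * ((x - \<alpha>) * (1 / cosh (x - \<alpha>))) + m * (1 / cosh (x - \<alpha>))) has_real_derivative \<psi> x) (at x)" for x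
    proof -
      have "((\<lambda>x. k * ((x - \<alpha>) * (1 / cosh (x - \<alpha>))) + m * (1 / cosh (x - \<alpha>))) has_real_derivative
        k * (1 * (1 / cosh (x - \<alpha>)) + (- sinh (x - \<alpha>) / (cosh (x - \<alpha>))\<^sup>2) * (x - \<alpha>)) + m * (- sinh (x - \<alpha>) / (cosh (x - \<alpha>))\<^sup>2)) (at x)"
        by (intro DERIV_add DERIV_cmult DERIV_mult sech_derivatives) (auto intro!: derivative_eq_intros)
      then show ?thesis by (simp add: psi mult.commute)
    qed
    have "((\<lambda>y::real. k * (y * (1 / cosh y)) + m * (1 / cosh y)) \<longlongrightarrow> k * 0 + m * 0) at_bot"
      "((\<lambda>y::real. k * (y * (1 / cosh y)) + m * (1 / cosh y)) \<longlongrightarrow> k * 0 + m * 0) at_top"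
      by (intro tendsto_add tendsto_mult_left sech_decay)+
    moreover have "filterlim (\<lambda>x. x - \<alpha>) at_bot at_bot" "filterlim (\<lambda>x. x - \<alpha>) at_top at_top" by real_asymp+
    ultimately show "((\<lambda>x. k * ((x - \<alpha>) * (1 / cosh (x - \<alpha>))) + m * (1 / cosh (x - \<alpha>))) \<longlongrightarrow> 0) at_bot"
      "((\<lambda>x. k * ((x - \<alpha>) * (1 / cosh (x - \<alpha>))) + m * (1 / cosh (x - \<alpha>))) \<longlongrightarrow> 0) at_top"
      using filterlim_compose[where g="\<lambda>y. k * (y * (1 / cosh y)) + m * (1 / cosh y)"] by fastforce+
  qed
  moreover have "(LINT x|lborel. 2 * \<psi> x / cosh (x - \<alpha>)) = k - (- k)"
  proof (rule integral_FTC_UNIV[OF has_real_derivative_vector _ i2])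
    show "isCont (\<lambda>x. 2 * \<psi> x / cosh (x - \<alpha>)) x" for x
      by (intro continuous_intros cont) auto
    \<comment> \<open>The coefficient of k is the derivative of A tanh (A y) in A at A = 1, the
      primitive that goes with the change of scale.\<close>
    let ?F = "\<lambda>y. k * (tanh y + y * (1 / cosh y)\<^sup>2) + m * (1 / cosh y)\<^sup>2"
    show "((\<lambda>x. ?F (x - \<alpha>)) has_real_derivative 2 * \<psi> x / cosh (x - \<alpha>)) (at x)" for x
    proof -
      let ?S = "\<lambda>x. 1 / cosh (x - \<alpha>)" and ?S' = "- sinh (x - \<alpha>) / (cosh (x - \<alpha>))\<^sup>2"
      have t: "((\<lambda>x. tanh (x - \<alpha>)) has_real_derivative (?S x)\<^sup>2) (at x)"
        using sech_derivatives(2)[of 1 \<alpha> x] by simp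
      have sq: "((\<lambda>x. (?S x)\<^sup>2) has_real_derivative 2 * ?S x * ?S') (at x)"
        using DERIV_power[OF sech_derivatives(3)[of \<alpha> x], of 2] by (simp add: mult_ac)
      have "((\<lambda>x. ?F (x - \<alpha>)) has_real_derivative k * ((?S x)\<^sup>2 + (1 * (?S x)\<^sup>2 + 2 * ?S x * ?S' * (x - \<alpha>))) + m * (2 * ?S x * ?S')) (at x)"
        by (intro DERIV_add DERIV_cmult DERIV_mult t sq) (auto intro!: derivative_eq_intros)
      also have "k * ((?S x)\<^sup>2 + (1 * (?S x)\<^sup>2 + 2 * ?S x * ?S' * (x - \<alpha>))) + m * (2 * ?S x * ?S') = 2 * \<psi> x / cosh (x - \<alpha>)"
        by (simp add: psi power2_eq_square algebra_simps diff_divide_distrib add_divide_distrib)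
      finally show ?thesis .
    qed
    have l: "filterlim (\<lambda>x. x - \<alpha>) at_bot at_bot" "filterlim (\<lambda>x. x - \<alpha>) at_top at_top" by real_asymp+
    have "((\<lambda>y::real. k * ((y * (1 / cosh y)) * (1 / cosh y)) + m * ((1 / cosh y) * (1 / cosh y))) \<longlongrightarrow> k * (0 * 0) + m * (0 * 0)) at_bot"
      "((\<lambda>y::real. k * ((y * (1 / cosh y)) * (1 / cosh y)) + m * ((1 / cosh y) * (1 / cosh y))) \<longlongrightarrow> k * (0 * 0) + m * (0 * 0)) at_top"
      by (intro tendsto_add tendsto_mult_left tendsto_mult sech_decay)+
    then have z: "((\<lambda>y::real. k * (y * (1 / cosh y)\<^sup>2) + m * (1 / cosh y)\<^sup>2) \<longlongrightarrow> 0) at_bot"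
      "((\<lambda>y::real. k * (y * (1 / cosh y)\<^sup>2) + m * (1 / cosh y)\<^sup>2) \<longlongrightarrow> 0) at_top"
      by (simp_all only: power2_eq_square mult.assoc mult_zero_right add_0_right)
    have F: "?F = (\<lambda>y. k * tanh y + (k * (y * (1 / cosh y)\<^sup>2) + m * (1 / cosh y)\<^sup>2))"
      by (simp add: fun_eq_iff ring_distribs)
    have "(?F \<longlongrightarrow> k * (- 1) + 0) at_bot" "(?F \<longlongrightarrow> k * 1 + 0) at_top"
      unfolding F by (intro tendsto_add tendsto_mult_left tanh_real_at_bot tanh_real_at_top z)+
    then show "((\<lambda>x. ?F (x - \<alpha>)) \<longlongrightarrow> - k) at_bot" "((\<lambda>x. ?F (x - \<alpha>)) \<longlongrightarrow> k) at_top"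
      using filterlim_compose[OF _ l(1), of ?F "nhds (- k)"] filterlim_compose[OF _ l(2), of ?F "nhds k"] by simp_all
  qed
  ultimately have "k = 0" using eq by simp
  then show ?thesis using psi by (intro exI[of _ m]) simp
qed

section \<open>Bounded continuous functions\<close>

text \<open>The class contains the primitives, which need not be integrable, is closed under
  products, and \<open>gconv\<close> is linear on it.\<close>

definition BC :: "(real \<Rightarrow> complex) \<Rightarrow> bool" where
  "BC f \<longleftrightarrow> (\<forall>x. isCont f x) \<and> (\<exists>B. \<forall>x. norm (f x) \<le> B)"

lemma BC_isCont: "BC f \<Longrightarrow> isCont f x"
  by (simp add: BC_def)

lemma BC_add:
  assumes "BC f" "BC g"
  shows "BC (\<lambda>x. f x + g x)"
proof -
  obtain B C where b: "\<And>x. norm (f x) \<le> B" "\<And>x. norm (g x) \<le> C"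
    using assms by (auto simp: BC_def)
  have "norm (f x + g x) \<le> B + C" for x
    using norm_triangle_le[OF add_mono[OF b(1) b(2)]] .
  then show ?thesis using assms unfolding BC_def by (blast intro: continuous_add)
qed

lemma BC_mult:
  assumes "BC f" "BC g"
  shows "BC (\<lambda>x. f x * g x)"
proof -
  obtain B C where b: "\<And>x. norm (f x) \<le> B" "\<And>x. norm (g x) \<le> C"
    using assms by (auto simp: BC_def)
  have "norm (f x * g x) \<le> B * C" for x
    unfolding norm_mult using b order_trans[OF norm_ge_zero b(1)] by (intro mult_mono) auto
  then show ?thesis using assms unfolding BC_def by (blast intro: continuous_mult)
qed

lemma BC_const: "BC (\<lambda>x. c)"
  by (auto simp: BC_def)

lemma BC_diff: "BC f \<Longrightarrow> BC g \<Longrightarrow> BC (\<lambda>x. f x - g x)"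
  using BC_add[of f "\<lambda>x. - 1 * g x"] BC_mult[OF BC_const, of g "- 1"] by simp

lemma BC_ift: "integrable lborel a \<Longrightarrow> BC (ift a)"
  unfolding BC_def using isCont_ift norm_ift_le by blast

lemma BC_primit: "integrable lborel \<beta> \<Longrightarrow> BC \<beta> \<Longrightarrow> BC (primit \<beta>)"
  unfolding BC_def using isCont_primit norm_primit_le by blast

lemma BC_green_integrable:
  assumes "BC f"
  shows "integrable lborel (\<lambda>y. complex_of_real (green (x - y)) * f y)"
proof -
  obtain B where "\<And>x. norm (f x) \<le> B" using assms by (auto simp: BC_def)
  moreover have "f \<in> borel_measurable borel" by (rule isCont_imp_borel) (rule BC_isCont[OF assms])
  ultimately have "integrable lborel (\<lambda>y. f y * complex_of_real (green (x - y)))"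
    using integrable_reflect_shift[OF integrable_green, of x] by (intro integrable_bounded_mult) auto
  then show ?thesis by (simp add: mult.commute)
qed

lemma gconv_add: "BC f \<Longrightarrow> BC g \<Longrightarrow> gconv (\<lambda>x. f x + g x) x = gconv f x + gconv g x"
  using BC_green_integrable[of f x] BC_green_integrable[of g x]
  by (simp add: gconv_def conv_reflect ring_distribs)

lemma gconv_diff: "BC f \<Longrightarrow> BC g \<Longrightarrow> gconv (\<lambda>x. f x - g x) x = gconv f x - gconv g x"
  using BC_green_integrable[of f x] BC_green_integrable[of g x]
  by (simp add: gconv_def conv_reflect ring_distribs)

lemma gconv_cmult: "gconv (\<lambda>x. c * f x) x = c * gconv f x"
  by (simp add: gconv_def conv_reflect mult.left_commute[of _ c])

lemma BC_Re_gconv: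
  assumes "BC h"
  shows "Re (gconv h x) = rgconv (\<lambda>y. Re (h y)) x" "Im (gconv h x) = rgconv (\<lambda>y. Im (h y)) x"
  using assms Re_gconv[of h] by (auto simp: BC_def)

lemma integrable_BC_mult: "BC f \<Longrightarrow> integrable lborel h \<Longrightarrow> integrable lborel (\<lambda>x. f x * h x)"
  unfolding BC_def using isCont_imp_borel[of f] by (auto intro: integrable_bounded_mult)

text \<open>Inversion gives the last clause of \<open>dtn_pair\<close> a.e., and continuity of both
  sides gives it everywhere.\<close>

lemma dtn_pairI:
  assumes a: "rapid a" and b: "integrable lborel \<beta>" "BC \<beta>" and F: "\<And>\<tau>. fourier_integral \<beta> \<tau> = of_real (tau_coth \<tau>) * a \<tau>"
  shows "dtn_pair a \<beta>"
proof -
  have Fb: "fourier_integral \<beta> = (\<lambda>\<tau>. of_real (tau_coth \<tau>) * a \<tau>)" using F by (simp add: fun_eq_iff)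
  have "AE x in lborel. \<beta> x = ift (\<lambda>\<tau>. of_real (tau_coth \<tau>) * a \<tau>) x"
    using fourier_inversion[OF b(1)] rapid_integrable(3)[OF a] by (simp add: Fb ift_def)
  then have "\<beta> x = ift (\<lambda>\<tau>. of_real (tau_coth \<tau>) * a \<tau>) x" for x
    using BC_isCont[OF b(2)] isCont_ift[OF rapid_integrable(3)[OF a]] by (intro continuous_eq_of_AE)
  then show ?thesis using a b Fb by (simp add: dtn_pair_def fun_eq_iff)
qed

text \<open>Used for the kernel equation, where T \<psi> + (2/\<pi>) \<psi> = 2 Q \<psi> is
  integrable although its two summands are only known to be in L2.\<close>

lemma fourier_L2_linear:
  assumes f: "f1 \<in> L2" "f2 \<in> L2" and h: "h \<in> L2" "integrable lborel h"
    and eq: "AE t in lborel. h t = f1 t + c * f2 t"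
  shows "AE \<tau> in lborel. fourier_L2 f1 \<tau> + c * fourier_L2 f2 \<tau> = fourier_integral h \<tau>"
proof (rule AE_eq_of_gauss_tests)
  note F = fourier_L2_L2[OF f(1)] fourier_L2_L2[OF f(2)]
  show "integrable lborel (\<lambda>t. gauss t * (fourier_L2 f1 t + c * fourier_L2 f2 t))"
    by (intro L2_mult_integrable gauss_L2 L2_add L2_cmult F)
  show "integrable lborel (\<lambda>t. gauss t * fourier_integral h t)"
    by (intro L2_mult_integrable gauss_L2 fourier_integral_L2 h)
  fix s
  let ?G = "\<lambda>t. wave s t * gauss t"
  have G: "?G \<in> L2" "integrable lborel ?G" by (rule wave_gauss_L2, rule integrable_wave_mult[OF integrable_gauss])
  have FG: "fourier_integral ?G \<in> L2" by (rule fourier_integral_L2[OF G])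
  have [measurable]: "f1 \<in> borel_measurable borel" "f2 \<in> borel_measurable borel" "h \<in> borel_measurable borel" "fourier_integral ?G \<in> borel_measurable borel"
    using L2_measurable[OF f(1)] L2_measurable[OF f(2)] L2_measurable[OF h(1)] L2_measurable[OF FG] by auto
  have i: "integrable lborel (\<lambda>t. fourier_L2 f1 t * ?G t)" "integrable lborel (\<lambda>t. c * (fourier_L2 f2 t * ?G t))"
    "integrable lborel (\<lambda>t. f1 t * fourier_integral ?G t)" "integrable lborel (\<lambda>t. c * (f2 t * fourier_integral ?G t))"
    by (intro integrable_mult_right L2_mult_integrable F G f FG)+
  have "(LINT t|lborel. wave s t * (gauss t * (fourier_L2 f1 t + c * fourier_L2 f2 t)))
     = (LINT t|lborel. fourier_L2 f1 t * ?G t + c * (fourier_L2 f2 t * ?G t))"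
    by (rule Bochner_Integration.integral_cong) (simp_all add: algebra_simps)
  also have "\<dots> = (LINT t|lborel. f1 t * fourier_integral ?G t) + c * (LINT t|lborel. f2 t * fourier_integral ?G t)"
    by (simp only: Bochner_Integration.integral_add[OF i(1,2)] integral_mult_right_zero fourier_L2_swap[OF f(1) G] fourier_L2_swap[OF f(2) G])
  also have "\<dots> = (LINT t|lborel. f1 t * fourier_integral ?G t + c * (f2 t * fourier_integral ?G t))"
    by (simp only: Bochner_Integration.integral_add[OF i(3,4)] integral_mult_right_zero)
  also have "\<dots> = (LINT t|lborel. h t * fourier_integral ?G t)"
  proof (rule integral_cong_AE)
    show "AE t in lborel. f1 t * fourier_integral ?G t + c * (f2 t * fourier_integral ?G t) = h t * fourier_integral ?G t"
      using eq by eventually_elim (simp add: algebra_simps)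
  qed measurable
  also have "\<dots> = (LINT t|lborel. fourier_integral h t * ?G t)"
    by (rule fourier_integral_swap[OF h(2) G(2), symmetric])
  finally show "(LINT t|lborel. wave s t * (gauss t * (fourier_L2 f1 t + c * fourier_L2 f2 t))) = (LINT t|lborel. wave s t * (gauss t * fourier_integral h t))"
    by (simp only: mult_ac)
qed

lemma L2_cong_AE:
  assumes "f \<in> L2" "AE t in lborel. g t = f t" "g \<in> borel_measurable lborel"
  shows "g \<in> L2"
  using assms sqnorm_cong_AE[OF assms(2)] by (simp add: L2_iff)

section \<open>Classification of the solutions and of the kernel\<close>

lemma primit_of_real: "primit (\<lambda>x. of_real (b x)) x = of_real (Re (primit (\<lambda>x. of_real (b x)) x))"
proof -
  have "primit (\<lambda>x. of_real (b x)) x = (LINT y|lborel. complex_of_real (indicator {0<..} y * b (x - y)))"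
    unfolding primit_def conv_def by (rule Bochner_Integration.integral_cong) (auto simp: expker_def indicator_def)
  also have "\<dots> = of_real (LINT y|lborel. indicator {0<..} y * b (x - y))"
    by (rule integral_complex_of_real)
  finally show ?thesis by (metis Re_complex_of_real)
qed

lemma has_real_derivative_Re:
  "(f has_vector_derivative f') (at x) \<Longrightarrow> ((\<lambda>x. Re (f x)) has_real_derivative Re f') (at x)"
  by (simp add: has_real_derivative_iff_has_vector_derivative bounded_linear.has_vector_derivative[OF bounded_linear_Re])

lemma has_real_derivative_Im:
  "(f has_vector_derivative f') (at x) \<Longrightarrow> ((\<lambda>x. Im (f x)) has_real_derivative Im f') (at x)"
  by (simp add: has_real_derivative_iff_has_vector_derivative bounded_linear.has_vector_derivative[OF bounded_linear_Im])

text \<open>The profile \<open>a\<close> and its primitive are exported along with the formula for Q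
  because the kernel is computed from the same data. \<open>primit\<close> is normalized at
  -\<infinity>, so it is tanh only up to a constant \<open>\<kappa>\<close>.\<close>

lemma soliton_classification:
  fixes Q :: "real \<Rightarrow> real"
  assumes QL2: "(\<lambda>t. complex_of_real (Q t)) \<in> L2"
    and nontriv: "\<not> (AE t in lborel. Q t = 0)"
    and sol: "solves_Q_equation Q"
  obtains a \<alpha> \<kappa> B where "dtn_pair a (\<lambda>x. ift a x * ift a x)"
    and "\<And>x. ift a x = of_real (1 / cosh (x - \<alpha>))"
    and "AE t in lborel. Q t = 1 / cosh (t - \<alpha>)"
    and "\<And>x. primit (\<lambda>x. ift a x * ift a x) x = of_real (tanh (x - \<alpha>) + \<kappa>)"
    and "ground_state (\<lambda>x. 1 / cosh (x - \<alpha>)) B"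
proof -
  have [measurable]: "Q \<in> borel_measurable borel"
    using L2_measurable[OF QL2] by (auto simp: borel_measurable_complex_iff)
  have eq: "AE t in lborel. complex_of_real (Q t) = gconv (\<lambda>y. of_real ((Q y)\<^sup>2)) t"
    by (rule solution_eq_gconv[OF QL2 sol])
  obtain a where na: "rapid a" and Qa: "AE t in lborel. complex_of_real (Q t) = ift a t"
    and Fsq: "\<And>\<tau>. fourier_integral (\<lambda>t. ift a t * ift a t) \<tau> = of_real (tau_coth \<tau>) * a \<tau>"
    using solution_profile[OF QL2 eq] by blast
  define u where "u = ift a"
  define \<beta> where "\<beta> = (\<lambda>x. u x * u x)"
  define q where "q x = Re (u x)" for x
  note ai = rapid_integrable[OF na]
  have u: "BC u" unfolding u_def by (rule BC_ift[OF ai(1)])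
  have ui: "integrable lborel u" and Fu: "fourier_integral u = a" using na by (auto simp: rapid_def u_def)
  \<comment> \<open>u is continuous and agrees a.e. with the real function Q, so it is real at every
    point.\<close>
  have uq: "u x = of_real (q x)" for x
  proof (rule continuous_eq_of_AE[where f=u and g="\<lambda>x. complex_of_real (q x)"])
    show "isCont u x" for x by (rule BC_isCont[OF u])
    show "isCont (\<lambda>x. complex_of_real (q x)) x" for x
      unfolding q_def by (intro continuous_intros isCont_Re BC_isCont[OF u])
    show "AE x in lborel. u x = complex_of_real (q x)"
      using Qa
    proof eventually_elim
      case (elim x)
      then have "u x = of_real (Q x)" by (simp add: u_def)
      then show ?case by (simp add: q_def)
    qed
  qed
  have Qq: "AE t in lborel. Q t = q t"
    using Qa by eventually_elim (metis u_def q_def Re_complex_of_real)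
  have b: "BC \<beta>" unfolding \<beta>_def by (intro BC_mult u)
  have bi: "integrable lborel \<beta>" unfolding \<beta>_def by (rule integrable_BC_mult[OF u ui])
  have dp: "dtn_pair a \<beta>"
    using Fsq by (intro dtn_pairI na bi b) (simp add: \<beta>_def u_def)
  have bq: "\<beta> = (\<lambda>x. of_real ((q x)\<^sup>2))"
    by (simp add: \<beta>_def uq fun_eq_iff power2_eq_square)
  have q_eq: "q x = rgconv (\<lambda>y. (q y)\<^sup>2) x" for x
  proof -
    have "u x = gconv \<beta> x" unfolding u_def by (rule dtn_derivative(3)[OF dp])
    then show ?thesis unfolding bq gconv_of_real uq of_real_eq_iff .
  qed
  obtain B where B: "\<And>x. norm (u x) \<le> B" using u by (auto simp: BC_def)
  have q_le: "\<bar>q x\<bar> \<le> B" for x using B[of x] by (simp add: uq)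
  have q_cont: "isCont q x" for x unfolding q_def by (intro isCont_Re BC_isCont[OF u])
  have qm [measurable]: "q \<in> borel_measurable borel"
    by (rule borel_measurable_continuous_onI) (simp add: continuous_at_imp_continuous_on q_cont)
  have q_sq: "integrable lborel (\<lambda>x. (q x)\<^sup>2)"
    using integrable_Re[OF bi] by (simp add: bq)
  have q_int: "integrable lborel q"
    using integrable_Re[OF ui] by (simp add: uq)
  have gq: "integrable lborel (\<lambda>y. green (x - y) * (q y)\<^sup>2)" for x
  proof (rule integrable_green_bounded[where B="B\<^sup>2"])
    show "\<bar>(q y)\<^sup>2\<bar> \<le> B\<^sup>2" for y
      using power_mono[OF q_le abs_ge_zero, of y 2] by simp
  qed measurable
  have q_nonneg: "q x \<ge> 0" for x
    unfolding q_eq[of x] rgconv_def by (intro integral_nonneg_AE) (simp add: green_nonneg)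
  \<comment> \<open>By the maximum principle a single zero of q would make q^2, and with it Q,
    vanish a.e.\<close>
  have q_pos: "q x > 0" for x
  proof (rule ccontr)
    assume "\<not> q x > 0"
    then have "rgconv (\<lambda>y. (q y)\<^sup>2) x = 0" using q_nonneg[of x] q_eq[of x] by simp
    then have "AE y in lborel. (q y)\<^sup>2 = 0" by (intro rgconv_eq_0[OF gq]) auto
    then have "AE t in lborel. Q t = 0" using Qq by eventually_elim simp
    with nontriv show False by simp
  qed
  have gs: "ground_state q B"
    by (rule ground_state.intro[OF qm q_pos order_trans[OF abs_ge_self q_le] q_sq q_eq])
  define V where "V = primit \<beta>"
  define v where "v x = Re (V x)" for x
  have Vv: "V x = of_real (v x)" for x unfolding V_def v_def bq by (rule primit_of_real)
  have V: "BC V" unfolding V_def by (rule BC_primit[OF bi b])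
  define u' where "u' = ift' a"
  have u': "BC u'" unfolding u'_def ift'_def by (rule BC_ift[OF ai(2)])
  have du: "(u has_vector_derivative u' x) (at x)" for x
    unfolding u_def u'_def by (rule rapid_has_derivative[OF na])
  have dV: "(V has_vector_derivative \<beta> x) (at x)" for x
    unfolding V_def by (rule primit_has_derivative[OF bi BC_isCont[OF b]])
  have "(\<beta> has_vector_derivative u x * u' x + u' x * u x) (at x)" for x
    unfolding \<beta>_def by (rule has_vector_derivative_mult[OF du du])
  from vector_derivative_unique_at[OF this dtn_derivative(1)[OF dp]]
  have b': "ift' (\<lambda>\<tau>. of_real (tau_coth \<tau>) * a \<tau>) = (\<lambda>x. u x * u' x + u' x * u x)"
    by (simp add: fun_eq_iff)
  have e1: "u' x = gconv (\<lambda>x. u x * u' x + u' x * u x) x" for x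
    using dtn_derivative(2)[OF dp, of x] by (simp add: b' u'_def)
  have e2: "u x * V x + u x * V x = gconv (\<lambda>x. V x * \<beta> x + V x * \<beta> x - (u x * u' x + u x * u' x)) x" for x
    using dtn_bilinear[OF dp dp, of x] by (simp add: u_def V_def u'_def)
  define p where "p x = u' x + u x * V x" for x
  have p_eq: "p x = gconv (\<lambda>x. u x * p x) x" for x
  proof -
    \<comment> \<open>The bilinear identity with both pairs equal yields twice D (u V), so the sum
      is formed for 2 p: 4 u u' + 2 V u^2 - 2 u u' = 2 u p.\<close>
    have "2 * p x = gconv (\<lambda>x. 2 * (u x * u' x + u' x * u x)) x + gconv (\<lambda>x. V x * \<beta> x + V x * \<beta> x - (u x * u' x + u x * u' x)) x"
      unfolding gconv_cmult e1[symmetric] e2[symmetric] by (simp add: p_def)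
    also have "\<dots> = gconv (\<lambda>x. 2 * (u x * u' x + u' x * u x) + (V x * \<beta> x + V x * \<beta> x - (u x * u' x + u x * u' x))) x"
      by (intro gconv_add[symmetric] BC_mult BC_add BC_diff BC_const u u' V b)
    also have "\<dots> = gconv (\<lambda>x. 2 * (u x * p x)) x"
      by (rule arg_cong[where f="\<lambda>h. gconv h x"]) (simp add: fun_eq_iff p_def \<beta>_def algebra_simps)
    finally show ?thesis unfolding gconv_cmult by simp
  qed
  have p: "BC p" unfolding p_def by (intro BC_add BC_mult u u' V)
  obtain C where C: "\<And>x. norm (p x) \<le> C" using p by (auto simp: BC_def)
  have "\<exists>\<kappa>. \<forall>x. Re (p x) = \<kappa> * q x"
  proof (rule ground_state.simple_eigenvalue[OF gs])
    show "\<bar>Re (p x)\<bar> \<le> C" for x using C[of x] abs_Re_le_cmod order_trans by blast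
    show "(\<lambda>x. Re (p x)) \<in> borel_measurable borel"
      using isCont_imp_borel[of p] BC_isCont[OF p] by measurable
    show "Re (p x) = rgconv (\<lambda>y. q y * Re (p y)) x" for x
    proof -
      have "Re (p x) = Re (gconv (\<lambda>x. u x * p x) x)" using p_eq[of x] by simp
      also have "\<dots> = rgconv (\<lambda>y. Re (u y * p y)) x" by (rule BC_Re_gconv[OF BC_mult[OF u p]])
      finally show ?thesis by (simp add: uq)
    qed
  qed
  then obtain \<kappa> where \<kappa>: "\<And>x. Re (p x) = \<kappa> * q x" by blast
  have dq: "(q has_real_derivative - q x * (v x - \<kappa>)) (at x)" for x
  proof -
    have "(q has_real_derivative Re (u' x)) (at x)"
      unfolding q_def using has_real_derivative_Re[OF du] .
    also have "Re (u' x) = - q x * (v x - \<kappa>)"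
      using \<kappa>[of x] by (simp add: p_def uq Vv algebra_simps)
    finally show ?thesis .
  qed
  have dv: "((\<lambda>x. v x - \<kappa>) has_real_derivative (q x)\<^sup>2) (at x)" for x
  proof -
    have "(v has_real_derivative Re (\<beta> x)) (at x)"
      unfolding v_def using has_real_derivative_Re[OF dV] .
    then show ?thesis by (auto intro!: derivative_eq_intros simp: bq)
  qed
  obtain A \<alpha> where A: "A > 0" and qA: "\<And>x. q x = A / cosh (A * (x - \<alpha>))" and vA: "\<And>x. v x - \<kappa> = A * tanh (A * (x - \<alpha>))"
    using soliton_ode[OF q_pos dq dv] by blast
  \<comment> \<open>Comparison at frequency 0, where the symbol is 2/\<pi>: 2 A = (2/\<pi>)
    \<pi>.\<close>
  have "A = 1"
  proof -
    have "fourier_integral \<beta> = (\<lambda>\<tau>. of_real (tau_coth \<tau>) * a \<tau>)"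
      using dp unfolding dtn_pair_def by blast
    then have "fourier_integral \<beta> 0 = of_real (tau_coth 0) * fourier_integral u 0"
      by (simp only: Fu)
    then have "cF * (LINT t|lborel. \<beta> t) = cF * (of_real (2 / pi) * (LINT t|lborel. u t))"
      by (simp add: fourier_integral_wave)
    then have "(LINT t|lborel. \<beta> t) = of_real (2 / pi) * (LINT t|lborel. u t)"
      by (simp only: mult_left_cancel[OF cF_nonzero])
    then have "complex_of_real (LINT t|lborel. (q t)\<^sup>2) = of_real (2 / pi * (LINT t|lborel. q t))"
      unfolding of_real_mult integral_complex_of_real[symmetric] by (simp only: bq uq)
    then have "(LINT t|lborel. (q t)\<^sup>2) = 2 / pi * (LINT t|lborel. q t)" by (simp only: of_real_eq_iff)
    moreover have "(LINT t|lborel. (q t)\<^sup>2) = 2 * A"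
      using integral_sech_squared[OF A, of \<alpha>] q_sq by (simp only: qA)
    moreover have "(LINT t|lborel. q t) = pi"
      using integral_sech[OF A, of \<alpha>] q_int by (simp only: qA[abs_def])
    ultimately show ?thesis by simp
  qed
  then have q1: "q x = 1 / cosh (x - \<alpha>)" and v1: "v x = tanh (x - \<alpha>) + \<kappa>" for x
    using qA[of x] vA[of x] by (auto simp: algebra_simps)
  have q1': "q = (\<lambda>x. 1 / cosh (x - \<alpha>))" by (simp add: q1 fun_eq_iff)
  show ?thesis
  proof (rule that)
    show "dtn_pair a (\<lambda>x. ift a x * ift a x)" using dp by (simp add: \<beta>_def u_def)
    show "ift a x = of_real (1 / cosh (x - \<alpha>))" for x using uq[of x] by (simp add: u_def q1)
    show "AE t in lborel. Q t = 1 / cosh (t - \<alpha>)" using Qq by (simp add: q1)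
    show "primit (\<lambda>x. ift a x * ift a x) x = of_real (tanh (x - \<alpha>) + \<kappa>)" for x
      using Vv[of x] by (simp add: V_def \<beta>_def u_def v1)
    show "ground_state (\<lambda>x. 1 / cosh (x - \<alpha>)) B" using gs unfolding q1' .
  qed
qed

text \<open>The linearized copy of the classification: decay is bootstrapped through convolution
  with the rapid profile \<open>a\<close>, the polarized identity gives another fixed point of the
  ground state operator, and the remaining linear system is solved explicitly.\<close>

lemma linearized_kernel:
  fixes \<alpha> \<kappa> B :: real
  assumes dp: "dtn_pair a (\<lambda>x. ift a x * ift a x)"
    and ua: "\<And>x. ift a x = of_real (1 / cosh (x - \<alpha>))"
    and Va: "\<And>x. primit (\<lambda>x. ift a x * ift a x) x = of_real (tanh (x - \<alpha>) + \<kappa>)"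
    and gs: "ground_state (\<lambda>x. 1 / cosh (x - \<alpha>)) B"
    and psi: "\<psi> \<in> L2" and psi_eq: "AE t in lborel. \<psi> t = gconv (\<lambda>y. 2 * (of_real (1 / cosh (y - \<alpha>)) * \<psi> y)) t"
  shows "\<exists>c. AE t in lborel. \<psi> t = c * of_real (- sinh (t - \<alpha>) / (cosh (t - \<alpha>))\<^sup>2)"
proof -
  define u where "u = ift a"
  define \<beta> where "\<beta> = (\<lambda>x. u x * u x)"
  define V where "V = primit \<beta>"
  define q where "q x = 1 / cosh (x - \<alpha>)" for x
  have uq: "u x = of_real (q x)" for x unfolding u_def q_def by (rule ua)
  have na: "rapid a" using dp by (simp add: dtn_pair_def)
  have da: "decays n a" for n using na by (simp add: rapid_def)
  note ai = rapid_integrable[OF na]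
  have dpb: "dtn_pair a \<beta>" using dp by (simp add: \<beta>_def u_def)
  have u: "BC u" unfolding u_def by (rule BC_ift[OF ai(1)])
  have ui: "integrable lborel u" using na by (auto simp: rapid_def u_def)
  have b: "BC \<beta>" unfolding \<beta>_def by (intro BC_mult u)
  have bi: "integrable lborel \<beta>" unfolding \<beta>_def by (rule integrable_BC_mult[OF u ui])
  have [measurable]: "\<psi> \<in> borel_measurable borel" using L2_measurable[OF psi] by simp
  have um [measurable]: "u \<in> borel_measurable borel" using ui by auto
  have uL2: "u \<in> L2"
  proof (rule L2I)
    have "integrable lborel (\<lambda>x. norm (\<beta> x))" by (rule integrable_norm[OF bi])
    then show "integrable lborel (\<lambda>x. (norm (u x))\<^sup>2)" by (simp add: \<beta>_def norm_mult power2_eq_square)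
  qed measurable
  define h where "h t = 2 * (u t * \<psi> t)" for t
  have hi: "integrable lborel h"
    unfolding h_def by (intro integrable_mult_right L2_mult_integrable uL2 psi)
  obtain C where C: "\<And>x. norm (u x) \<le> C" using u by (auto simp: BC_def)
  have hL2: "h \<in> L2"
  proof (rule L2I)
    have "integrable lborel (\<lambda>t. (norm (2 * u t))\<^sup>2 * (norm (\<psi> t))\<^sup>2)"
    proof (rule integrable_bounded_mult[OF L2_integrable[OF psi], where B="(2 * C)\<^sup>2"])
      show "norm ((norm (2 * u x))\<^sup>2) \<le> (2 * C)\<^sup>2" for x
        using C[of x] by (simp add: norm_mult power_mono)
    qed measurable
    then show "integrable lborel (\<lambda>t. (norm (h t))\<^sup>2)" by (simp add: h_def norm_mult power_mult_distrib mult_ac)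
  qed (unfold h_def, measurable)
  have pg: "AE t in lborel. \<psi> t = gconv h t"
    using psi_eq by (simp add: h_def[abs_def] uq q_def)
  define \<alpha>' where "\<alpha>' = (\<lambda>\<tau>. fourier_integral h \<tau> / of_real (tau_coth \<tau>))"
  have pm: "\<psi> \<in> borel_measurable borel" by measurable
  note pr = gconv_solution_profile[OF hi hL2 pm pg, folded \<alpha>'_def]
  define w where "w = ift \<alpha>'"
  have pw: "AE t in lborel. \<psi> t = w t" and al: "integrable lborel \<alpha>'" and wi: "integrable lborel w"
    and Fw: "fourier_integral w = \<alpha>'" unfolding w_def by (rule pr)+
  have [measurable]: "w \<in> borel_measurable borel" using wi by auto
  define \<gamma> where "\<gamma> = (\<lambda>x. 2 * (u x * w x))"
  have w: "BC w" unfolding w_def by (rule BC_ift[OF al])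
  have c: "BC \<gamma>" unfolding \<gamma>_def by (intro BC_mult BC_const u w)
  have ci: "integrable lborel \<gamma>" unfolding \<gamma>_def by (intro integrable_mult_right integrable_BC_mult u wi)
  have [measurable]: "\<gamma> \<in> borel_measurable borel" using ci by auto
  have Fh: "fourier_integral h \<tau> = fourier_integral \<gamma> \<tau>" for \<tau>
  proof (rule fourier_integral_cong_AE)
    show "AE x in lborel. h x = \<gamma> x" using pw by eventually_elim (simp add: h_def \<gamma>_def)
    show "h \<in> borel_measurable lborel" using hi by auto
  qed measurable
  have Fh': "fourier_integral h = (\<lambda>\<tau>. (2 * cF) * (LINT s|lborel. \<alpha>' (\<tau> - s) * a s))"
  proof
    fix \<tau>
    have "fourier_integral \<gamma> \<tau> = 2 * fourier_integral (\<lambda>x. w x * u x) \<tau>"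
      unfolding \<gamma>_def fourier_integral_cmult by (simp add: mult.commute)
    also have "\<dots> = 2 * (cF * (LINT s|lborel. \<alpha>' (\<tau> - s) * a s))"
      unfolding u_def fourier_integral_mult_ift[OF wi ai(1)] Fw ..
    finally show "fourier_integral h \<tau> = (2 * cF) * (LINT s|lborel. \<alpha>' (\<tau> - s) * a s)"
      by (simp add: Fh)
  qed
  have dal: "decays n \<alpha>'" for n
    unfolding \<alpha>'_def
  proof (rule decays_all_of_step)
    show "decays 0 (fourier_integral h)" by (rule decays_fourier_integral)
    show "decays n (fourier_integral h)" if "decays n (\<lambda>\<tau>. fourier_integral h \<tau> / of_real (tau_coth \<tau>))" for n
    proof -
      have "decays n \<alpha>'" using that by (simp add: \<alpha>'_def)
      from decays_convolution[OF al this ai(1) da, of "2 * cF"] show ?thesis unfolding Fh' .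
    qed
  qed
  have nal: "rapid \<alpha>'"
    using al wi Fw dal by (simp add: rapid_def w_def borel_measurable_integrable[of lborel, simplified])
  note ali = rapid_integrable[OF nal]
  have dpc: "dtn_pair \<alpha>' \<gamma>"
  proof (rule dtn_pairI[OF nal ci c])
    show "fourier_integral \<gamma> \<tau> = of_real (tau_coth \<tau>) * \<alpha>' \<tau>" for \<tau>
      using tau_coth_lower(2)[of \<tau>] by (simp add: \<alpha>'_def flip: Fh)
  qed
  define Z where "Z = primit \<gamma>"
  define u' where "u' = ift' a"
  define w' where "w' = ift' \<alpha>'"
  have V: "BC V" unfolding V_def by (rule BC_primit[OF bi b])
  have Z: "BC Z" unfolding Z_def by (rule BC_primit[OF ci c])
  have u': "BC u'" unfolding u'_def ift'_def by (rule BC_ift[OF ai(2)])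
  have w': "BC w'" unfolding w'_def ift'_def by (rule BC_ift[OF ali(2)])
  have du: "(u has_vector_derivative u' x) (at x)" for x
    unfolding u_def u'_def by (rule rapid_has_derivative[OF na])
  have dw: "(w has_vector_derivative w' x) (at x)" for x
    unfolding w_def w'_def by (rule rapid_has_derivative[OF nal])
  have dZ: "(Z has_vector_derivative \<gamma> x) (at x)" for x
    unfolding Z_def by (rule primit_has_derivative[OF ci BC_isCont[OF c]])
  have VT: "V x = of_real (tanh (x - \<alpha>) + \<kappa>)" for x unfolding V_def \<beta>_def u_def by (rule Va)
  have u'T: "u' x = - (u x * (V x - of_real \<kappa>))" for x
  proof -
    have "((\<lambda>x. complex_of_real (1 / cosh (x - \<alpha>))) has_vector_derivative of_real (- sinh (x - \<alpha>) / (cosh (x - \<alpha>))\<^sup>2)) (at x)"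
      using has_vector_derivative_of_real[OF sech_derivatives(3)] by blast
    moreover have "u = (\<lambda>x. complex_of_real (1 / cosh (x - \<alpha>)))" by (simp add: u_def ua fun_eq_iff)
    ultimately have "(u has_vector_derivative of_real (- sinh (x - \<alpha>) / (cosh (x - \<alpha>))\<^sup>2)) (at x)" by simp
    from vector_derivative_unique_at[OF du this]
    show ?thesis by (simp add: uq q_def VT tanh_def power2_eq_square)
  qed
  have "(\<gamma> has_vector_derivative 2 * (u x * w' x + u' x * w x)) (at x)" for x
    unfolding \<gamma>_def using has_vector_derivative_mult[OF has_vector_derivative_const[of 2] has_vector_derivative_mult[OF du dw]] by simp
  from vector_derivative_unique_at[OF this dtn_derivative(1)[OF dpc]]
  have c': "ift' (\<lambda>\<tau>. of_real (tau_coth \<tau>) * \<alpha>' \<tau>) = (\<lambda>x. 2 * (u x * w' x + u' x * w x))"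
    by (simp add: fun_eq_iff)
  have e1: "w' x = gconv (\<lambda>x. 2 * (u x * w' x + u' x * w x)) x" for x
    using dtn_derivative(2)[OF dpc, of x] by (simp only: c' w'_def)
  have e2: "u x * Z x + w x * V x = gconv (\<lambda>x. Z x * \<beta> x + V x * \<gamma> x - (u x * w' x + w x * u' x)) x" for x
    using dtn_bilinear[OF dpb dpc, of x] by (simp add: u_def V_def u'_def w_def Z_def w'_def)
  have e3: "w x = gconv \<gamma> x" for x
    unfolding w_def by (rule dtn_derivative(3)[OF dpc])
  \<comment> \<open>The last term compensates for V being tanh + \<kappa>. Substituting u' = - u (V
    - \<kappa>) into D (w' + u Z + w V) leaves an extra \<kappa> u w beyond the multiple by u, and D
    (\<kappa> w) = 2 \<kappa> u w turns it into the required - \<kappa> u w.\<close>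
  define p where "p x = w' x + (u x * Z x + w x * V x) - of_real \<kappa> * w x" for x
  have p: "BC p" unfolding p_def by (intro BC_add BC_diff BC_mult BC_const u V w Z w')
  have p_eq: "p x = gconv (\<lambda>x. u x * p x) x" for x
  proof -
    have "p x = gconv (\<lambda>x. 2 * (u x * w' x + u' x * w x)) x + gconv (\<lambda>x. Z x * \<beta> x + V x * \<gamma> x - (u x * w' x + w x * u' x)) x
       - gconv (\<lambda>x. of_real \<kappa> * \<gamma> x) x"
    proof -
      have "gconv (\<lambda>x. of_real \<kappa> * \<gamma> x) x = of_real \<kappa> * w x"
        by (simp only: gconv_cmult e3[symmetric])
      then show ?thesis by (simp only: p_def e1[of x, symmetric] e2[of x, symmetric])
    qed
    also have "\<dots> = gconv (\<lambda>x. 2 * (u x * w' x + u' x * w x) + (Z x * \<beta> x + V x * \<gamma> x - (u x * w' x + w x * u' x))) x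
       - gconv (\<lambda>x. of_real \<kappa> * \<gamma> x) x"
      by (subst gconv_add) (intro BC_mult BC_add BC_diff BC_const u u' V b w w' Z c refl)+
    also have "\<dots> = gconv (\<lambda>x. 2 * (u x * w' x + u' x * w x) + (Z x * \<beta> x + V x * \<gamma> x - (u x * w' x + w x * u' x)) - of_real \<kappa> * \<gamma> x) x"
      by (rule gconv_diff[symmetric]) (intro BC_mult BC_add BC_diff BC_const u u' V b w w' Z c)+
    also have "\<dots> = gconv (\<lambda>x. u x * p x) x"
      by (rule arg_cong[where f="\<lambda>h. gconv h x"]) (simp add: fun_eq_iff p_def \<beta>_def \<gamma>_def u'T algebra_simps)
    finally show ?thesis .
  qed
  obtain D where D: "\<And>x. norm (p x) \<le> D" using p by (auto simp: BC_def)
  have pmeas [measurable]: "p \<in> borel_measurable borel" by (rule isCont_imp_borel[OF BC_isCont[OF p]])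
  note gc = BC_Re_gconv[OF BC_mult[OF u p], folded p_eq]
  \<comment> \<open>The fixed point equation has real coefficients, so real and imaginary parts of p
    are each a multiple of the ground state.\<close>
  have "\<exists>\<kappa>. \<forall>x. Re (p x) = \<kappa> * (1 / cosh (x - \<alpha>))"
  proof (rule ground_state.simple_eigenvalue[OF gs])
    show "\<bar>Re (p x)\<bar> \<le> D" for x using D[of x] abs_Re_le_cmod order_trans by blast
    show "Re (p x) = rgconv (\<lambda>y. 1 / cosh (y - \<alpha>) * Re (p y)) x" for x
      using gc(1)[of x] by (simp add: uq q_def)
  qed measurable
  then obtain k1 where k1: "\<And>x. Re (p x) = k1 * q x" by (auto simp: q_def)
  have "\<exists>\<kappa>. \<forall>x. Im (p x) = \<kappa> * (1 / cosh (x - \<alpha>))"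
  proof (rule ground_state.simple_eigenvalue[OF gs])
    show "\<bar>Im (p x)\<bar> \<le> D" for x using D[of x] abs_Im_le_cmod order_trans by blast
    show "Im (p x) = rgconv (\<lambda>y. 1 / cosh (y - \<alpha>) * Im (p y)) x" for x
      using gc(2)[of x] by (simp add: uq q_def)
  qed measurable
  then obtain k2 where k2: "\<And>x. Im (p x) = k2 * q x" by (auto simp: q_def)
  have F0: "(LINT t|lborel. \<gamma> t) = of_real (2 / pi) * (LINT t|lborel. w t)"
  proof -
    have "fourier_integral \<gamma> 0 = of_real (tau_coth 0) * fourier_integral w 0"
    proof -
      have "fourier_integral \<gamma> = (\<lambda>\<tau>. of_real (tau_coth \<tau>) * \<alpha>' \<tau>)"
        using dpc unfolding dtn_pair_def by blast
      then show ?thesis by (simp only: Fw)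
    qed
    then have "cF * (LINT t|lborel. \<gamma> t) = cF * (of_real (2 / pi) * (LINT t|lborel. w t))"
      by (simp add: fourier_integral_wave)
    then show ?thesis by (simp only: mult_left_cancel[OF cF_nonzero])
  qed
  have RG: "Re (\<gamma> x) = 2 * Re (w x) / cosh (x - \<alpha>)" "Im (\<gamma> x) = 2 * Im (w x) / cosh (x - \<alpha>)" for x
    by (simp_all add: \<gamma>_def uq q_def)
  have "\<exists>m. \<forall>x. Re (w x) = m * (- sinh (x - \<alpha>) / (cosh (x - \<alpha>))\<^sup>2)"
  proof (rule linearized_real_solution)
    \<comment> \<open>The multiple k1 of the ground state is absorbed into the constant of
      integration of Z, so that Re Z - k1 plays the role of \<zeta>.\<close>
    show "((\<lambda>x. Re (w x)) has_real_derivative - tanh (x - \<alpha>) * Re (w x) - (Re (Z x) - k1) / cosh (x - \<alpha>)) (at x)" for x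
    proof -
      have "Re (w' x) = - tanh (x - \<alpha>) * Re (w x) - (Re (Z x) - k1) / cosh (x - \<alpha>)"
        using k1[of x] by (simp add: p_def uq q_def VT field_simps)
      with has_real_derivative_Re[OF dw, of x] show ?thesis by simp
    qed
    show "((\<lambda>x. Re (Z x) - k1) has_real_derivative 2 * Re (w x) / cosh (x - \<alpha>)) (at x)" for x
      using DERIV_diff[OF has_real_derivative_Re[OF dZ] DERIV_const[of k1], of x] by (simp add: RG)
    show "integrable lborel (\<lambda>x. Re (w x))" by (rule integrable_Re[OF wi])
    show "integrable lborel (\<lambda>x. 2 * Re (w x) / cosh (x - \<alpha>))" using integrable_Re[OF ci] by (simp add: RG)
    show "(LINT x|lborel. 2 * Re (w x) / cosh (x - \<alpha>)) = 2 / pi * (LINT x|lborel. Re (w x))"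
      using arg_cong[OF F0, of Re] by (simp add: RG[symmetric] integral_Re[OF wi] integral_Re[OF ci])
  qed
  then obtain m1 where m1: "\<And>x. Re (w x) = m1 * (- sinh (x - \<alpha>) / (cosh (x - \<alpha>))\<^sup>2)" by blast
  have "\<exists>m. \<forall>x. Im (w x) = m * (- sinh (x - \<alpha>) / (cosh (x - \<alpha>))\<^sup>2)"
  proof (rule linearized_real_solution)
    show "((\<lambda>x. Im (w x)) has_real_derivative - tanh (x - \<alpha>) * Im (w x) - (Im (Z x) - k2) / cosh (x - \<alpha>)) (at x)" for x
    proof -
      have "Im (w' x) = - tanh (x - \<alpha>) * Im (w x) - (Im (Z x) - k2) / cosh (x - \<alpha>)"
        using k2[of x] by (simp add: p_def uq q_def VT field_simps)
      with has_real_derivative_Im[OF dw, of x] show ?thesis by simp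
    qed
    show "((\<lambda>x. Im (Z x) - k2) has_real_derivative 2 * Im (w x) / cosh (x - \<alpha>)) (at x)" for x
      using DERIV_diff[OF has_real_derivative_Im[OF dZ] DERIV_const[of k2], of x] by (simp add: RG)
    show "integrable lborel (\<lambda>x. Im (w x))" by (rule integrable_Im[OF wi])
    show "integrable lborel (\<lambda>x. 2 * Im (w x) / cosh (x - \<alpha>))" using integrable_Im[OF ci] by (simp add: RG)
    show "(LINT x|lborel. 2 * Im (w x) / cosh (x - \<alpha>)) = 2 / pi * (LINT x|lborel. Im (w x))"
      using arg_cong[OF F0, of Im] by (simp add: RG[symmetric] integral_Im[OF wi] integral_Im[OF ci])
  qed
  then obtain m2 where m2: "\<And>x. Im (w x) = m2 * (- sinh (x - \<alpha>) / (cosh (x - \<alpha>))\<^sup>2)" by blast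
  have "w x = Complex m1 m2 * of_real (- sinh (x - \<alpha>) / (cosh (x - \<alpha>))\<^sup>2)" for x
    using m1[of x] m2[of x] by (simp add: complex_eq_iff)
  with pw show ?thesis by (intro exI[of _ "Complex m1 m2"]) simp
qed

section \<open>The weak derivative and the final statement\<close>

lemma integrable_compact_support:
  fixes f :: "real \<Rightarrow> real"
  assumes f: "\<And>x. isCont f x" and R: "\<And>x. \<bar>x\<bar> > R \<Longrightarrow> f x = 0"
  shows "integrable lborel f"
proof -
  have "set_integrable lborel {- R..R} f"
    using f by (intro borel_integrable_atLeastAtMost') (simp add: continuous_at_imp_continuous_on)
  moreover have "indicator {- R..R} x *\<^sub>R f x = f x" for x
    using R[of x] by (cases "\<bar>x\<bar> \<le> R") (auto simp: indicator_def)
  ultimately show ?thesis unfolding set_integrable_def by (simp only:)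
qed

text \<open>Integration by parts for the smooth representative; the boundary terms vanish because
  the test function has bounded support.\<close>

lemma has_weak_derivative_of_smooth:
  fixes Q S S' :: "real \<Rightarrow> real"
  assumes [measurable]: "Q \<in> borel_measurable borel" and Q: "AE t in lborel. Q t = S t"
    and S: "\<And>x. (S has_real_derivative S' x) (at x)" and S': "\<And>x. isCont S' x"
  shows "has_weak_derivative Q S'"
proof -
  have Sc: "isCont S x" for x using S by (rule DERIV_isCont)
  have [measurable]: "S \<in> borel_measurable borel"
    by (rule borel_measurable_continuous_onI) (simp add: continuous_at_imp_continuous_on Sc)
  have "set_integrable lborel {a..b} Q" for a b
  proof -
    have "set_integrable lborel {a..b} S"
      by (intro borel_integrable_atLeastAtMost') (simp add: continuous_at_imp_continuous_on Sc)
    moreover have "AE t in lborel. indicator {a..b} t *\<^sub>R S t = indicator {a..b} t *\<^sub>R Q t"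
      using Q by eventually_elim simp
    ultimately show ?thesis
      unfolding set_integrable_def by (subst (asm) integrable_cong_AE) auto
  qed
  moreover have "set_integrable lborel {a..b} S'" for a b
    by (intro borel_integrable_atLeastAtMost') (simp add: continuous_at_imp_continuous_on S')
  moreover have "(LINT t|lborel. Q t * deriv \<phi> t) = - (LINT t|lborel. S' t * \<phi> t)" if phi: "test_function \<phi>" for \<phi>
  proof -
    obtain R where R: "\<And>t. \<bar>t\<bar> > R \<Longrightarrow> \<phi> t = 0" using phi by (auto simp: test_function_def)
    have diff: "(deriv ^^ k) \<phi> differentiable (at t)" for k t using phi by (simp add: test_function_def)
    have d: "(\<phi> has_real_derivative deriv \<phi> t) (at t)" for t
      using diff[of 0 t] by (simp add: DERIV_deriv_iff_real_differentiable)
    have pc: "isCont \<phi> t" for t using d by (rule DERIV_isCont)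
    have dc: "isCont (deriv \<phi>) t" for t
      using diff[of 1 t] by (simp add: differentiable_imp_continuous_within)
    have dR: "deriv \<phi> t = 0" if "\<bar>t\<bar> > R" for t
    proof (rule DERIV_unique[OF d])
      have "open {t. \<bar>t\<bar> > R}" by (intro open_Collect_less continuous_intros)
      then show "(\<phi> has_real_derivative 0) (at t)"
        using that R by (intro has_field_derivative_transform_within_open[OF DERIV_const[of 0], where S="{t. \<bar>t\<bar> > R}"]) auto
    qed
    have [measurable]: "deriv \<phi> \<in> borel_measurable borel"
      by (rule borel_measurable_continuous_onI) (simp add: continuous_at_imp_continuous_on dc)
    have i1: "integrable lborel (\<lambda>t. S t * deriv \<phi> t)" and i2: "integrable lborel (\<lambda>t. S' t * \<phi> t)"
      using R dR by (intro integrable_compact_support[where R=R] continuous_mult Sc dc S' pc; simp)+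
    have lim: "((\<lambda>t. S t * \<phi> t) \<longlongrightarrow> 0) at_bot" "((\<lambda>t. S t * \<phi> t) \<longlongrightarrow> 0) at_top"
    proof -
      have "\<forall>\<^sub>F t in at_bot. S t * \<phi> t = 0" "\<forall>\<^sub>F t in at_top. S t * \<phi> t = 0"
        by (rule eventually_mono[OF eventually_gt_at_bot[of "- \<bar>R\<bar>"]], simp add: R,
            rule eventually_mono[OF eventually_gt_at_top[of "\<bar>R\<bar>"]], simp add: R)
      then show "((\<lambda>t. S t * \<phi> t) \<longlongrightarrow> 0) at_bot" "((\<lambda>t. S t * \<phi> t) \<longlongrightarrow> 0) at_top"
        by (auto intro: tendsto_eventually)
    qed
    have "(LINT t|lborel. S' t * \<phi> t + S t * deriv \<phi> t) = 0 - 0"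
    proof (rule integral_FTC_UNIV[OF has_real_derivative_vector _ _ lim])
      show "((\<lambda>t. S t * \<phi> t) has_real_derivative S' t * \<phi> t + S t * deriv \<phi> t) (at t)" for t
        using DERIV_mult[OF S d, of t] by (simp add: mult.commute)
      show "isCont (\<lambda>t. S' t * \<phi> t + S t * deriv \<phi> t) t" for t
        by (intro continuous_intros Sc dc S' pc)
    qed (intro Bochner_Integration.integrable_add i1 i2)
    then have "(LINT t|lborel. S t * deriv \<phi> t) = - (LINT t|lborel. S' t * \<phi> t)"
      using i1 i2 by simp
    moreover have "(LINT t|lborel. Q t * deriv \<phi> t) = (LINT t|lborel. S t * deriv \<phi> t)"
      by (rule integral_cong_AE) (use Q in \<open>auto elim: eventually_mono\<close>)
    ultimately show ?thesis by simp
  qed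
  ultimately show ?thesis by (simp add: has_weak_derivative_def)
qed

theorem theorem2p2:
  fixes Q :: "real \<Rightarrow> real"
  assumes "(\<lambda>t. complex_of_real (Q t)) \<in> H_half"
    and "AE t in lborel. Q t \<ge> 0"
    and "\<not> (AE t in lborel. Q t = 0)"
    and "solves_Q_equation Q"
  shows "(\<exists>\<alpha>::real. AE t in lborel. Q t = 1 / cosh (t - \<alpha>)) \<and>
    (\<exists>Q'. has_weak_derivative Q Q' \<and> (\<lambda>t. complex_of_real (Q' t)) \<in> L2 \<and>
       kernel_linearized Q = span_L2 (\<lambda>t. complex_of_real (Q' t)))"
proof -
  have QL2: "(\<lambda>t. complex_of_real (Q t)) \<in> L2" using assms(1) by (simp add: H_half_def)
  have [measurable]: "Q \<in> borel_measurable borel"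
    using L2_measurable[OF QL2] by (auto simp: borel_measurable_complex_iff)
  obtain a \<alpha> \<kappa> B where dp: "dtn_pair a (\<lambda>x. ift a x * ift a x)"
    and ua: "\<And>x. ift a x = of_real (1 / cosh (x - \<alpha>))"
    and Qa: "AE t in lborel. Q t = 1 / cosh (t - \<alpha>)"
    and Va: "\<And>x. primit (\<lambda>x. ift a x * ift a x) x = of_real (tanh (x - \<alpha>) + \<kappa>)"
    and gs: "ground_state (\<lambda>x. 1 / cosh (x - \<alpha>)) B"
    using soliton_classification[OF QL2 assms(3,4)] by blast
  define q where "q x = 1 / cosh (x - \<alpha>)" for x
  define Q' where "Q' x = - sinh (x - \<alpha>) / (cosh (x - \<alpha>))\<^sup>2" for x
  have na: "rapid a" using dp by (simp add: dtn_pair_def)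
  note ai = rapid_integrable[OF na]
  have uq: "ift a = (\<lambda>x. of_real (q x))" by (simp add: ua q_def fun_eq_iff)
  have ui: "integrable lborel (ift a)" using na by (simp add: rapid_def)
  have dq: "(q has_real_derivative Q' x) (at x)" for x
    unfolding q_def Q'_def by (rule sech_derivatives(3))
  have Q'c: "isCont Q' x" for x
    unfolding Q'_def by (intro continuous_intros) auto
  have [measurable]: "Q' \<in> borel_measurable borel" "q \<in> borel_measurable borel"
    unfolding Q'_def q_def cosh_def sinh_def by measurable
  have Q'_le: "\<bar>Q' x\<bar> \<le> q x" for x
  proof -
    have "\<bar>sinh (x - \<alpha>)\<bar> \<le> cosh (x - \<alpha>)"
      by (simp add: sinh_def cosh_def abs_le_iff)
    then have "\<bar>sinh (x - \<alpha>)\<bar> / (cosh (x - \<alpha>))\<^sup>2 \<le> cosh (x - \<alpha>) / (cosh (x - \<alpha>))\<^sup>2"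
      by (intro divide_right_mono) auto
    then show ?thesis by (simp add: Q'_def q_def power2_eq_square)
  qed
  have q_pos: "q x > 0" for x by (simp add: q_def)
  have q_int: "integrable lborel q" using integrable_Re[OF ui] by (simp add: uq)
  have q_sq: "integrable lborel (\<lambda>x. (q x)\<^sup>2)" using ground_state.Q_sq[OF gs] by (simp add: q_def)
  have Q'_int: "integrable lborel Q'"
    by (rule Bochner_Integration.integrable_bound[OF q_int]) (use Q'_le q_pos in \<open>auto simp: less_imp_le\<close>)
  have Q'_L2: "(\<lambda>t. complex_of_real (Q' t)) \<in> L2"
  proof (rule L2I)
    have "(Q' x)\<^sup>2 \<le> (q x)\<^sup>2" for x
      using power_mono[OF Q'_le[of x] abs_ge_zero, of 2] by simp
    then show "integrable lborel (\<lambda>t. (norm (complex_of_real (Q' t)))\<^sup>2)"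
      by (intro Bochner_Integration.integrable_bound[OF q_sq]) auto
  qed measurable
  have "((\<lambda>x. complex_of_real (q x)) has_vector_derivative of_real (Q' x)) (at x)" for x
    by (rule has_vector_derivative_of_real[OF dq])
  then have "(ift a has_vector_derivative of_real (Q' x)) (at x)" for x
    unfolding uq .
  from vector_derivative_unique_at[OF rapid_has_derivative[OF na] this]
  have u': "ift' a = (\<lambda>x. of_real (Q' x))" by (simp add: fun_eq_iff)
  have "((\<lambda>x. ift a x * ift a x) has_vector_derivative ift a x * ift' a x + ift' a x * ift a x) (at x)" for x
    by (rule has_vector_derivative_mult[OF rapid_has_derivative[OF na] rapid_has_derivative[OF na]])
  from vector_derivative_unique_at[OF this dtn_derivative(1)[OF dp], symmetric]
  have b': "ift' (\<lambda>\<tau>. of_real (tau_coth \<tau>) * a \<tau>) = (\<lambda>x. 2 * (of_real (q x) * of_real (Q' x)))"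
    by (simp add: fun_eq_iff u' uq mult.commute)
  \<comment> \<open>The derivative of Q^2. Differentiating D Q = Q^2 gives D Q' = \<open>h\<close> =
    2 Q Q', which is what places Q' in the kernel.\<close>
  define h where "h x = 2 * (complex_of_real (q x) * of_real (Q' x))" for x
  have Q'_eq: "complex_of_real (Q' x) = gconv h x" for x
    using dtn_derivative(2)[OF dp, of x] by (simp add: u' b' h_def[abs_def])
  have h_int: "integrable lborel h"
  proof -
    have "(\<lambda>x. complex_of_real (q x)) \<in> L2" using q_sq by (intro L2I) auto
    then show ?thesis unfolding h_def by (intro integrable_mult_right L2_mult_integrable Q'_L2)
  qed
  have Q'_intc: "integrable lborel (\<lambda>x. complex_of_real (Q' x))" using Q'_int by simp
  have FQ': "fourier_integral (\<lambda>x. complex_of_real (Q' x)) \<tau> = fourier_integral h \<tau> / of_real (tau_coth \<tau>)" for \<tau>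
    using fourier_integral_gconv[OF h_int] by (simp add: Q'_eq)
  have "kernel_linearized Q = span_L2 (\<lambda>t. complex_of_real (Q' t))"
  proof (intro equalityI subsetI)
    fix \<psi> assume "\<psi> \<in> kernel_linearized Q"
    then obtain U where psi: "\<psi> \<in> L2" and U: "U \<in> L2"
      and FU: "AE \<tau> in lborel. fourier_L2 U \<tau> = complex_of_real (tau_coth \<tau> - 2 / pi) * fourier_L2 \<psi> \<tau>"
      and eq: "AE t in lborel. U t - 2 * complex_of_real (Q t) * \<psi> t + complex_of_real (2 / pi) * \<psi> t = 0"
      by (auto simp: kernel_linearized_def T_graph_def)
    have [measurable]: "\<psi> \<in> borel_measurable borel" using L2_measurable[OF psi] by simp
    define g where "g t = 2 * (complex_of_real (q t) * \<psi> t)" for t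
    \<comment> \<open>Moving the constant 2/\<pi> of T to the other side turns the kernel equation
      into D \<psi> = 2 Q \<psi>. The right side is integrable as a product of L2 functions, and it
      is in L2 because this identity expresses it by U and \<psi>.\<close>
    have g_eq: "AE t in lborel. g t = U t + of_real (2 / pi) * \<psi> t"
      using eq Qa
    proof eventually_elim
      case (elim t)
      then have "U t + complex_of_real (2 / pi) * \<psi> t = 2 * complex_of_real (Q t) * \<psi> t" by (simp add: algebra_simps)
      then show ?case using elim by (simp add: g_def q_def)
    qed
    have qL2: "(\<lambda>x. complex_of_real (q x)) \<in> L2" using q_sq by (intro L2I) auto
    have g_int: "integrable lborel g"
      unfolding g_def by (intro integrable_mult_right L2_mult_integrable qL2 psi)
    have g_L2: "g \<in> L2"
      by (rule L2_cong_AE[OF L2_add[OF U L2_cmult[OF psi]] g_eq]) (use g_int in auto)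
    have "AE \<tau> in lborel. fourier_L2 U \<tau> + of_real (2 / pi) * fourier_L2 \<psi> \<tau> = fourier_integral g \<tau>"
      by (rule fourier_L2_linear[OF U psi g_L2 g_int g_eq])
    with FU have "AE \<tau> in lborel. fourier_L2 \<psi> \<tau> = fourier_integral (gconv g) \<tau>"
    proof eventually_elim
      case (elim \<tau>)
      then have "of_real (tau_coth \<tau>) * fourier_L2 \<psi> \<tau> = fourier_integral g \<tau>"
        by (simp add: algebra_simps)
      moreover have "complex_of_real (tau_coth \<tau>) \<noteq> 0" using tau_coth_lower(2)[of \<tau>] by simp
      ultimately show ?case by (simp add: fourier_integral_gconv[OF g_int] field_simps)
    qed
    then have "AE t in lborel. \<psi> t = gconv g t"
      by (rule eq_of_fourier_L2_eq_fourier_integral[OF psi integrable_gconv[OF g_int]])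
    then have "AE t in lborel. \<psi> t = gconv (\<lambda>y. 2 * (of_real (1 / cosh (y - \<alpha>)) * \<psi> y)) t"
      by (simp only: g_def[abs_def] q_def)
    from linearized_kernel[OF dp ua Va gs psi this] psi
    show "\<psi> \<in> span_L2 (\<lambda>t. complex_of_real (Q' t))"
      unfolding span_L2_def Q'_def by blast
  next
    fix \<psi> assume "\<psi> \<in> span_L2 (\<lambda>t. complex_of_real (Q' t))"
    then obtain c where psi: "\<psi> \<in> L2" and c: "AE t in lborel. \<psi> t = c * of_real (Q' t)"
      by (auto simp: span_L2_def)
    have [measurable]: "\<psi> \<in> borel_measurable borel" using L2_measurable[OF psi] by simp
    \<comment> \<open>\<open>U\<close> is the value that the kernel equation forces on T \<psi>;
      \<open>W\<close> is its explicit form, whose integrability and transform can be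
      computed.\<close>
    define U where "U t = 2 * complex_of_real (Q t) * \<psi> t - of_real (2 / pi) * \<psi> t" for t
    define W where "W t = c * h t - (c * of_real (2 / pi)) * of_real (Q' t)" for t
    have UW: "AE t in lborel. U t = W t"
      using c Qa by eventually_elim (simp add: U_def W_def h_def q_def algebra_simps)
    have W_int: "integrable lborel W"
      unfolding W_def by (intro Bochner_Integration.integrable_diff integrable_mult_right h_int Q'_intc)
    have Um [measurable]: "U \<in> borel_measurable borel" unfolding U_def by measurable
    have hm [measurable]: "h \<in> borel_measurable borel" unfolding h_def by measurable
    have Wm [measurable]: "W \<in> borel_measurable borel" unfolding W_def by measurable
    have h_L2: "h \<in> L2"
    proof (rule L2I)
      have "norm (q x) \<le> B" for x using ground_state.Q_le[OF gs, of x] q_pos[of x] by (simp add: q_def)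
      then have "integrable lborel (\<lambda>x. q x * (q x * (Q' x)\<^sup>2))"
        using integrable_bounded_mult[OF integrable_bounded_mult[OF L2_integrable[OF Q'_L2]], of q B q B] by simp
      then have "integrable lborel (\<lambda>x. 4 * (q x * (q x * (Q' x)\<^sup>2)))" by (rule integrable_mult_right)
      then show "integrable lborel (\<lambda>x. (norm (h x))\<^sup>2)"
        using q_pos by (simp add: h_def norm_mult power_mult_distrib power2_eq_square[of "q _"] mult.assoc less_imp_le)
    qed measurable
    have W_L2: "W \<in> L2"
      unfolding W_def by (intro L2_diff L2_cmult h_L2 Q'_L2)
    have U_L2: "U \<in> L2" by (rule L2_cong_AE[OF W_L2 UW]) measurable
    have U_int: "integrable lborel U" using integrable_cong_AE[OF _ _ UW] W_int by simp
    have psi_int: "integrable lborel \<psi>" using integrable_cong_AE[OF _ _ c] Q'_intc by simp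
    have Fpsi: "fourier_integral \<psi> \<tau> = c * fourier_integral (\<lambda>x. complex_of_real (Q' x)) \<tau>" for \<tau>
      using fourier_integral_cong_AE[OF c] by (simp add: fourier_integral_cmult)
    have FUt: "fourier_integral U \<tau> = complex_of_real (tau_coth \<tau> - 2 / pi) * fourier_integral \<psi> \<tau>" for \<tau>
    proof -
      have "fourier_integral U \<tau> = fourier_integral W \<tau>"
        by (rule fourier_integral_cong_AE[OF UW]) auto
      also have "\<dots> = c * fourier_integral h \<tau> - (c * of_real (2 / pi)) * fourier_integral (\<lambda>x. complex_of_real (Q' x)) \<tau>"
        unfolding W_def
        by (subst fourier_integral_diff) (intro integrable_mult_right h_int Q'_intc, intro integrable_mult_right h_int Q'_intc, simp only: fourier_integral_cmult)
      also have "fourier_integral h \<tau> = of_real (tau_coth \<tau>) * fourier_integral (\<lambda>x. complex_of_real (Q' x)) \<tau>"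
        using tau_coth_lower(2)[of \<tau>] by (simp add: FQ')
      finally show ?thesis by (simp add: Fpsi algebra_simps)
    qed
    have "AE \<tau> in lborel. fourier_L2 U \<tau> = complex_of_real (tau_coth \<tau> - 2 / pi) * fourier_L2 \<psi> \<tau>"
      using fourier_L2_eq_fourier_integral[OF U_L2 U_int] fourier_L2_eq_fourier_integral[OF psi psi_int]
      by eventually_elim (simp only: FUt)
    then have "(\<psi>, U) \<in> T_graph" using psi U_L2 by (simp add: T_graph_def)
    then show "\<psi> \<in> kernel_linearized Q"
      unfolding kernel_linearized_def by (auto simp: U_def intro!: exI[of _ U])
  qed
  moreover have "has_weak_derivative Q Q'"
    by (rule has_weak_derivative_of_smooth[OF _ _ dq Q'c]) (use Qa in \<open>auto simp: q_def\<close>)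
  ultimately show ?thesis using Qa Q'_L2 by blast
qed

end
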